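(* Assume (LimG): almost surely, for each $x\in\mathbb{Z}^d$ the geodesics $G(x,ne_1)$ have a limit $\Gamma(x)$ as $n\to\infty$, and moreover the paths $\Gamma(x)$, $x\in\mathbb{Z}^d$, all coalesce. Then there is some $\delta>0$ such that, for each $x\in\mathbb{Z}^d$, $\Theta(\Gamma(x))\cap S_\delta=\varnothing$ almost surely, where $$S_\delta=\{z\in\mathbb{S}^{d-1}:\ |z+e_1|<\delta\}.$$
   Context: First-passage percolation (FPP) on $\mathbb{Z}^d$, $d\ge 2$: $\mathcal{E}^d$ is the set of nearest-neighbor edges of $\mathbb{Z}^d$; the edge weights $(t_e)_{e\in\mathcal{E}^d}$ are i.i.d. nonnegative random variables with common distribution $F$ and joint distribution $\mathbb{P}$. For a finite nearest-neighbor path $\gamma$, $T(\gamma)=\sum_{e\in\gamma}t_e$, and $T(x,y)=\inf_{\gamma}T(\gamma)$ over finite paths $\gamma$ from $x$ to $y$. A path $\gamma$ from $x$ to $y$ is a (finite) geodesic if $T(\gamma)=T(x,y)$. Standing assumptions: (1) $\mathbf{E}\min\{t_1,\dots,t_{2d}\}^d<\infty$, where $t_1,\dots,t_{2d}$ are i.i.d. with distribution $F$; (2) $F$ is continuous, i.e. $\mathbb{P}(t_e=a)=0$ for every real $a$. Under these assumptions there is almost surely a unique finite geodesic between each $x,y\in\mathbb{Z}^d$, denoted $G(x,y)$. A sequence of nearest-neighbor paths $(\gamma_n)$ converges to a path $\gamma$ if for each fixed $k$ and all large $n$, the first $k$ edges of $\gamma_n$ are identical with the first $k$ edges of $\gamma$.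 Infinite paths $\gamma,\gamma'$ coalesce if they become asymptotically identical, i.e. $|\gamma\triangle\gamma'|<\infty$. For an infinite geodesic $\gamma=(x_0,x_1,\dots)$, $\Theta(\gamma)\subseteq\mathbb{S}^{d-1}$ is the set of limit points of the sequence $(x_i/|x_i|)_i$, where $|\cdot|$ is the Euclidean norm. $e_1$ is the first standard basis vector. *)

theory Defs
  imports "HOL-Probability.Probability"
begin

text \<open>
  The lattice is \<open>int ^ 'd\<close>, of dimension \<open>CARD('d)\<close>. An edge is an unordered pair of
  neighbours. Below, \<open>w\<close> always stands for a single configuration of edge weights.
\<close>

definition adjacent :: "int ^ 'd \<Rightarrow> int ^ 'd \<Rightarrow> bool" where
  "adjacent x y \<longleftrightarrow> (\<Sum>i\<in>UNIV. \<bar>x $ i - y $ i\<bar>) = 1"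

definition edges :: "(int ^ 'd) set set" where
  "edges = {{x, y} | x y. adjacent x y}"

text \<open>A finite path is the nonempty list of its vertices; \<open>[x]\<close> is the path without edges at \<open>x\<close>.\<close>

definition path_from_to :: "int ^ 'd \<Rightarrow> int ^ 'd \<Rightarrow> (int ^ 'd) list \<Rightarrow> bool" where
  "path_from_to x y p \<longleftrightarrow> p \<noteq> [] \<and> hd p = x \<and> last p = y \<and> successively adjacent p"

definition path_edges :: "(int ^ 'd) list \<Rightarrow> (int ^ 'd) set list" where
  "path_edges p = map2 (\<lambda>x y. {x, y}) p (tl p)"

text \<open>
  An edge is counted as often as it is traversed. Summing over the set of edges instead would make
  retracing an edge free, and geodesics would not be unique.
\<close>

definition path_time :: "((int ^ 'd) set \<Rightarrow> real) \<Rightarrow> (int ^ 'd) list \<Rightarrow> real" where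
  "path_time w p = (\<Sum>e\<leftarrow>path_edges p. w e)"

definition passage_time :: "((int ^ 'd) set \<Rightarrow> real) \<Rightarrow> int ^ 'd \<Rightarrow> int ^ 'd \<Rightarrow> real" where
  "passage_time w x y = (INF p\<in>{p. path_from_to x y p}. path_time w p)"

definition is_geodesic :: "((int ^ 'd) set \<Rightarrow> real) \<Rightarrow> int ^ 'd \<Rightarrow> int ^ 'd \<Rightarrow> (int ^ 'd) list \<Rightarrow> bool"
  where "is_geodesic w x y p \<longleftrightarrow> path_from_to x y p \<and> path_time w p = passage_time w x y"

text \<open>Meaningful only where the geodesic exists and is unique, which holds almost surely.\<close>

definition geodesic :: "((int ^ 'd) set \<Rightarrow> real) \<Rightarrow> int ^ 'd \<Rightarrow> int ^ 'd \<Rightarrow> (int ^ 'd) list" where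
  "geodesic w x y = (THE p. is_geodesic w x y p)"

definition infinite_path :: "(nat \<Rightarrow> int ^ 'd) \<Rightarrow> bool" where
  "infinite_path \<gamma> \<longleftrightarrow> (\<forall>i. adjacent (\<gamma> i) (\<gamma> (Suc i)))"

definition infinite_path_edge :: "(nat \<Rightarrow> int ^ 'd) \<Rightarrow> nat \<Rightarrow> (int ^ 'd) set" where
  "infinite_path_edge \<gamma> i = {\<gamma> i, \<gamma> (Suc i)}"

text \<open>The equation forces \<open>p n\<close> to have at least \<open>k\<close> edges.\<close>

definition paths_converge :: "(nat \<Rightarrow> (int ^ 'd) list) \<Rightarrow> (nat \<Rightarrow> int ^ 'd) \<Rightarrow> bool" where
  "paths_converge p \<gamma> \<longleftrightarrow>
     (\<forall>k. \<forall>\<^sub>F n in sequentially. take k (path_edges (p n)) = map (infinite_path_edge \<gamma>) [0..<k])"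

definition coalesce :: "(nat \<Rightarrow> int ^ 'd) \<Rightarrow> (nat \<Rightarrow> int ^ 'd) \<Rightarrow> bool" where
  "coalesce \<gamma> \<gamma>' \<longleftrightarrow>
     finite (sym_diff (range (infinite_path_edge \<gamma>)) (range (infinite_path_edge \<gamma>')))"

text \<open>
  The coordinate \<open>j\<close> plays the role of the first one, so that \<open>axis j (int n)\<close> is the lattice
  point \<open>n e\<^sub>1\<close>.
\<close>

definition is_limit_geodesic ::
    "((int ^ 'd) set \<Rightarrow> real) \<Rightarrow> 'd \<Rightarrow> int ^ 'd \<Rightarrow> (nat \<Rightarrow> int ^ 'd) \<Rightarrow> bool" where
  "is_limit_geodesic w j x \<gamma> \<longleftrightarrow>
     infinite_path \<gamma> \<and> paths_converge (\<lambda>n. geodesic w x (axis j (int n))) \<gamma>"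

definition limit_geodesic :: "((int ^ 'd) set \<Rightarrow> real) \<Rightarrow> 'd \<Rightarrow> int ^ 'd \<Rightarrow> nat \<Rightarrow> int ^ 'd" where
  "limit_geodesic w j x = (THE \<gamma>. is_limit_geodesic w j x \<gamma>)"

definition real_vec :: "int ^ 'd \<Rightarrow> real ^ 'd" where
  "real_vec x = (\<chi> i. of_int (x $ i))"

text \<open>Here \<open>sgn v\<close> is \<open>v\<close> divided by its Euclidean norm, and \<open>sgn 0 = 0\<close>.\<close>

definition asymptotic_directions :: "(nat \<Rightarrow> int ^ 'd) \<Rightarrow> (real ^ 'd) set" where
  "asymptotic_directions \<gamma> =
     {z \<in> sphere 0 1. \<exists>r. strict_mono r \<and> (\<lambda>i. sgn (real_vec (\<gamma> (r i)))) \<longlonglongrightarrow> z}"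

end

theory Submission
  imports Defs
begin

text \<open>
  If \<open>\<Gamma>(x)\<close> had a direction close to \<open>- e\<^sub>1\<close>, it would pass, for infinitely many \<open>n\<close>, through a
  vertex \<open>v\<close> that can be joined to \<open>- n e\<^sub>1\<close> in time small compared with \<open>n\<close>. Since the geodesics
  from \<open>x\<close> to \<open>N e\<^sub>1\<close> run through \<open>v\<close>, and \<open>T(x, v)\<close> grows linearly, the Busemann function
  \<open>B(- n e\<^sub>1, 0) = lim (T(- n e\<^sub>1, N e\<^sub>1) - T(0, N e\<^sub>1))\<close> would be at most \<open>- c n\<close> infinitely often.
  Coalescence makes this limit exist, and \<open>B(- n e\<^sub>1, 0)\<close> is a sum of \<open>n\<close> stationary terms. On the
  shift-invariant event \<open>A\<close> of such a drift the maximal ergodic theorem bounds the integral of one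
  term by \<open>- c P(A)\<close>; but this integral is the limit of the increments of the nonnegative sequence
  \<open>E[T(0, N e\<^sub>1); A]\<close>, hence nonnegative, and so \<open>P(A) = 0\<close>. No ergodicity is needed.

  The moment assumption only yields tails of order \<open>s\<^sup>-\<^sup>3\<^sup>/\<^sup>2\<close> for the passage time between
  neighbours through three disjoint paths, so a fixed line of \<open>m\<close> sites is crossed in time \<open>O(m)\<close> only
  with probability \<open>1 - O(m\<^sup>-\<^sup>1\<^sup>/\<^sup>2)\<close>. This is too weak for a union bound over all starting points;
  but both ends of the connection can be chosen among many separated, hence independent, lines.
\<close>

section \<open>Paths and passage times\<close>

text \<open>The scales are as follows. If a direction of the limit path lies within
  \<open>1 / q\<close> of minus the axis vector, the path visits, for arbitrarily large
  \<open>m\<close>, the cube of radius \<open>2 m\<close> around the axis point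
  \<open>- q m\<close>. Connecting it to the axis costs \<open>O(m)\<close> with a constant
  independent of \<open>q\<close>, while the passage time from the start is at least of order
  \<open>q m\<close>. So a deterministic \<open>q\<close>, chosen from the constants alone, gives
  \<open>\<delta> = 1 / q\<close>. One end of the connection has to be a vertex of the limit path
  itself, since passage times add up exactly only there; it cannot be moved to a good line at will.
  Independent candidates exist nevertheless: the injective path leaves a cube of fixed size and
  crosses separated hyperplanes on its way out. The other end may be any of the axis points
  \<open>- (q m + 3 k)\<close> with \<open>k\<close> below a fixed bound, because the drift is
  needed for infinitely many \<open>n\<close> only. The argument takes place on the product space of
  edge weights, where translations preserve the measure; almost-sure statements are carried there
  and back at the end.\<close>

definition l1_norm :: "int ^ 'd \<Rightarrow> int" where
  "l1_norm x = (\<Sum>i\<in>UNIV. \<bar>x $ i\<bar>)"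

lemma l1_norm_nonneg: "0 \<le> l1_norm x"
  by (simp add: l1_norm_def sum_nonneg)

lemma l1_norm_triangle: "l1_norm (x + y) \<le> l1_norm x + l1_norm y"
  unfolding l1_norm_def by (auto simp: sum.distrib[symmetric] intro!: sum_mono abs_triangle_ineq)

lemma l1_norm_minus_commute: "l1_norm (x - y) = l1_norm (y - x)"
  unfolding l1_norm_def by (simp add: abs_minus_commute)

lemma component_le_l1_norm: "\<bar>x $ i\<bar> \<le> l1_norm x"
  unfolding l1_norm_def by (rule member_le_sum) auto

lemma adjacent_iff: "adjacent x y \<longleftrightarrow> l1_norm (x - y) = 1"
  by (simp add: adjacent_def l1_norm_def)

lemma adjacent_sym: "adjacent x y \<longleftrightarrow> adjacent y x"
  by (simp add: adjacent_iff l1_norm_minus_commute)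

lemma adjacent_translate [simp]: "adjacent (x + a) (y + a) \<longleftrightarrow> adjacent x y"
  by (simp add: adjacent_iff)

lemma adjacent_component: "adjacent x y \<Longrightarrow> \<bar>x $ i - y $ i\<bar> \<le> 1"
  using component_le_l1_norm[of "x - y" i] by (simp add: adjacent_iff)

lemma l1_norm_axis: "l1_norm (axis b k) = \<bar>k\<bar>"
  unfolding l1_norm_def axis_def by (simp add: if_distrib[of abs] cong: if_cong)

lemma adjacent_axis: "\<bar>k\<bar> = 1 \<Longrightarrow> adjacent x (x + axis b k)" "\<bar>k\<bar> = 1 \<Longrightarrow> adjacent (x + axis b k) x"
  using l1_norm_minus_commute[of "x + axis b k" x] by (simp_all add: adjacent_iff l1_norm_axis)

lemma edge_iff: "{x, y} \<in> edges \<longleftrightarrow> adjacent x y"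
  using adjacent_sym unfolding edges_def by (auto simp: doubleton_eq_iff)

section \<open>Edge lists and times of finite paths\<close>

lemma path_edges_simps [simp]:
  "path_edges [] = []" "path_edges [x] = []"
  "path_edges (x # y # p) = {x, y} # path_edges (y # p)"
  by (simp_all add: path_edges_def)

lemma length_path_edges [simp]: "length (path_edges p) = length p - 1"
  by (simp add: path_edges_def)

lemma nth_path_edges: "Suc i < length p \<Longrightarrow> path_edges p ! i = {p ! i, p ! Suc i}"
  by (cases p) (auto simp: path_edges_def nth_tl nth_Cons split: nat.splits)

lemma path_edges_append:
  "path_edges (xs @ v # ys) = path_edges (xs @ [v]) @ path_edges (v # ys)"
proof (induction xs)
  case (Cons a xs)
  then show ?case by (cases xs) auto
qed simp

lemma path_edges_rev: "path_edges (rev p) = rev (path_edges p)"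
proof (induction p rule: induct_list012)
  case (3 x y zs)
  then show ?case
    using path_edges_append[of "rev zs" y "[x]"] by (simp add: insert_commute)
qed simp_all

lemma path_time_simps [simp]:
  "path_time w [] = 0" "path_time w [x] = 0"
  "path_time w (x # y # p) = w {x, y} + path_time w (y # p)"
  by (simp_all add: path_time_def)

lemma path_time_append: "path_time w (xs @ v # ys) = path_time w (xs @ [v]) + path_time w (v # ys)"
  unfolding path_time_def by (subst path_edges_append) simp

lemma path_time_rev: "path_time w (rev p) = path_time w p"
  by (simp add: path_time_def path_edges_rev sum_list_rev flip: rev_map)

lemma path_from_to_append:
  "path_from_to x y (xs @ v # ys) \<longleftrightarrow> path_from_to x v (xs @ [v]) \<and> path_from_to v y (v # ys)"
  by (cases xs; cases ys)
    (auto simp: path_from_to_def successively_append_iff successively_Cons hd_append)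

lemma path_from_to_rev: "path_from_to x y p \<Longrightarrow> path_from_to y x (rev p)"
  by (auto simp: path_from_to_def hd_rev last_rev adjacent_sym cong: successively_cong
      elim!: successively_mono)

lemma path_from_to_Cons:
  "path_from_to x y (x # p) \<longleftrightarrow> (if p = [] then x = y else adjacent x (hd p) \<and> path_from_to (hd p) y p)"
  by (cases p) (auto simp: path_from_to_def)

lemma path_edges_subset: "successively adjacent p \<Longrightarrow> set (path_edges p) \<subseteq> edges"
  by (induction p rule: induct_list012) (auto simp: edge_iff)

lemma path_from_to_edges: "path_from_to x y p \<Longrightarrow> set (path_edges p) \<subseteq> edges"
  by (simp add: path_from_to_def path_edges_subset)

lemma path_edge_vertices: "e \<in> set (path_edges p) \<Longrightarrow> e \<subseteq> set p"
  by (induction p rule: induct_list012) auto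

lemma distinct_path_edges: "distinct p \<Longrightarrow> distinct (path_edges p)"
proof (induction p rule: induct_list012)
  case (3 x y zs)
  then show ?case using path_edge_vertices[of "{x, y}" "y # zs"] by auto
qed simp_all

lemma path_time_distinct: "distinct p \<Longrightarrow> path_time w p = (\<Sum>e\<in>set (path_edges p). w e)"
  by (simp add: path_time_def sum_list_distinct_conv_sum_set distinct_path_edges)

lemma path_time_cong: "(\<And>e. e \<in> edges \<Longrightarrow> w e = w' e) \<Longrightarrow> path_from_to x y p \<Longrightarrow>
    path_time w p = path_time w' p"
  unfolding path_time_def by (metis map_cong path_from_to_edges subsetD)

lemma path_from_to_length: "path_from_to x y p \<Longrightarrow> l1_norm (x - y) \<le> int (length p) - 1"
proof (induction p arbitrary: x)
  case (Cons a p)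
  have [simp]: "a = x" using Cons.prems by (auto simp: path_from_to_def)
  show ?case
  proof (cases "p = []")
    case False
    then have "adjacent x (hd p)" "path_from_to (hd p) y p"
      using Cons.prems by (simp_all add: path_from_to_Cons)
    with Cons.IH[of "hd p"] l1_norm_triangle[of "x - hd p" "hd p - y"] show ?thesis
      by (simp add: adjacent_iff)
  qed (use Cons.prems in \<open>auto simp: path_from_to_def l1_norm_def\<close>)
qed (simp add: path_from_to_def)

lemma path_exists: "\<exists>p. path_from_to x y p"
proof (induction "nat (l1_norm (x - y))" arbitrary: x rule: less_induct)
  case less
  show ?case
  proof (cases "x = y")
    case True
    then show ?thesis by (intro exI[of _ "[x]"]) (auto simp: path_from_to_def)
  next
    case False
    then obtain i where i: "x $ i \<noteq> y $ i" by (auto simp: vec_eq_iff)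
    define x' where "x' = x + axis i (sgn (y $ i - x $ i))"
    have adj: "adjacent x x'" unfolding x'_def using i by (intro adjacent_axis) (auto simp: sgn_if)
    have "l1_norm (x' - y) < l1_norm (x - y)"
      unfolding l1_norm_def
    proof (rule sum_strict_mono_ex1)
      show "\<exists>k\<in>UNIV. \<bar>(x' - y) $ k\<bar> < \<bar>(x - y) $ k\<bar>"
        using i by (intro bexI[of _ i]) (auto simp: x'_def axis_def sgn_if)
    qed (use i in \<open>auto simp: x'_def axis_def sgn_if\<close>)
    then have "nat (l1_norm (x' - y)) < nat (l1_norm (x - y))"
      using l1_norm_nonneg[of "x' - y"] by linarith
    from less[OF this] obtain p where p: "path_from_to x' y p" ..
    then have "path_from_to x y (x # p)"
      using adj by (auto simp: path_from_to_Cons) (auto simp: path_from_to_def)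
    then show ?thesis ..
  qed
qed

section \<open>Passage times as a pseudometric, and simple paths\<close>

definition nonneg_weights :: "((int ^ 'd) set \<Rightarrow> real) \<Rightarrow> bool" where
  "nonneg_weights w \<longleftrightarrow> (\<forall>e\<in>edges. 0 \<le> w e)"

definition pos_weights :: "((int ^ 'd) set \<Rightarrow> real) \<Rightarrow> bool" where
  "pos_weights w \<longleftrightarrow> (\<forall>e\<in>edges. 0 < w e)"

lemma pos_imp_nonneg_weights: "pos_weights w \<Longrightarrow> nonneg_weights w"
  by (auto simp: pos_weights_def nonneg_weights_def less_imp_le)

lemma path_time_nonneg: "nonneg_weights w \<Longrightarrow> successively adjacent p \<Longrightarrow> 0 \<le> path_time w p"
  by (induction p rule: induct_list012) (auto simp: nonneg_weights_def edge_iff)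

lemma path_time_pos:
  "pos_weights w \<Longrightarrow> successively adjacent p \<Longrightarrow> 2 \<le> length p \<Longrightarrow> 0 < path_time w p"
proof (induction p rule: induct_list012)
  case (3 x y zs)
  then show ?case
    using path_time_nonneg[of w "y # zs"] pos_imp_nonneg_weights[of w]
    by (auto simp: pos_weights_def edge_iff intro!: add_pos_nonneg)
qed auto

lemma passage_time_bdd_below: "nonneg_weights w \<Longrightarrow> bdd_below (path_time w ` {p. path_from_to x y p})"
  by (rule bdd_belowI2[of _ 0]) (auto simp: path_from_to_def path_time_nonneg)

lemma passage_time_le: "nonneg_weights w \<Longrightarrow> path_from_to x y p \<Longrightarrow> passage_time w x y \<le> path_time w p"
  unfolding passage_time_def by (rule cINF_lower) (auto intro: passage_time_bdd_below)

lemma passage_time_greatest: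
  "(\<And>p. path_from_to x y p \<Longrightarrow> a \<le> path_time w p) \<Longrightarrow> a \<le> passage_time w x y"
  unfolding passage_time_def using path_exists by (intro cINF_greatest) auto

lemma passage_time_nonneg: "nonneg_weights w \<Longrightarrow> 0 \<le> passage_time w x y"
  by (rule passage_time_greatest) (auto simp: path_from_to_def path_time_nonneg)

lemma passage_time_cong:
  assumes "\<And>e. e \<in> edges \<Longrightarrow> w e = w' e"
  shows "passage_time w x y = passage_time w' x y"
  unfolding passage_time_def using assms by (intro INF_cong) (auto intro: path_time_cong)

lemma passage_time_sym: "passage_time w x y = passage_time w y x"
proof -
  have "path_time w ` {p. path_from_to x y p} = path_time w ` {p. path_from_to y x p}"
    by (auto simp: image_iff) (metis path_from_to_rev path_time_rev)+
  then show ?thesis by (simp add: passage_time_def)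
qed

lemma passage_time_triangle:
  assumes w: "nonneg_weights w"
  shows "passage_time w x z \<le> passage_time w x y + passage_time w y z"
proof -
  have *: "passage_time w x z \<le> path_time w p + path_time w q"
    if p: "path_from_to x y p" and q: "path_from_to y z q" for p q
  proof -
    have p': "butlast p @ [y] = p" using p by (auto simp: path_from_to_def)
    have q': "y # tl q = q" using q by (cases q) (auto simp: path_from_to_def)
    have "path_from_to x z (butlast p @ y # tl q)"
      using p q path_from_to_append[of x z "butlast p" y "tl q"] by (simp only: p' q' simp_thms)
    then have "passage_time w x z \<le> path_time w (butlast p @ y # tl q)"
      by (rule passage_time_le[OF w])
    then show ?thesis by (subst (asm) path_time_append) (simp only: p' q')
  qed
  \<comment> \<open>An infimum need not be attained here, so the two infima are taken one after the
    other.\<close>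
  have "passage_time w x z - path_time w p \<le> passage_time w y z" if "path_from_to x y p" for p
    using *[OF that] by (intro passage_time_greatest) (simp add: algebra_simps)
  then have "passage_time w x z - passage_time w y z \<le> passage_time w x y"
    by (intro passage_time_greatest) (simp add: algebra_simps)
  then show ?thesis by simp
qed

lemma passage_time_refl: "nonneg_weights w \<Longrightarrow> passage_time w x x = 0"
  using passage_time_le[of w x x "[x]"] passage_time_nonneg[of w x x]
  by (auto simp: path_from_to_def)

lemma path_from_to_translate:
  "path_from_to (x + a) (y + a) (map (\<lambda>v. v + a) p) \<longleftrightarrow> path_from_to x y p"
  by (auto simp: path_from_to_def hd_map last_map successively_map)

lemma path_time_translate:
  "successively adjacent p \<Longrightarrow>
    path_time w (map (\<lambda>v. v + a) p) = path_time (\<lambda>e\<in>edges. w ((\<lambda>v. v + a) ` e)) p"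
  by (induction p rule: induct_list012) (auto simp: edge_iff)

text \<open>The restriction to \<open>edges\<close> keeps the translated configuration in the
  product space and is harmless because paths use only edges.\<close>

lemma passage_time_translate:
  "passage_time (\<lambda>e\<in>edges. w ((\<lambda>v. v + a) ` e)) x y = passage_time w (x + a) (y + a)"
proof -
  have "path_from_to (x + a) (y + a) q \<longleftrightarrow> (\<exists>p. path_from_to x y p \<and> q = map (\<lambda>v. v + a) p)" for q
  proof
    assume q: "path_from_to (x + a) (y + a) q"
    have "q = map (\<lambda>v. v + a) (map (\<lambda>v. v - a) q)" by (simp add: comp_def)
    with q show "\<exists>p. path_from_to x y p \<and> q = map (\<lambda>v. v + a) p"
      by (metis path_from_to_translate)
  qed (auto simp: path_from_to_translate)
  then have "{p. path_from_to (x + a) (y + a) p} = map (\<lambda>v. v + a) ` {p. path_from_to x y p}"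
    by auto
  moreover have "(INF p\<in>{p. path_from_to x y p}. path_time (\<lambda>e\<in>edges. w ((\<lambda>v. v + a) ` e)) p) =
      (INF p\<in>{p. path_from_to x y p}. path_time w (map (\<lambda>v. v + a) p))"
    by (intro INF_cong refl) (simp add: path_from_to_def path_time_translate)
  ultimately show ?thesis
    by (simp add: passage_time_def image_image)
qed

text \<open>Cutting out the piece between two visits to a vertex removes a closed walk with at least
  one edge: its time is nonnegative, and positive under \<open>pos_weights\<close>. Optimal paths
  may therefore be sought among simple ones.\<close>

lemma loop_erasure:
  assumes w: "nonneg_weights w" and "path_from_to x y p"
  obtains q where "path_from_to x y q" "distinct q" "path_time w q \<le> path_time w p"
    "pos_weights w \<Longrightarrow> \<not> distinct p \<Longrightarrow> path_time w q < path_time w p"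
  using assms(2)
proof (induction "length p" arbitrary: p thesis rule: less_induct)
  case less
  show ?case
  proof (cases "distinct p")
    case False
    then obtain xs ys zs v where p: "p = xs @ [v] @ ys @ [v] @ zs"
      using not_distinct_decomp by blast
    define l where "l = v # ys @ [v]"
    have "path_from_to v y (v # ys @ v # zs)" "path_from_to x v (xs @ [v])"
      using less.prems(2) path_from_to_append[of x y xs v "ys @ v # zs"] by (simp_all add: p)
    then have q: "path_from_to x y (xs @ v # zs)" and "path_from_to v v (v # ys @ [v])"
      using path_from_to_append[of v y "v # ys" v zs] path_from_to_append[of x y xs v zs]
      by simp_all
    then have l: "successively adjacent l" "2 \<le> length l"
      by (auto simp: path_from_to_def l_def)
    have eq: "path_time w p = path_time w (xs @ v # zs) + path_time w l"
    proof -
      have "path_time w (v # ys @ v # zs) = path_time w l + path_time w (v # zs)"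
        using path_time_append[of w "v # ys" v zs] by (simp add: l_def)
      then show ?thesis
        using path_time_append[of w xs v "ys @ v # zs"] path_time_append[of w xs v zs]
        by (simp add: p)
    qed
    from less.hyps[OF _ _ q] obtain q where q: "path_from_to x y q" "distinct q"
        "path_time w q \<le> path_time w (xs @ v # zs)"
      by (auto simp: p)
    show ?thesis
    proof (rule less.prems(1)[OF q(1,2)])
      show "path_time w q \<le> path_time w p"
        using q(3) eq path_time_nonneg[OF w l(1)] by linarith
      show "path_time w q < path_time w p" if "pos_weights w"
        using q(3) eq path_time_pos[OF that l] by linarith
    qed
  qed (use less.prems in blast)
qed

lemma geodesic_distinct: "pos_weights w \<Longrightarrow> is_geodesic w x y p \<Longrightarrow> distinct p"
  unfolding is_geodesic_def
  by (metis loop_erasure passage_time_le pos_imp_nonneg_weights not_less)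

lemma geodesic_through:
  assumes w: "nonneg_weights w" and p: "is_geodesic w x y p" and v: "v \<in> set p"
  shows "passage_time w x y = passage_time w x v + passage_time w v y"
proof (rule antisym)
  obtain xs ys where p': "p = xs @ v # ys" using v by (auto simp: in_set_conv_decomp)
  have "path_from_to x v (xs @ [v])" "path_from_to v y (v # ys)"
    using p path_from_to_append[of x y xs v ys] by (simp_all add: is_geodesic_def p')
  then have "passage_time w x v + passage_time w v y \<le> path_time w (xs @ [v]) + path_time w (v # ys)"
    by (intro add_mono passage_time_le[OF w])
  also have "\<dots> = passage_time w x y"
    using p path_time_append[of w xs v ys] by (simp add: is_geodesic_def p')
  finally show "passage_time w x v + passage_time w v y \<le> passage_time w x y" .
qed (rule passage_time_triangle[OF w])

text \<open>The starting vertex of a simple path lies on its first edge only, so the first edges of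
  \<open>p\<close> and \<open>q\<close> agree and can be removed from both. For two different simple
  paths with common ends this supplies an edge of one that the other does not use.\<close>

lemma simple_path_determined_by_edges:
  assumes "distinct p" "distinct q" "p \<noteq> []" "q \<noteq> []" "hd p = hd q" "last p = last q"
    and "set (path_edges p) \<subseteq> set (path_edges q)"
  shows "p = q"
  using assms
proof (induction p arbitrary: q)
  case (Cons x p)
  obtain q' where q: "q = x # q'" using Cons.prems by (cases q) auto
  show ?case
  proof (cases "p = []")
    case True
    then show ?thesis using Cons.prems q by (cases "q' = []") auto
  next
    case False
    have sub: "{x, hd p} \<in> set (path_edges q)" "set (path_edges p) \<subseteq> set (path_edges q)"
      using Cons.prems(7) False by (cases p; auto)+
    then have "q' \<noteq> []" using q by (cases q') auto
    then have e: "path_edges q = {x, hd q'} # path_edges q'" using q by (cases q') auto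
    have x: "x \<notin> set p" "x \<notin> set q'" using Cons.prems q by auto
    have "{x, hd p} = {x, hd q'}"
      using sub(1) x(2) path_edge_vertices[of "{x, hd p}" q'] by (auto simp: e)
    then have hd: "hd p = hd q'" by (auto simp: doubleton_eq_iff)
    have "{x, hd q'} \<notin> set (path_edges p)"
      using x(1) path_edge_vertices[of "{x, hd q'}" p] by auto
    then have "set (path_edges p) \<subseteq> set (path_edges q')" using sub(2) e by auto
    with Cons.IH[of q'] Cons.prems q False \<open>q' \<noteq> []\<close> hd show ?thesis by auto
  qed
qed simp

lemma adjacent_cases:
  assumes "adjacent x y"
  obtains b s where "s \<in> {1, -1}" "y = x + axis b s"
proof -
  define z where "z = y - x"
  have l1: "(\<Sum>i\<in>UNIV. \<bar>z $ i\<bar>) = 1"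
    using assms l1_norm_minus_commute[of x y] by (simp add: adjacent_iff l1_norm_def z_def)
  then obtain b where b: "z $ b \<noteq> 0"
    by (metis abs_0 sum.neutral zero_neq_one)
  have "(\<Sum>i\<in>UNIV. \<bar>z $ i\<bar>) = \<bar>z $ b\<bar> + (\<Sum>i\<in>UNIV - {b}. \<bar>z $ i\<bar>)"
    by (rule sum.remove) auto
  moreover have nn: "0 \<le> (\<Sum>i\<in>UNIV - {b}. \<bar>z $ i\<bar>)" by (simp add: sum_nonneg)
  ultimately have zb: "\<bar>z $ b\<bar> = 1" and "(\<Sum>i\<in>UNIV - {b}. \<bar>z $ i\<bar>) = 0"
    using b l1 by linarith+
  then have "\<forall>i\<in>UNIV - {b}. \<bar>z $ i\<bar> = 0" by (subst (asm) sum_nonneg_eq_0_iff) auto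
  then have "z = axis b (z $ b)" by (auto simp: vec_eq_iff axis_def)
  then have "y = x + axis b (z $ b)" by (simp add: z_def algebra_simps)
  with zb show ?thesis by (intro that[of "z $ b" b]) (auto simp: abs_if split: if_splits)
qed

section \<open>Counting walks, and consequences of linear growth\<close>

definition walks :: "nat \<Rightarrow> int ^ 'd \<Rightarrow> (int ^ 'd) list set" where
  "walks n x = {p. p \<noteq> [] \<and> hd p = x \<and> successively adjacent p \<and> length p = Suc n}"

lemma walks_finite_card:
  fixes x :: "int ^ 'd"
  shows "finite (walks n x) \<and> card (walks n x) \<le> (2 * CARD('d)) ^ n"
proof (induction n arbitrary: x)
  case 0
  have "walks 0 x = {[x]}" by (auto simp: walks_def length_Suc_conv)
  then show ?case by simp
next
  case (Suc n)
  define N where "N = (\<lambda>(b, s). x + axis b s) ` ((UNIV :: 'd set) \<times> {1, -1})"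
  have N: "finite N" "card N \<le> 2 * CARD('d)"
    unfolding N_def by (simp, rule order.trans[OF card_image_le]) (auto simp: card_cartesian_product)
  have sub: "walks (Suc n) x \<subseteq> (\<Union>y\<in>N. (#) x ` walks n y)"
  proof
    fix p assume p: "p \<in> walks (Suc n) x"
    then have "p = x # tl p" "tl p \<noteq> []" by (cases p; auto simp: walks_def)+
    then obtain q where q: "p = x # q" "q \<noteq> []" by blast
    have "adjacent x (hd q)" "q \<in> walks n (hd q)"
      using p q by (cases q; auto simp: walks_def)+
    moreover from this(1) have "hd q \<in> N" unfolding N_def by (rule adjacent_cases) force
    ultimately show "p \<in> (\<Union>y\<in>N. (#) x ` walks n y)" using q by blast
  qed
  have fin: "finite (\<Union>y\<in>N. (#) x ` walks n y)" using N Suc by auto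
  have "card (walks (Suc n) x) \<le> (\<Sum>y\<in>N. card ((#) x ` walks n y))"
    using card_mono[OF fin sub] card_UN_le[OF N(1), of "\<lambda>y. (#) x ` walks n y"] by linarith
  also have "\<dots> \<le> (\<Sum>y\<in>N. (2 * CARD('d)) ^ n)"
    using Suc by (intro sum_mono order.trans[OF card_image_le]) auto
  also have "\<dots> \<le> (2 * CARD('d)) ^ Suc n" using N by simp
  finally show ?case using finite_subset[OF sub fin] by simp
qed

text \<open>Restricted to simple paths because their edges are distinct and so carry independent
  weights; loop erasure extends the consequences to all paths.\<close>

definition linear_growth :: "((int ^ 'd) set \<Rightarrow> real) \<Rightarrow> real \<Rightarrow> int ^ 'd \<Rightarrow> bool" where
  "linear_growth w c x \<longleftrightarrow>
     (\<forall>\<^sub>F n in sequentially. \<forall>p\<in>walks n x. distinct p \<longrightarrow> c * real n \<le> path_time w p)"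

text \<open>Long simple paths are no faster than a fixed path \<open>p0\<close>, so the infimum is a
  minimum over finitely many paths.\<close>

lemma geodesic_exists:
  assumes w: "nonneg_weights w" and c: "c > 0" and growth: "linear_growth w c x"
  shows "\<exists>p. is_geodesic w x y p"
proof -
  obtain p0 where p0: "path_from_to x y p0" "distinct p0"
    using path_exists loop_erasure[OF w] by metis
  obtain n0 where n0: "\<And>n p. n \<ge> n0 \<Longrightarrow> p \<in> walks n x \<Longrightarrow> distinct p \<Longrightarrow> c * real n \<le> path_time w p"
    using growth by (auto simp: linear_growth_def eventually_sequentially)
  \<comment> \<open>Beyond \<open>N\<close> edges, \<open>c * n\<close> is at least the time of
    \<open>p0\<close>. As \<open>p0\<close> may itself be longer than \<open>N\<close>, it is
    inserted into the finite set \<open>S\<close> separately.\<close>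
  define N where "N = max n0 (nat \<lceil>path_time w p0 / c\<rceil>)"
  define S where "S = insert p0 {p \<in> (\<Union>n\<in>{..N}. walks n x). path_from_to x y p}"
  have "finite (\<Union>n\<in>{..N}. walks n x)" using walks_finite_card by blast
  then have "finite S" "S \<noteq> {}" unfolding S_def by auto
  then obtain p where p: "p \<in> S" and min: "\<And>q. q \<in> S \<Longrightarrow> path_time w p \<le> path_time w q"
    using ex_min_if_finite[of "path_time w ` S"] by (force simp: not_less)
  have path: "path_from_to x y p" using p p0 by (auto simp: S_def)
  have "path_time w p \<le> passage_time w x y"
  proof (rule passage_time_greatest)
    fix q assume "path_from_to x y q"
    then obtain q' where q': "path_from_to x y q'" "distinct q'" "path_time w q' \<le> path_time w q"
      using loop_erasure[OF w] by metis
    define n where "n = length q' - 1"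
    have n: "q' \<in> walks n x" using q'(1) by (auto simp: walks_def path_from_to_def n_def)
    have "path_time w p \<le> path_time w q'"
    proof (cases "n \<le> N")
      case True
      then show ?thesis using q'(1) n by (intro min) (auto simp: S_def)
    next
      case False
      then have "path_time w p0 / c \<le> real n" unfolding N_def by linarith
      then have "path_time w p0 \<le> c * real n" using c by (simp add: field_simps)
      also have "\<dots> \<le> path_time w q'" using False n q' by (intro n0) (auto simp: N_def)
      finally show ?thesis using min[of p0] by (simp add: S_def)
    qed
    with q'(3) show "path_time w p \<le> path_time w q" by simp
  qed
  with path show ?thesis
    using passage_time_le[OF w path] by (auto simp: is_geodesic_def intro: antisym)
qed

text \<open>A path to \<open>y\<close> has at least \<open>l1_norm (x - y)\<close> edges, so growth
  in the number of edges becomes growth in the distance.\<close>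

lemma passage_time_lower_bound:
  assumes w: "nonneg_weights w" and c: "c > 0" and growth: "linear_growth w c x"
  obtains r where "\<And>y. r \<le> l1_norm (x - y) \<Longrightarrow> c * real_of_int (l1_norm (x - y)) \<le> passage_time w x y"
proof -
  obtain n0 where n0: "\<And>n p. n \<ge> n0 \<Longrightarrow> p \<in> walks n x \<Longrightarrow> distinct p \<Longrightarrow> c * real n \<le> path_time w p"
    using growth by (auto simp: linear_growth_def eventually_sequentially)
  show ?thesis
  proof (rule that[of "int n0"], rule passage_time_greatest)
    fix y p assume y: "int n0 \<le> l1_norm (x - y)" and "path_from_to x y p"
    then obtain q where q: "path_from_to x y q" "distinct q" "path_time w q \<le> path_time w p"
      using loop_erasure[OF w] by metis
    define n where "n = length q - 1"
    have n: "q \<in> walks n x" using q(1) by (auto simp: walks_def path_from_to_def n_def)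
    have l: "l1_norm (x - y) \<le> int n"
      using path_from_to_length[OF q(1)] q(1) by (cases q) (auto simp: n_def path_from_to_def)
    then have "c * real_of_int (l1_norm (x - y)) \<le> c * real n" using c by simp
    also have "\<dots> \<le> path_time w q" using y l n q by (intro n0) auto
    finally show "c * real_of_int (l1_norm (x - y)) \<le> path_time w p" using q(3) by simp
  qed
qed

section \<open>Limits of geodesics\<close>

definition unique_geodesics :: "((int ^ 'd) set \<Rightarrow> real) \<Rightarrow> bool" where
  "unique_geodesics w \<longleftrightarrow> (\<forall>x y. \<exists>!p. is_geodesic w x y p)"

lemma is_geodesic_geodesic: "unique_geodesics w \<Longrightarrow> is_geodesic w x y (geodesic w x y)"
  unfolding unique_geodesics_def geodesic_def by (metis theI')

text \<open>
  Convergence determines only the edges of the limit; as geodesics are simple, two consecutive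
  edges have a single common vertex.
\<close>

lemma limit_geodesic_prefix:
  assumes pos: "pos_weights w" and uniq: "unique_geodesics w" and lim: "is_limit_geodesic w j x \<gamma>"
  shows "\<forall>\<^sub>F n in sequentially. k < length (geodesic w x (axis j (int n))) \<and>
    (\<forall>i\<le>k. \<gamma> i = geodesic w x (axis j (int n)) ! i)"
proof -
  have "\<forall>\<^sub>F n in sequentially. take (k + 2) (path_edges (geodesic w x (axis j (int n)))) =
      map (infinite_path_edge \<gamma>) [0..<k + 2]"
    using lim unfolding is_limit_geodesic_def paths_converge_def by blast
  then show ?thesis
  proof eventually_elim
    case (elim n)
    define p where "p = geodesic w x (axis j (int n))"
    \<comment> \<open>Vertex \<open>Suc i\<close> is the common vertex of the edges \<open>i\<close>
      and \<open>Suc i\<close>; having this for all \<open>i \<le> k\<close> takes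
      \<open>k + 2\<close> edges.\<close>
    have eq: "take (k + 2) (path_edges p) = map (infinite_path_edge \<gamma>) [0..<k + 2]"
      using elim by (simp add: p_def)
    from arg_cong[OF this, of length] have len: "k + 2 < length p" by simp
    have dist: "distinct p"
      using geodesic_distinct[OF pos is_geodesic_geodesic[OF uniq]] by (simp add: p_def)
    have edge: "{p ! i, p ! Suc i} = {\<gamma> i, \<gamma> (Suc i)}" if "i < k + 2" for i
      using arg_cong[OF eq, of "\<lambda>l. l ! i"] that len
      by (simp add: nth_path_edges infinite_path_edge_def del: upt_Suc)
    have neq: "p ! i \<noteq> p ! i'" if "i \<le> k + 2" "i' \<le> k + 2" "i \<noteq> i'" for i i'
      using that len dist by (simp add: nth_eq_iff_index_eq)
    have S: "\<gamma> (Suc i) = p ! Suc i" if "i \<le> k" for i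
      using edge[of i] edge[of "Suc i"] neq[of i "Suc (Suc i)"] that
      by (auto simp: doubleton_eq_iff)
    \<comment> \<open>Vertex 0 is not shared by two edges; it is the other end of the first edge
      once vertex 1 is known.\<close>
    have "\<gamma> i = p ! i" if "i \<le> k" for i
    proof (cases i)
      case 0
      then show ?thesis using S[of 0] edge[of 0] neq[of 0 "Suc 0"] by (auto simp: doubleton_eq_iff)
    qed (use S that in auto)
    then show ?case using len by (simp add: p_def)
  qed
qed

context
  fixes w :: "(int ^ 'd) set \<Rightarrow> real" and j :: 'd and x :: "int ^ 'd" and \<gamma> :: "nat \<Rightarrow> int ^ 'd"
  assumes pos: "pos_weights w" and uniq: "unique_geodesics w" and lim: "is_limit_geodesic w j x \<gamma>"
begin

lemma limit_geodesic_inj: "inj \<gamma>"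
proof (rule injI)
  fix a b assume ab: "\<gamma> a = \<gamma> b"
  obtain n where n: "max a b < length (geodesic w x (axis j (int n)))"
     "\<forall>i\<le>max a b. \<gamma> i = geodesic w x (axis j (int n)) ! i"
    using eventually_happens[OF limit_geodesic_prefix[OF pos uniq lim, of "max a b"]] by auto
  then show "a = b"
    using ab geodesic_distinct[OF pos is_geodesic_geodesic[OF uniq, of x "axis j (int n)"]]
    by (simp add: nth_eq_iff_index_eq)
qed

lemma limit_geodesic_unique: "limit_geodesic w j x = \<gamma>"
  unfolding limit_geodesic_def
proof (rule the_equality)
  show "is_limit_geodesic w j x \<gamma>" by (fact lim)
  fix \<gamma>' assume lim': "is_limit_geodesic w j x \<gamma>'"
  have "\<gamma>' k = \<gamma> k" for k
    using eventually_happens[OF eventually_conj[OF limit_geodesic_prefix[OF pos uniq lim, of k]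
      limit_geodesic_prefix[OF pos uniq lim', of k]]] by auto
  then show "\<gamma>' = \<gamma>" by auto
qed

text \<open>Each vertex of the limit eventually lies on the approximating geodesics, and passage
  times are additive there. This exact identity turns a cheap connection to such a vertex into a
  bound on the Busemann function.\<close>

lemma limit_geodesic_additive:
  "\<forall>\<^sub>F n in sequentially. passage_time w x (axis j (int n)) =
     passage_time w x (\<gamma> k) + passage_time w (\<gamma> k) (axis j (int n))"
  using limit_geodesic_prefix[OF pos uniq lim, of k]
proof eventually_elim
  case (elim n)
  then have "\<gamma> k \<in> set (geodesic w x (axis j (int n)))" by simp
  then show ?case
    using geodesic_through[OF pos_imp_nonneg_weights[OF pos] is_geodesic_geodesic[OF uniq]] by blast
qed

end

text \<open>Paths without a common vertex have no common edge, so the symmetric difference would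
  contain all edges of \<open>\<gamma>\<close>, infinitely many by injectivity.\<close>

lemma coalescing_share_vertex:
  assumes "inj \<gamma>" and "coalesce \<gamma> \<gamma>'"
  shows "\<exists>i k. \<gamma> i = \<gamma>' k"
proof (rule ccontr)
  assume no: "\<not> ?thesis"
  have "range \<gamma> \<subseteq> \<Union> (range (infinite_path_edge \<gamma>))" by (auto simp: infinite_path_edge_def)
  moreover have "finite (\<Union> (range (infinite_path_edge \<gamma>)))" if "finite (range (infinite_path_edge \<gamma>))"
    using that by (rule finite_Union) (auto simp: infinite_path_edge_def)
  ultimately have "infinite (range (infinite_path_edge \<gamma>))"
    using assms(1) by (meson finite_subset range_inj_infinite)
  moreover have "range (infinite_path_edge \<gamma>) \<subseteq>
      sym_diff (range (infinite_path_edge \<gamma>)) (range (infinite_path_edge \<gamma>'))"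
    using no by (auto simp: infinite_path_edge_def doubleton_eq_iff)
  ultimately show False using assms(2) finite_subset unfolding coalesce_def by blast
qed

text \<open>The sequence is eventually constant: the geodesics from both points pass through a
  common vertex, and the remaining time cancels.\<close>

lemma busemann_limit_exists:
  assumes pos: "pos_weights w" and uniq: "unique_geodesics w"
    and lim: "is_limit_geodesic w j x \<gamma>" and lim': "is_limit_geodesic w j y \<gamma>'"
    and co: "coalesce \<gamma> \<gamma>'"
  shows "convergent (\<lambda>n. passage_time w x (axis j (int n)) - passage_time w y (axis j (int n)))"
proof -
  obtain i k where z: "\<gamma> i = \<gamma>' k"
    using coalescing_share_vertex[OF limit_geodesic_inj[OF pos uniq lim] co] by blast
  have "\<forall>\<^sub>F n in sequentially. passage_time w x (axis j (int n)) - passage_time w y (axis j (int n)) =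
      passage_time w x (\<gamma> i) - passage_time w y (\<gamma> i)"
    using limit_geodesic_additive[OF pos uniq lim, of i] limit_geodesic_additive[OF pos uniq lim', of k]
    by eventually_elim (simp add: z)
  then show ?thesis by (intro convergentI tendsto_eventually)
qed

section \<open>Probabilistic tools\<close>

text \<open>The maximum of the orbit sums of \<open>g\<close> with at most \<open>n\<close> terms,
  the empty sum included, in the recursive form that Garsia's argument uses.\<close>

primrec running_max :: "('a \<Rightarrow> 'a) \<Rightarrow> ('a \<Rightarrow> real) \<Rightarrow> nat \<Rightarrow> 'a \<Rightarrow> real" where
  "running_max \<theta> g 0 x = 0"
| "running_max \<theta> g (Suc n) x = max 0 (g x + running_max \<theta> g n (\<theta> x))"

lemma running_max_nonneg: "0 \<le> running_max \<theta> g n x"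
  by (cases n) auto

lemma running_max_mono: "running_max \<theta> g n x \<le> running_max \<theta> g (Suc n) x"
proof (induction n arbitrary: x)
  case (Suc n)
  from Suc[of "\<theta> x"] show ?case by simp
qed simp

lemma orbit_sum_le_running_max: "(\<Sum>k<n. g ((\<theta> ^^ k) x)) \<le> running_max \<theta> g n x"
proof (induction n arbitrary: x)
  case (Suc n)
  have "(\<Sum>k<Suc n. g ((\<theta> ^^ k) x)) = g x + (\<Sum>k<n. g ((\<theta> ^^ k) (\<theta> x)))"
    by (subst sum.lessThan_Suc_shift) (simp add: funpow_swap1)
  with Suc[of "\<theta> x"] show ?case by simp
qed simp

text \<open>Garsia's proof of the maximal ergodic theorem.\<close>

lemma maximal_ergodic:
  fixes g :: "'a \<Rightarrow> real"
  assumes \<theta>: "\<theta> \<in> M \<rightarrow>\<^sub>M M" "distr M M \<theta> = M" and g: "integrable M g"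
    and pos: "AE x in M. indicator A x = (1::real) \<longleftrightarrow> (\<exists>n. 0 < running_max \<theta> g n x)"
    and A: "A \<in> sets M"
  shows "0 \<le> (\<integral>x. indicator A x * g x \<partial>M)"
proof -
  note [measurable] = \<theta>(1) A borel_measurable_integrable[OF g]
  define m where "m = running_max \<theta> g"
  have shift: "integrable M (\<lambda>x. h (\<theta> x)) \<and> (\<integral>x. h (\<theta> x) \<partial>M) = (\<integral>x. h x \<partial>M)"
    if "integrable M h" for h :: "'a \<Rightarrow> real"
  proof -
    have [measurable]: "h \<in> borel_measurable M" using that by simp
    show ?thesis using integrable_distr_eq[of \<theta> M M h] integral_distr[of \<theta> M M h] \<theta> that by simp
  qed
  have m_int: "integrable M (m n)" for n
  proof (induction n)
    case (Suc n)
    have "integrable M (\<lambda>x. max 0 (g x + m n (\<theta> x)))"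
      using Suc shift g by (intro integrable_max Bochner_Integration.integrable_add) auto
    then show ?case by (simp add: m_def cong: integrable_cong)
  qed (simp add: m_def)
  note [measurable] = borel_measurable_integrable[OF m_int]
  have ind: "0 \<le> (\<integral>x. indicator {x\<in>space M. 0 < m (Suc n) x} x * g x \<partial>M)" for n
  proof -
    have "(\<integral>x. m n x \<partial>M) \<le> (\<integral>x. m (Suc n) x \<partial>M)"
      by (rule integral_mono[OF m_int m_int]) (simp only: m_def running_max_mono)
    then have "0 \<le> (\<integral>x. m (Suc n) x \<partial>M) - (\<integral>x. m n x \<partial>M)" by simp
    also have "\<dots> = (\<integral>x. m (Suc n) x - m n (\<theta> x) \<partial>M)"
      using shift[OF m_int] by (subst Bochner_Integration.integral_diff[OF m_int]) auto
    \<comment> \<open>Where \<open>m (Suc n)\<close> is positive the difference equals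
      \<open>g\<close>; elsewhere it is at most zero because \<open>m n\<close> is
      nonnegative.\<close>
    also have "\<dots> \<le> (\<integral>x. indicator {x\<in>space M. 0 < m (Suc n) x} x * g x \<partial>M)"
    proof (rule integral_mono)
      show "integrable M (\<lambda>x. m (Suc n) x - m n (\<theta> x))"
        using m_int shift[OF m_int] by (intro Bochner_Integration.integrable_diff) auto
      show "integrable M (\<lambda>x. indicator {x\<in>space M. 0 < m (Suc n) x} x * g x)"
        using integrable_real_mult_indicator[OF _ g, of "{x\<in>space M. 0 < m (Suc n) x}"]
        by (simp add: mult.commute)
      show "m (Suc n) x - m n (\<theta> x) \<le> indicator {x\<in>space M. 0 < m (Suc n) x} x * g x"
        if "x \<in> space M" for x
        using that running_max_nonneg[of \<theta> g n "\<theta> x"] by (auto simp: m_def indicator_def max_def)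
    qed
    finally show ?thesis .
  qed
  \<comment> \<open>The sets where \<open>m (Suc n)\<close> is positive increase to \<open>A\<close>
    up to a null set.\<close>
  have "(\<lambda>n. \<integral>x. indicator {x\<in>space M. 0 < m (Suc n) x} x * g x \<partial>M) \<longlonglongrightarrow>
      (\<integral>x. indicator A x * g x \<partial>M)"
  proof (rule integral_dominated_convergence[where w = "\<lambda>x. \<bar>g x\<bar>"])
    show "AE x in M. (\<lambda>n. indicator {x\<in>space M. 0 < m (Suc n) x} x * g x) \<longlonglongrightarrow> indicator A x * g x"
      using pos AE_space
    proof eventually_elim
      case (elim x)
      have inc: "incseq (\<lambda>n. m n x)" unfolding m_def by (rule incseq_SucI) (rule running_max_mono)
      show ?case
      proof (cases "\<exists>n. 0 < m n x")
        case True
        then obtain n0 where n0: "0 < m n0 x" by blast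
        have "\<forall>\<^sub>F n in sequentially. indicator {x\<in>space M. 0 < m (Suc n) x} x * g x = indicator A x * g x"
          using eventually_ge_at_top[of n0]
        proof eventually_elim
          case (elim n)
          have "m n0 x \<le> m (Suc n) x" using inc elim by (auto simp: incseq_def)
          then have "0 < m (Suc n) x" using n0 by linarith
          with True \<open>x \<in> space M\<close> \<open>indicator A x = 1 \<longleftrightarrow> _\<close> show ?case by (auto simp: m_def)
        qed
        then show ?thesis by (rule tendsto_eventually)
      next
        case False
        with elim have "indicator A x = (0::real)" by (auto simp: m_def indicator_def)
        with False show ?thesis by (simp del: running_max.simps)
      qed
    qed
  qed (use g in \<open>auto simp: indicator_def\<close>)
  then show ?thesis by (rule LIMSEQ_le_const) (use ind in auto)
qed

section \<open>Sums of heavy-tailed variables with short-range dependence\<close>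

definition zeta32 :: real where
  "zeta32 = (\<Sum>k. real (Suc k) powr (-3/2))"

lemma sum_powr_le_zeta32: "(\<Sum>k<n. real (Suc k) powr (-3/2)) \<le> zeta32"
proof -
  have "summable (\<lambda>k. real k powr (-3/2))" by (simp add: summable_real_powr_iff)
  then have "summable (\<lambda>k. real (Suc k) powr (-3/2))" by (subst summable_Suc_iff)
  then show ?thesis unfolding zeta32_def by (intro sum_le_suminf) auto
qed

text \<open>Telescoping: each term is at most twice the corresponding increment of the square
  root.\<close>

lemma sum_inverse_sqrt_le: "(\<Sum>k<n. real (Suc k) powr (-1/2)) \<le> 2 * sqrt (real n)"
proof (induction n)
  case (Suc n)
  have "real (Suc n) powr (-1/2) = 1 / sqrt (real (Suc n))"
    by (simp add: powr_minus powr_half_sqrt field_simps)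
  moreover have "1 / sqrt (real (Suc n)) \<le> 2 * (sqrt (real (Suc n)) - sqrt (real n))"
  proof -
    have "(sqrt (real (Suc n)) - sqrt (real n)) * (sqrt (real (Suc n)) + sqrt (real n)) = 1"
      by (simp add: algebra_simps)
    moreover have "(sqrt (real (Suc n)) - sqrt (real n)) * (sqrt (real (Suc n)) + sqrt (real n))
        \<le> (sqrt (real (Suc n)) - sqrt (real n)) * (2 * sqrt (real (Suc n)))"
      by (intro mult_left_mono) auto
    ultimately have "1 \<le> 2 * (sqrt (real (Suc n)) - sqrt (real n)) * sqrt (real (Suc n))"
      by (simp add: algebra_simps)
    then show ?thesis by (subst pos_divide_le_eq) auto
  qed
  ultimately show ?case using Suc by simp
qed simp

context prob_space
begin

context
  fixes X :: "'a \<Rightarrow> real" and A :: real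
  assumes X [measurable]: "random_variable borel X"
    and tail: "\<And>s. s > 0 \<Longrightarrow> prob {x\<in>space M. s < X x} \<le> A * s powr (-3/2)"
begin

lemma tail_const_nonneg: "0 \<le> A"
  using order.trans[OF measure_nonneg tail[of 1]] by simp

text \<open>The term \<open>k = 0\<close> is bounded by 1, since the tail estimate assumes
  \<open>s > 0\<close>.\<close>

lemma sum_tails_le: "(\<Sum>k<n. prob {x\<in>space M. real k < X x}) \<le> 1 + A * zeta32"
proof (cases n)
  case (Suc n')
  have "(\<Sum>k<n. prob {x\<in>space M. real k < X x}) =
      prob {x\<in>space M. real 0 < X x} + (\<Sum>k<n'. prob {x\<in>space M. real (Suc k) < X x})"
    unfolding Suc by (subst sum.lessThan_Suc_shift) simp
  also have "\<dots> \<le> 1 + (\<Sum>k<n'. A * real (Suc k) powr (-3/2))"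
    by (intro add_mono sum_mono tail) auto
  also have "\<dots> \<le> 1 + A * zeta32"
    using sum_powr_le_zeta32[of n'] tail_const_nonneg
    by (simp add: mult_left_mono flip: sum_distrib_left)
  finally show ?thesis .
next
  case 0
  have "0 \<le> zeta32" using sum_powr_le_zeta32[of 0] by simp
  then show ?thesis using 0 tail_const_nonneg by simp
qed

text \<open>A nonnegative variable is at most the number of naturals below it, and the exponent 3/2
  makes the series of tails converge.\<close>

lemma integrable_if_tail:
  assumes nonneg: "AE x in M. 0 \<le> X x"
  shows "integrable M X"
proof (rule integrableI_nonneg[OF X nonneg])
  have "(\<integral>\<^sup>+x. ennreal (X x) \<partial>M) \<le> (\<integral>\<^sup>+x. (\<Sum>k. indicator {x\<in>space M. real k < X x} x) \<partial>M)"
  proof (rule nn_integral_mono)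
    fix x assume x: "x \<in> space M"
    define n where "n = nat \<lceil>X x\<rceil>"
    have "ennreal (X x) \<le> ennreal (real n)" unfolding n_def by (intro ennreal_leI real_nat_ceiling_ge)
    also have "\<dots> = (\<Sum>k<n. indicator {x\<in>space M. real k < X x} x)"
    proof -
      have "indicator {x\<in>space M. real k < X x} x = (1::ennreal)" if "k < n" for k
        using that x unfolding n_def by (auto simp: indicator_def) linarith
      then show ?thesis by (simp add: ennreal_of_nat_eq_real_of_nat)
    qed
    also have "\<dots> \<le> (\<Sum>k. indicator {x\<in>space M. real k < X x} x)"
      by (rule sum_le_suminf) auto
    finally show "ennreal (X x) \<le> (\<Sum>k. indicator {x\<in>space M. real k < X x} x)" .
  qed
  also have "\<dots> = (\<Sum>k. emeasure M {x\<in>space M. real k < X x})"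
    by (subst nn_integral_suminf) (auto intro!: suminf_cong)
  also have "\<dots> \<le> ennreal (1 + A * zeta32)"
  proof (rule suminf_le_const)
    fix n
    have "(\<Sum>k<n. emeasure M {x\<in>space M. real k < X x}) = ennreal (\<Sum>k<n. prob {x\<in>space M. real k < X x})"
      by (simp add: emeasure_eq_measure sum_ennreal)
    then show "(\<Sum>k<n. emeasure M {x\<in>space M. real k < X x}) \<le> ennreal (1 + A * zeta32)"
      using sum_tails_le[of n] by (simp add: ennreal_leI)
  qed simp
  finally show "(\<integral>\<^sup>+x. ennreal (X x) \<partial>M) < \<infinity>" by (simp add: le_less_trans)
qed

lemma expectation_truncated:
  "expectation (\<lambda>x. max 0 (min (X x) (real n))) \<le> 1 + A * zeta32"
proof -
  have "expectation (\<lambda>x. max 0 (min (X x) (real n))) \<le>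
      expectation (\<lambda>x. \<Sum>k<n. indicator {x\<in>space M. real k < X x} x)"
  proof (rule integral_mono)
    show "integrable M (\<lambda>x. max 0 (min (X x) (real n)))"
      by (rule integrable_const_bound[of _ "real n"]) auto
    fix x assume x: "x \<in> space M"
    define l where "l = min n (nat \<lceil>X x\<rceil>)"
    have "max 0 (min (X x) (real n)) \<le> real l" 
      using real_nat_ceiling_ge[of "X x"] unfolding l_def by (auto simp: min_def)
    also have "\<dots> = (\<Sum>k<l. 1)" by simp
    also have "\<dots> = (\<Sum>k<l. indicator {x\<in>space M. real k < X x} x)"
    proof (rule sum.cong)
      show "1 = (indicator {x\<in>space M. real k < X x} x :: real)" if "k \<in> {..<l}" for k
        using that x unfolding l_def by (auto simp: indicator_def) linarith
    qed simp
    also have "\<dots> \<le> (\<Sum>k<n. indicator {x\<in>space M. real k < X x} x)"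
      by (rule sum_mono2) (auto simp: l_def)
    finally show "max 0 (min (X x) (real n)) \<le> (\<Sum>k<n. indicator {x\<in>space M. real k < X x} x)" .
  qed (auto intro!: integrable_real_indicator simp: emeasure_eq_measure)
  also have "\<dots> = (\<Sum>k<n. prob {x\<in>space M. real k < X x})"
    by (subst Bochner_Integration.integral_sum)
       (auto intro!: integrable_real_indicator simp: emeasure_eq_measure)
  finally show ?thesis using sum_tails_le[of n] by simp
qed

text \<open>The full second moment may be infinite. Truncation at \<open>n\<close> leaves at most
  the sum of \<open>2 k + 1\<close> times the tail at \<open>k\<close> over \<open>k < n\<close>,
  whose terms are of order \<open>k powr (-1/2)\<close>.\<close>

lemma second_moment_truncated:
  assumes "n > 0"
  shows "expectation (\<lambda>x. (max 0 (min (X x) (real n)))\<^sup>2) \<le> (1 + 6 * A) * sqrt (real n)"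
proof -
  have "expectation (\<lambda>x. (max 0 (min (X x) (real n)))\<^sup>2) \<le>
      expectation (\<lambda>x. \<Sum>k<n. (2 * real k + 1) * indicator {x\<in>space M. real k < X x} x)"
  proof (rule integral_mono)
    show "integrable M (\<lambda>x. (max 0 (min (X x) (real n)))\<^sup>2)"
      by (rule integrable_const_bound[of _ "real n ^ 2"]) (auto intro!: power_mono)
    fix x assume x: "x \<in> space M"
    define l where "l = min n (nat \<lceil>X x\<rceil>)"
    have "max 0 (min (X x) (real n)) \<le> real l" 
      using real_nat_ceiling_ge[of "X x"] unfolding l_def by (auto simp: min_def)
    then have "(max 0 (min (X x) (real n)))\<^sup>2 \<le> (real l)\<^sup>2" by (rule power_mono) simp
    also have "\<dots> = (\<Sum>k<l. 2 * real k + 1)"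
      by (induction l) (simp_all add: power2_eq_square algebra_simps)
    also have "\<dots> = (\<Sum>k<l. (2 * real k + 1) * indicator {x\<in>space M. real k < X x} x)"
    proof (rule sum.cong)
      fix k assume "k \<in> {..<l}"
      then have "real k < X x" unfolding l_def by simp linarith
      then show "2 * real k + 1 = (2 * real k + 1) * indicator {x\<in>space M. real k < X x} x"
        using x by simp
    qed simp
    also have "\<dots> \<le> (\<Sum>k<n. (2 * real k + 1) * indicator {x\<in>space M. real k < X x} x)"
      by (rule sum_mono2) (auto simp: l_def)
    finally show "(max 0 (min (X x) (real n)))\<^sup>2 \<le>
      (\<Sum>k<n. (2 * real k + 1) * indicator {x\<in>space M. real k < X x} x)" .
  qed (intro Bochner_Integration.integrable_sum integrable_mult_right integrable_real_indicator,
       auto simp: emeasure_eq_measure)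
  also have "\<dots> = (\<Sum>k<n. (2 * real k + 1) * prob {x\<in>space M. real k < X x})"
    by (subst Bochner_Integration.integral_sum)
       (auto intro!: integrable_real_indicator simp: emeasure_eq_measure)
  also have "\<dots> = prob {x\<in>space M. 0 < X x} +
      (\<Sum>k<n - 1. (2 * real (Suc k) + 1) * prob {x\<in>space M. real (Suc k) < X x})"
    using assms sum.lessThan_Suc_shift[of "\<lambda>k. (2 * real k + 1) * prob {x\<in>space M. real k < X x}" "n - 1"]
    by simp
  also have "\<dots> \<le> 1 + (\<Sum>k<n - 1. 3 * A * real (Suc k) powr (-1/2))"
  proof (intro add_mono sum_mono)
    fix k
    have "(2 * real (Suc k) + 1) * prob {x\<in>space M. real (Suc k) < X x} \<le>
        (3 * real (Suc k)) * (A * real (Suc k) powr (-3/2))"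
      by (intro mult_mono tail) auto
    also have "\<dots> = 3 * A * (real (Suc k) powr 1 * real (Suc k) powr (-3/2))" by simp
    also have "real (Suc k) powr 1 * real (Suc k) powr (-3/2) = real (Suc k) powr (-1/2)"
      by (subst powr_add[symmetric]) simp
    finally show "(2 * real (Suc k) + 1) * prob {x\<in>space M. real (Suc k) < X x} \<le>
        3 * A * real (Suc k) powr (-1/2)" .
  qed simp
  also have "\<dots> \<le> 1 + 3 * A * (2 * sqrt (real n))"
  proof -
    have "(\<Sum>k<n - 1. real (Suc k) powr (-1/2)) \<le> 2 * sqrt (real n)"
      using sum_inverse_sqrt_le[of "n - 1"] real_sqrt_le_mono[of "real (n - 1)" "real n"] by linarith
    then have "3 * A * (\<Sum>k<n - 1. real (Suc k) powr (-1/2)) \<le> 3 * A * (2 * sqrt (real n))"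
      using tail_const_nonneg by (intro mult_left_mono) auto
    then show ?thesis by (simp only: sum_distrib_left[symmetric] add_left_mono)
  qed
  also have "\<dots> \<le> (1 + 6 * A) * sqrt (real n)"
    using assms by (simp add: algebra_simps)
  finally show ?thesis .
qed

end

text \<open>Some summand exceeds \<open>n\<close> with probability at most
  \<open>n * A * n powr (-3/2)\<close>. The truncated summands have variance
  \<open>O(sqrt n)\<close> and only neighbouring ones can be correlated, so Chebyshev's inequality
  for a deviation \<open>n\<close> again gives order \<open>n powr (-1/2)\<close>. The threshold
  adds this deviation, 1 per summand, to the bound \<open>1 + A * zeta32\<close> on the mean, and
  \<open>3 + 19 * A\<close> is \<open>A + 3 * (1 + 6 * A)\<close>.\<close>

lemma heavy_tail_sum_bound:
  fixes X :: "nat \<Rightarrow> 'a \<Rightarrow> real"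
  assumes X [measurable]: "\<And>i. random_variable borel (X i)"
    and tail: "\<And>i s. s > 0 \<Longrightarrow> prob {x\<in>space M. s < X i x} \<le> A * s powr (-3/2)"
    and indep: "\<And>i k. i + 2 \<le> k \<Longrightarrow> indep_var borel (X i) borel (X k)"
    and n: "n > 0"
  shows "prob {x\<in>space M. (2 + A * zeta32) * real n < (\<Sum>i<n. X i x)} \<le> (3 + 19 * A) / sqrt (real n)"
proof -
  define Y where "Y i x = max 0 (min (X i x) (real n))" for i x
  have Y [measurable]: "random_variable borel (Y i)" for i unfolding Y_def by measurable
  have Y_bd: "0 \<le> Y i x" "Y i x \<le> real n" for i x by (auto simp: Y_def)
  define v where "v = (1 + 6 * A) * sqrt (real n)"
  define Z where "Z i x = Y i x - expectation (Y i)" for i x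
  have Z [measurable]: "random_variable borel (Z i)" for i unfolding Z_def by measurable
  have Y_int: "integrable M (Y i)" for i
    by (rule integrable_const_bound[of _ "real n"]) (use Y_bd in \<open>auto simp: abs_le_iff\<close>)
  have Y2_int: "integrable M (\<lambda>x. (Y i x)\<^sup>2)" for i
    by (rule integrable_const_bound[of _ "real n ^ 2"]) (use Y_bd in \<open>auto intro!: power_mono\<close>)
  have EY: "0 \<le> expectation (Y i)" "expectation (Y i) \<le> 1 + A * zeta32" for i
    using expectation_truncated[of "X i" A n, OF X tail] Y_bd unfolding Y_def
    by (auto intro!: Bochner_Integration.integral_nonneg)
  have Z2: "expectation (\<lambda>x. (Z i x)\<^sup>2) \<le> v" for i
  proof -
    have "expectation (\<lambda>x. (Z i x)\<^sup>2) = expectation (\<lambda>x. (Y i x)\<^sup>2) - (expectation (Y i))\<^sup>2"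
      unfolding Z_def using Y_int Y2_int by (rule variance_eq)
    also have "\<dots> \<le> expectation (\<lambda>x. (Y i x)\<^sup>2)" by simp
    finally show ?thesis
      using second_moment_truncated[of "X i" A n, OF X tail n] unfolding Y_def v_def by simp
  qed
  have v0: "0 \<le> v" by (rule order.trans[OF _ Z2[of 0]]) simp
  have Z_bd: "\<bar>Z i x\<bar> \<le> real n + (1 + A * zeta32)" for i x
    using Y_bd[of i x] EY[of i] by (auto simp: Z_def)
  have ZZ_int: "integrable M (\<lambda>x. Z i x * Z k x)" for i k
  proof (rule integrable_const_bound[of _ "(real n + (1 + A * zeta32)) * (real n + (1 + A * zeta32))"])
    show "AE x in M. norm (Z i x * Z k x) \<le> (real n + (1 + A * zeta32)) * (real n + (1 + A * zeta32))"
      unfolding real_norm_def abs_mult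
      by (intro AE_I2 mult_mono Z_bd abs_ge_zero order.trans[OF abs_ge_zero Z_bd[of i]])
  qed measurable
  have Z_int: "integrable M (Z i)" for i
    unfolding Z_def using Y_int by auto
  have cov_le: "expectation (\<lambda>x. Z i x * Z k x) \<le> v" for i k
  proof -
    have "expectation (\<lambda>x. Z i x * Z k x) \<le> expectation (\<lambda>x. ((Z i x)\<^sup>2 + (Z k x)\<^sup>2) / 2)"
    proof (rule integral_mono)
      show "integrable M (\<lambda>x. ((Z i x)\<^sup>2 + (Z k x)\<^sup>2) / 2)"
        using ZZ_int[of i i] ZZ_int[of k k] by (auto simp: power2_eq_square)
      show "Z i x * Z k x \<le> ((Z i x)\<^sup>2 + (Z k x)\<^sup>2) / 2" for x
        using sum_squares_bound[of "Z i x" "Z k x"] by (simp add: field_simps)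
    qed (rule ZZ_int)
    also have "\<dots> = (expectation (\<lambda>x. (Z i x)\<^sup>2) + expectation (\<lambda>x. (Z k x)\<^sup>2)) / 2"
      using ZZ_int[of i i] ZZ_int[of k k] by (simp add: power2_eq_square)
    finally show ?thesis using Z2[of i] Z2[of k] by simp
  qed
  have cov_0: "expectation (\<lambda>x. Z i x * Z k x) = 0" if "i + 2 \<le> k" for i k
  proof -
    have "indep_var borel ((\<lambda>y. max 0 (min y (real n)) - expectation (Y i)) \<circ> X i)
        borel ((\<lambda>y. max 0 (min y (real n)) - expectation (Y k)) \<circ> X k)"
      by (rule indep_var_compose[OF indep[OF that]]) measurable
    moreover have "(\<lambda>y. max 0 (min y (real n)) - expectation (Y i)) \<circ> X i = Z i" for i
      by (rule ext) (simp only: comp_def Z_def Y_def)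
    ultimately have "indep_var borel (Z i) borel (Z k)" by simp
    then have "expectation (\<lambda>x. Z i x * Z k x) = expectation (Z i) * expectation (Z k)"
      by (intro indep_var_lebesgue_integral Z_int)
    also have "expectation (Z i) = 0" unfolding Z_def using Y_int by (simp add: prob_space)
    finally show ?thesis by simp
  qed
  \<comment> \<open>At most three indices \<open>k\<close> contribute for each \<open>i\<close>; the
    truncated subtraction at \<open>i = 0\<close> only shortens the interval.\<close>
  have cov: "expectation (\<lambda>x. Z i x * Z k x) \<le> (if k \<in> {i - 1..i + 1} then v else 0)" for i k
  proof (cases "k \<in> {i - 1..i + 1}")
    case False
    then consider "i + 2 \<le> k" | "k + 2 \<le> i" by force
    then have "expectation (\<lambda>x. Z i x * Z k x) = 0"
      by cases (use cov_0[of i k] cov_0[of k i] in \<open>simp_all add: mult.commute\<close>)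
    with False show ?thesis by (simp only: if_False order_refl)
  qed (use cov_le in simp)
  have sq: "(\<Sum>i<n. Z i x)\<^sup>2 = (\<Sum>i<n. \<Sum>k<n. Z i x * Z k x)" for x
    by (simp only: power2_eq_square sum_product)
  have "expectation (\<lambda>x. (\<Sum>i<n. Z i x)\<^sup>2) = (\<Sum>i<n. \<Sum>k<n. expectation (\<lambda>x. Z i x * Z k x))"
    unfolding sq
    by (simp only: Bochner_Integration.integral_sum Bochner_Integration.integrable_sum ZZ_int)
  also have "\<dots> \<le> (\<Sum>i<n. \<Sum>k<n. if k \<in> {i - 1..i + 1} then v else 0)"
    by (intro sum_mono cov)
  also have "\<dots> \<le> (\<Sum>i<n. 3 * v)"
  proof (rule sum_mono)
    fix i
    have "card ({..<n} \<inter> {i - 1..i + 1}) \<le> card {i - 1..i + 1}" by (rule card_mono) auto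
    then have "real (card ({..<n} \<inter> {i - 1..i + 1})) * v \<le> 3 * v"
      using v0 by (intro mult_right_mono) auto
    then show "(\<Sum>k<n. if k \<in> {i - 1..i + 1} then v else 0) \<le> 3 * v"
      by (subst sum.inter_restrict[symmetric]) auto
  qed
  also have "\<dots> = 3 * real n * v" by simp
  finally have var: "expectation (\<lambda>x. (\<Sum>i<n. Z i x)\<^sup>2) \<le> 3 * real n * v" .
  have sq_int: "integrable M (\<lambda>x. (\<Sum>i<n. Z i x)\<^sup>2)"
    unfolding sq by (intro Bochner_Integration.integrable_sum ZZ_int)
  have dev: "prob {x\<in>space M. (real n)\<^sup>2 \<le> (\<Sum>i<n. Z i x)\<^sup>2} \<le> 3 * real n * v / (real n)\<^sup>2"
    using integral_Markov_inequality_measure[OF sq_int, of "{}" "(real n)\<^sup>2"] n var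
    by (auto intro: order.trans simp: divide_right_mono)
  have sub: "{x\<in>space M. (2 + A * zeta32) * real n < (\<Sum>i<n. X i x)} \<subseteq>
      (\<Union>i<n. {x\<in>space M. real n < X i x}) \<union> {x\<in>space M. (real n)\<^sup>2 \<le> (\<Sum>i<n. Z i x)\<^sup>2}"
  proof safe
    fix x assume x: "(2 + A * zeta32) * real n < (\<Sum>i<n. X i x)"
      and no: "x \<notin> (\<Union>i<n. {x\<in>space M. real n < X i x})" and "x \<in> space M"
    have "(\<Sum>i<n. X i x) \<le> (\<Sum>i<n. Z i x + (1 + A * zeta32))"
    proof (rule sum_mono)
      fix i assume "i \<in> {..<n}"
      then have "X i x \<le> real n" using no \<open>x \<in> space M\<close> by force
      then have "X i x \<le> Y i x" by (simp add: Y_def)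
      then show "X i x \<le> Z i x + (1 + A * zeta32)" using EY(2)[of i] by (simp add: Z_def)
    qed
    also have "\<dots> = (\<Sum>i<n. Z i x) + (1 + A * zeta32) * real n" by (simp add: sum.distrib algebra_simps)
    finally have "real n \<le> (\<Sum>i<n. Z i x)" using x by (simp add: algebra_simps)
    then show "(real n)\<^sup>2 \<le> (\<Sum>i<n. Z i x)\<^sup>2" by (rule power_mono) simp
  qed
  have max: "prob (\<Union>i<n. {x\<in>space M. real n < X i x}) \<le> A / sqrt (real n)"
  proof -
    have "prob (\<Union>i<n. {x\<in>space M. real n < X i x}) \<le> (\<Sum>i<n. prob {x\<in>space M. real n < X i x})"
      by (rule finite_measure_subadditive_finite) auto
    also have "\<dots> \<le> (\<Sum>i<n. A * real n powr (-3/2))" using n by (intro sum_mono tail) auto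
    also have "\<dots> = A * (real n powr 1 * real n powr (-3/2))" by simp
    also have "real n powr 1 * real n powr (-3/2) = real n powr (-1/2)"
      by (subst powr_add[symmetric]) simp
    also have "A * real n powr (-1/2) = A / sqrt (real n)"
      by (simp add: powr_minus powr_half_sqrt field_simps)
    finally show ?thesis .
  qed
  have "3 * real n * v / (real n)\<^sup>2 = 3 * (1 + 6 * A) * (sqrt (real n) / real n)"
    using n by (simp add: v_def power2_eq_square field_simps)
  also have "sqrt (real n) / real n = 1 / sqrt (real n)" using n by (simp add: field_simps)
  finally have v_eq: "3 * real n * v / (real n)\<^sup>2 = 3 * (1 + 6 * A) / sqrt (real n)" by simp
  have "prob {x\<in>space M. (2 + A * zeta32) * real n < (\<Sum>i<n. X i x)} \<le>
      prob (\<Union>i<n. {x\<in>space M. real n < X i x}) + prob {x\<in>space M. (real n)\<^sup>2 \<le> (\<Sum>i<n. Z i x)\<^sup>2}"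
    by (rule order.trans[OF finite_measure_mono[OF sub] measure_Un_le]) auto
  also have "\<dots> \<le> A / sqrt (real n) + 3 * (1 + 6 * A) / sqrt (real n)"
    using max dev unfolding v_eq by (rule add_mono)
  also have "\<dots> = (3 + 19 * A) / sqrt (real n)"
    by (simp flip: add_divide_distrib)
  finally show ?thesis .
qed

end

section \<open>Passage times along lattice lines\<close>

text \<open>
  The dimension is a separate parameter because a constant whose type does not mention \<open>'d\<close> cannot
  be defined from \<open>CARD('d)\<close>.
\<close>

locale fpp =
  fixes F :: "real measure" and A :: real and j :: "'d::finite" and dimension :: nat
  assumes prob_F: "prob_space F"
    and sets_F [measurable_cong]: "sets F = sets borel"
    and pos_F: "AE s in F. 0 < s"
    and no_atoms: "\<And>a. measure F {a} = 0"
    and tail_F: "\<And>s. s > 0 \<Longrightarrow> measure F {s<..} \<le> A * s powr (-1/2)"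
    and dim: "CARD('d) \<ge> 2"
    and dimension: "CARD('d) = dimension"
begin

abbreviation P :: "((int ^ 'd) set \<Rightarrow> real) measure" where
  "P \<equiv> PiM edges (\<lambda>_. F)"

sublocale prob_space P
  by (rule prob_space_PiM) (rule prob_F)

section \<open>Independence of functions of disjoint edge sets\<close>

lemma edges_countable: "countable (edges :: (int ^ 'd) set set)"
  unfolding edges_def by (rule countable_subset[of _ "(\<lambda>(x, y). {x, y}) ` UNIV"]) auto

lemma edges_nonempty: "(edges :: (int ^ 'd) set set) \<noteq> {}"
proof -
  have "{0, 0 + axis j 1} \<in> (edges :: (int ^ 'd) set set)"
    unfolding edge_iff by (rule adjacent_axis) simp
  then show ?thesis by auto
qed

lemma distr_coordinate: "e \<in> edges \<Longrightarrow> distr P F (\<lambda>w. w e) = F"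
  by (rule distr_PiM_component) (auto intro: prob_F)

lemma indep_coordinates: "indep_vars (\<lambda>_. F) (\<lambda>e w. w e) edges"
proof (subst indep_vars_iff_distr_eq_PiM'[OF edges_nonempty])
  have "distr P P (\<lambda>w. restrict w edges) = distr P P (\<lambda>w. w)"
    by (rule distr_cong) (auto simp: space_PiM)
  also have "\<dots> = P" by (rule distr_id)
  also have "\<dots> = PiM edges (\<lambda>e. distr P F (\<lambda>w. w e))"
    by (rule PiM_cong) (simp_all add: distr_coordinate)
  finally show "distr P P (\<lambda>w. \<lambda>e\<in>edges. w e) = PiM edges (\<lambda>e. distr P F (\<lambda>w. w e))" .
qed simp

text \<open>Locality is expressed as invariance under \<open>restrict\<close>, so that functions of
  the whole configuration can be used without redefining them on smaller product spaces.\<close>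

lemma indep_local:
  assumes "\<And>k. k \<in> K \<Longrightarrow> J k \<subseteq> edges" "disjoint_family_on J K"
    and g: "\<And>k. k \<in> K \<Longrightarrow> g k \<in> borel_measurable (PiM (J k) (\<lambda>_. F))"
    and loc: "\<And>k w. k \<in> K \<Longrightarrow> g k (restrict w (J k)) = g k w"
  shows "indep_vars (\<lambda>_. borel) g K"
proof -
  have "indep_vars (\<lambda>_. borel) (\<lambda>k w. g k (restrict (\<lambda>e. w e) (J k))) K"
    by (rule indep_vars_compose2[OF indep_vars_restrict[OF indep_coordinates assms(1,2)]]) (auto intro: g)
  then show ?thesis
    by (subst indep_vars_cong[OF refl, where Y = "\<lambda>k w. g k (restrict (\<lambda>e. w e) (J k))"])
       (auto simp: loc)
qed

lemma indep_var_local: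
  fixes f g :: "_ \<Rightarrow> real"
  assumes "I \<subseteq> edges" "J \<subseteq> edges" "I \<inter> J = {}"
    and "f \<in> borel_measurable (PiM I (\<lambda>_. F))" "g \<in> borel_measurable (PiM J (\<lambda>_. F))"
    and "\<And>w. f (restrict w I) = f w" "\<And>w. g (restrict w J) = g w"
  shows "indep_var borel f borel g"
proof -
  have "indep_vars (\<lambda>_. borel) (case_bool f g) UNIV"
    by (rule indep_local[where J = "case_bool I J"])
       (use assms in \<open>auto simp: disjoint_family_on_def split: bool.splits\<close>)
  moreover have "case_bool borel borel = (\<lambda>_. borel :: real measure)" by (auto split: bool.splits)
  ultimately show ?thesis unfolding indep_var_def by (simp only:)
qed

lemma prob_coordinates:
  assumes "finite J" "J \<subseteq> edges" "J \<noteq> {}" "S \<in> sets borel"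
  shows "prob {w\<in>space P. \<forall>e\<in>J. w e \<in> S} = measure F S ^ card J"
proof -
  have "prob (\<Inter>e\<in>J. (\<lambda>w. w e) -` S \<inter> space P) = (\<Prod>e\<in>J. prob ((\<lambda>w. w e) -` S \<inter> space P))"
    by (rule indep_varsD[OF indep_coordinates]) (use assms in \<open>auto simp: sets_F\<close>)
  also have "\<dots> = (\<Prod>e\<in>J. measure F S)"
  proof (rule prod.cong)
    fix e assume "e \<in> J"
    then have "e \<in> edges" using assms by auto
    then show "prob ((\<lambda>w. w e) -` S \<inter> space P) = measure F S"
      using measure_distr[of "\<lambda>w. w e" P F S] assms distr_coordinate by (simp add: sets_F)
  qed simp
  also have "(\<Inter>e\<in>J. (\<lambda>w. w e) -` S \<inter> space P) = {w\<in>space P. \<forall>e\<in>J. w e \<in> S}"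
    using assms by auto
  finally show ?thesis by simp
qed

section \<open>Three disjoint paths between neighbours\<close>

definition side :: "'d \<Rightarrow> 'd" where
  "side b = (SOME c. c \<noteq> b)"

lemma side_neq: "side b \<noteq> b"
proof -
  have "\<exists>c. c \<noteq> b"
  proof (rule ccontr)
    assume "\<not> ?thesis"
    then have "(UNIV :: 'd set) = {b}" by auto
    then have "CARD('d) = 1" by (metis card_1_singleton_iff One_nat_def)
    then show False using dim by simp
  qed
  then show ?thesis unfolding side_def by (rule someI_ex)
qed

definition detour :: "int ^ 'd \<Rightarrow> 'd \<Rightarrow> int \<Rightarrow> (int ^ 'd) list" where
  "detour u b s =
     [u, u + axis (side b) s, u + axis (side b) s + axis b 1, u + axis b 1]"

text \<open>
  The three paths are edge disjoint: with tails of order \<open>s\<^sup>-\<^sup>1\<^sup>/\<^sup>2\<close> for one edge this is the least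
  number for which the minimum is integrable.
\<close>

definition tau :: "((int ^ 'd) set \<Rightarrow> real) \<Rightarrow> int ^ 'd \<Rightarrow> 'd \<Rightarrow> real" where
  "tau w u b = min (path_time w [u, u + axis b 1])
     (min (path_time w (detour u b 1)) (path_time w (detour u b (-1))))"

definition tau_edges :: "int ^ 'd \<Rightarrow> 'd \<Rightarrow> (int ^ 'd) set set" where
  "tau_edges u b =
     set (path_edges [u, u + axis b 1]) \<union> set (path_edges (detour u b 1)) \<union> set (path_edges (detour u b (-1)))"

lemma detour_path: "\<bar>s\<bar> = 1 \<Longrightarrow> path_from_to u (u + axis b 1) (detour u b s)"
proof -
  assume s: "\<bar>s\<bar> = 1"
  have "adjacent (u + axis b 1 + axis (side b) s) (u + axis b 1)"
    using s by (rule adjacent_axis)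
  then have "adjacent (u + axis (side b) s + axis b 1) (u + axis b 1)" by (simp add: ac_simps)
  then show ?thesis
    using s by (simp add: path_from_to_def detour_def adjacent_axis)
qed

lemma direct_path: "path_from_to u (u + axis b 1) [u, u + axis b 1]"
  by (simp add: path_from_to_def adjacent_axis)

lemma tau_edges_subset: "tau_edges u b \<subseteq> edges"
  unfolding tau_edges_def
  by (intro Un_least path_from_to_edges[OF detour_path] path_from_to_edges[OF direct_path]) simp_all

lemma passage_time_le_tau: "nonneg_weights w \<Longrightarrow> passage_time w u (u + axis b 1) \<le> tau w u b"
  unfolding tau_def by (intro min.boundedI passage_time_le detour_path direct_path) auto

lemma tau_nonneg: "nonneg_weights w \<Longrightarrow> 0 \<le> tau w u b"
  using passage_time_le_tau[of w u b] passage_time_nonneg[of w u "u + axis b 1"] by linarith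

lemma path_time_local:
  "set (path_edges p) \<subseteq> J \<Longrightarrow> path_time (restrict w J) p = path_time w p"
  unfolding path_time_def by (rule arg_cong[of _ _ sum_list], rule map_cong) auto

lemma path_time_measurable [measurable]:
  assumes "set (path_edges p) \<subseteq> J"
  shows "(\<lambda>w. path_time w p) \<in> borel_measurable (PiM J (\<lambda>_. F))"
proof -
  have "(\<lambda>w. w e) \<in> borel_measurable (PiM J (\<lambda>_. F))" if "e \<in> J" for e
    using measurable_component_singleton[OF that, of "\<lambda>_. F"]
    by (simp cong: measurable_cong_sets add: sets_F)
  then have *: "(\<lambda>w. sum_list (map w l)) \<in> borel_measurable (PiM J (\<lambda>_. F))" if "set l \<subseteq> J" for l
    using that by (induction l) auto
  show ?thesis unfolding path_time_def by (rule *) (rule assms)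
qed

lemma tau_local: "tau_edges u b \<subseteq> J \<Longrightarrow> tau (restrict w J) u b = tau w u b"
  unfolding tau_def tau_edges_def by (simp only: path_time_local Un_subset_iff)

lemma tau_measurable:
  "tau_edges u b \<subseteq> J \<Longrightarrow> (\<lambda>w. tau w u b) \<in> borel_measurable (PiM J (\<lambda>_. F))"
  unfolding tau_def tau_edges_def by (intro borel_measurable_min path_time_measurable) auto

text \<open>The first bound makes links two apart on a line in direction \<open>b\<close> edge
  disjoint; the second does so for lines in hyperplanes at distance 3.\<close>

lemma tau_edges_near:
  assumes "e \<in> tau_edges u b" "y \<in> e"
  shows "y $ b \<in> {u $ b, u $ b + 1}" "c \<noteq> b \<Longrightarrow> \<bar>y $ c - u $ c\<bar> \<le> 1"
  using assms side_neq[of b] by (auto simp: tau_edges_def detour_def axis_def)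

text \<open>Nine pairs of detour edges, times the cube of the tail bound at
  \<open>s / 3\<close>.\<close>

definition tau_const :: real where
  "tau_const = 9 * A ^ 3 * 3 powr (3/2)"

text \<open>A three-edge path slower than \<open>s\<close> has an edge above \<open>s / 3\<close>.
  If all three paths are slow, three distinct and hence independent weights exceed
  \<open>s / 3\<close>: the direct edge and one edge of each detour.\<close>

lemma tau_tail:
  assumes s: "s > 0"
  shows "prob {w\<in>space P. s < tau w u b} \<le> tau_const * s powr (-3/2)"
proof -
  define e0 where "e0 = {u, u + axis b 1}"
  define E where "E \<sigma> = set (path_edges (detour u b \<sigma>))" for \<sigma>
  have E_edges: "E 1 \<subseteq> edges" "E (-1) \<subseteq> edges" "e0 \<in> edges"
    unfolding E_def
    by (intro path_from_to_edges[OF detour_path], simp, intro path_from_to_edges[OF detour_path], simp)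
       (simp add: e0_def edge_iff adjacent_axis)
  have E_fin: "finite (E \<sigma>)" "card (E \<sigma>) \<le> 3" for \<sigma>
    unfolding E_def
    using order.trans[OF card_length, of "path_edges (detour u b \<sigma>)" 3] by (auto simp: detour_def)
  define c where "c = side b"
  \<comment> \<open>The coordinate \<open>c\<close> tells the paths apart: every edge of a detour
    touches the side \<open>\<sigma>\<close> and never the opposite one, while the direct edge
    touches neither.\<close>
  have mem: "\<exists>y\<in>e. y $ c = u $ c + \<sigma>" "\<forall>y\<in>e. y $ c \<in> {u $ c, u $ c + \<sigma>}" if "e \<in> E \<sigma>" for e \<sigma>
    using that side_neq[of b] by (auto simp: E_def detour_def c_def axis_def)
  have e0: "\<forall>y\<in>e0. y $ c = u $ c" using side_neq[of b] by (auto simp: e0_def c_def axis_def)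
  have dist: "e0 \<noteq> e" "e0 \<noteq> e'" "e \<noteq> e'" if "e \<in> E 1" "e' \<in> E (-1)" for e e'
    using mem[OF that(1)] mem[OF that(2)] e0 by fastforce+
  have big: "\<exists>e\<in>E \<sigma>. s / 3 < w e" if "s < path_time w (detour u b \<sigma>)" for w \<sigma>
  proof (rule ccontr)
    assume "\<not> ?thesis"
    then have "path_time w (detour u b \<sigma>) \<le> s / 3 + s / 3 + s / 3"
      unfolding E_def detour_def by (auto simp: not_less intro!: add_mono)
    then show False using that by simp
  qed
  have "{w\<in>space P. s < tau w u b} \<subseteq>
      (\<Union>(e, e')\<in>E 1 \<times> E (-1). {w\<in>space P. \<forall>e''\<in>{e0, e, e'}. w e'' \<in> {s / 3<..}})" (is "_ \<subseteq> (\<Union>p\<in>_. ?S p)")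
  proof safe
    fix w assume w: "w \<in> space P" and t: "s < tau w u b"
    obtain e e' where "e \<in> E 1" "e' \<in> E (-1)" "s / 3 < w e" "s / 3 < w e'"
      using t big[of w 1] big[of w "-1"] unfolding tau_def by force
    moreover have "s / 3 < w e0" using t s by (auto simp: tau_def e0_def)
    ultimately show "w \<in> (\<Union>(e, e')\<in>E 1 \<times> E (-1). {w\<in>space P. \<forall>e''\<in>{e0, e, e'}. w e'' \<in> {s / 3<..}})"
      using w by auto
  qed
  moreover have meas: "?S p \<in> sets P" if "p \<in> E 1 \<times> E (-1)" for p
    using that E_edges by (cases p) (auto intro!: sets.sets_Collect_conj sets_Collect_single' simp: sets_F)
  ultimately have "prob {w\<in>space P. s < tau w u b} \<le> prob (\<Union>p\<in>E 1 \<times> E (-1). ?S p)"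
    using E_fin by (intro finite_measure_mono) (auto intro!: sets.finite_UN)
  also have "\<dots> \<le> (\<Sum>p\<in>E 1 \<times> E (-1). prob (?S p))"
    using E_fin meas by (intro finite_measure_subadditive_finite) auto
  also have "\<dots> \<le> (\<Sum>p\<in>E 1 \<times> E (-1). (A * (s / 3) powr (-1/2)) ^ 3)"
  proof (rule sum_mono)
    fix p assume "p \<in> E 1 \<times> E (-1)"
    then obtain e e' where p: "p = (e, e')" "e \<in> E 1" "e' \<in> E (-1)" by auto
    have "prob (?S p) = measure F {s / 3<..} ^ card {e0, e, e'}"
      using p E_edges unfolding p(1) prod.case by (intro prob_coordinates) auto
    also have "card {e0, e, e'} = 3" using dist[OF p(2,3)] by simp
    finally show "prob (?S p) \<le> (A * (s / 3) powr (-1/2)) ^ 3"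
      using tail_F[of "s / 3"] s by (simp add: power_mono)
  qed
  also have "\<dots> = real (card (E 1) * card (E (-1))) * (A * (s / 3) powr (-1/2)) ^ 3"
    by (simp add: card_cartesian_product)
  also have "\<dots> \<le> 9 * (A * (s / 3) powr (-1/2)) ^ 3"
  proof (rule mult_right_mono)
    have "card (E 1) * card (E (-1)) \<le> 3 * 3" using E_fin by (intro mult_mono) auto
    then have "real (card (E 1) * card (E (-1))) \<le> real (3 * 3)" by (rule of_nat_mono)
    then show "real (card (E 1) * card (E (-1))) \<le> 9" by (simp del: of_nat_mult)
    have "0 \<le> A * (s / 3) powr (-1/2)" using order.trans[OF measure_nonneg tail_F[of "s / 3"]] s by simp
    then show "0 \<le> (A * (s / 3) powr (-1/2)) ^ 3" by simp
  qed
  also have "\<dots> = 9 * A ^ 3 * ((s / 3) powr (-1/2)) ^ 3"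
    by (simp add: power_mult_distrib)
  also have "((s / 3) powr (-1/2)) ^ 3 = (s / 3) powr (-3/2)"
    using s by (simp add: powr_power)
  also have "\<dots> = 3 powr (3/2) * s powr (-3/2)"
  proof -
    have "3 powr (3/2) * s powr (-3/2) = 3 powr (3/2) * (3 * (s / 3)) powr (-3/2)" by simp
    also have "\<dots> = (3 powr (3/2) * 3 powr (-3/2)) * (s / 3) powr (-3/2)"
      using s by (subst powr_mult) (auto simp: mult.assoc)
    also have "3 powr (3/2) * 3 powr (-3/2) = (1 :: real)" by (simp flip: powr_add)
    finally show ?thesis by simp
  qed
  also have "9 * A ^ 3 * \<dots> = tau_const * s powr (-3/2)"
    by (simp add: tau_const_def)
  finally show ?thesis .
qed

text \<open>The line extends \<open>8 m\<close> to both sides because routes join points within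
  \<open>4 m\<close> of a common centre, whose coordinates differ by at most
  \<open>8 m\<close>.\<close>

definition line_time :: "((int ^ 'd) set \<Rightarrow> real) \<Rightarrow> nat \<Rightarrow> int ^ 'd \<Rightarrow> 'd \<Rightarrow> real" where
  "line_time w m u b = (\<Sum>k<16 * m. tau w (u + axis b (int k - 8 * int m)) b)"

text \<open>The threshold of \<open>heavy_tail_sum_bound\<close> per link, for 16 links per unit of
  \<open>m\<close>.\<close>

definition line_const :: real where
  "line_const = 16 * (2 + tau_const * zeta32)"

definition good_line :: "((int ^ 'd) set \<Rightarrow> real) \<Rightarrow> nat \<Rightarrow> int ^ 'd \<Rightarrow> 'd \<Rightarrow> bool" where
  "good_line w m u b \<longleftrightarrow> line_time w m u b \<le> line_const * real m"

text \<open>Links whose indices differ by at least 2 use disjoint edges, so the bound for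
  heavy-tailed sums applies to the \<open>16 * m\<close> links.\<close>

lemma bad_line_prob:
  assumes m: "m > 0"
  shows "prob {w\<in>space P. \<not> good_line w m u b} \<le> (3 + 19 * tau_const) / sqrt (real m)"
proof -
  define X where "X k w = tau w (u + axis b (int k - 8 * int m)) b" for k w
  have "prob {w\<in>space P. (2 + tau_const * zeta32) * real (16 * m) < (\<Sum>k<16 * m. X k w)}
      \<le> (3 + 19 * tau_const) / sqrt (real (16 * m))"
  proof (rule heavy_tail_sum_bound)
    show "random_variable borel (X k)" for k
      unfolding X_def by (rule tau_measurable[OF tau_edges_subset])
    show "prob {w\<in>space P. s < X k w} \<le> tau_const * s powr (-3/2)" if "s > 0" for k s
      unfolding X_def using that by (rule tau_tail)
    show "indep_var borel (X k) borel (X l)" if "k + 2 \<le> l" for k l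
    proof -
      define T where "T k = tau_edges (u + axis b (int k - 8 * int m)) b" for k
      have ne: "\<exists>y. y \<in> e" if "e \<in> T k" for e
        using that by (auto simp: T_def tau_edges_def detour_def)
      have near: "y $ b \<in> {u $ b + int k - 8 * int m, u $ b + int k - 8 * int m + 1}"
        if "e \<in> T k" "y \<in> e" for e k y
        using tau_edges_near(1)[of e "u + axis b (int k - 8 * int m)" b y] that
        by (auto simp: T_def axis_def)
      have "T k \<inter> T l = {}"
      proof (rule ccontr)
        assume "T k \<inter> T l \<noteq> {}"
        then obtain e y where "e \<in> T k" "e \<in> T l" "y \<in> e" using ne by blast
        from near[OF this(1,3)] near[OF this(2,3)] \<open>k + 2 \<le> l\<close> show False by auto
      qed
      then show ?thesis
        unfolding X_def T_def
        by (intro indep_var_local[of "T k" "T l"])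
           (auto simp: T_def tau_local intro!: tau_measurable dest: subsetD[OF tau_edges_subset])
    qed
    show "0 < 16 * m" using m by simp
  qed
  also have "\<dots> \<le> (3 + 19 * tau_const) / sqrt (real m)"
  proof (rule divide_left_mono)
    have "0 \<le> A" using order.trans[OF measure_nonneg tail_F[of 1]] by simp
    then show "0 \<le> 3 + 19 * tau_const" by (simp add: tau_const_def)
  qed (use m in auto)
  finally show ?thesis
    by (simp add: good_line_def line_time_def line_const_def X_def not_le algebra_simps)
qed

end

section \<open>Linear growth and uniqueness of geodesics\<close>

text \<open>By Fubini: the sections of the diagonal are single points, which are null for the law of
  \<open>X\<close>.\<close>

lemma (in prob_space) AE_neq_if_indep:
  fixes X Y :: "'a \<Rightarrow> real"
  assumes indep: "indep_var borel X borel Y" and no_atoms: "\<And>a. prob {x\<in>space M. X x = a} = 0"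
  shows "AE x in M. X x \<noteq> Y x"
proof -
  have [measurable]: "random_variable borel X" "random_variable borel Y"
    using indep by (auto simp: indep_var_distribution_eq)
  interpret X: prob_space "distr M borel X" by (rule prob_space_distr) simp
  interpret Y: prob_space "distr M borel Y" by (rule prob_space_distr) simp
  interpret XY: pair_sigma_finite "distr M borel X" "distr M borel Y" ..
  define D where "D = {p \<in> space (borel \<Otimes>\<^sub>M borel). fst p = (snd p :: real)}"
  have D [measurable]: "D \<in> sets (borel \<Otimes>\<^sub>M borel)" unfolding D_def by measurable
  have "emeasure M {x\<in>space M. X x = Y x} =
      emeasure (distr M (borel \<Otimes>\<^sub>M borel) (\<lambda>x. (X x, Y x))) D"
    by (subst emeasure_distr[OF _ D])
       (simp, auto simp: D_def space_pair_measure intro!: arg_cong[of _ _ "emeasure M"])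
  also have "\<dots> = emeasure (distr M borel X \<Otimes>\<^sub>M distr M borel Y) D"
    using indep by (simp add: indep_var_distribution_eq)
  also have "\<dots> = (\<integral>\<^sup>+y. emeasure (distr M borel X) ((\<lambda>x. (x, y)) -` D) \<partial>distr M borel Y)"
    using D by (intro XY.emeasure_pair_measure_alt2) simp
  also have "\<dots> = (\<integral>\<^sup>+y. 0 \<partial>distr M borel Y)"
  proof (rule nn_integral_cong)
    fix y :: real
    have "(\<lambda>x. (x, y)) -` D = {y}" by (auto simp: D_def space_pair_measure)
    moreover have "emeasure (distr M borel X) {y} = emeasure M {x\<in>space M. X x = y}"
      by (subst emeasure_distr) (auto intro!: arg_cong[of _ _ "emeasure M"])
    ultimately show "emeasure (distr M borel X) ((\<lambda>x. (x, y)) -` D) = 0"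
      using no_atoms[of y] by (simp add: emeasure_eq_measure)
  qed
  finally show ?thesis by (intro AE_I[of _ _ "{x\<in>space M. X x = Y x}"]) auto
qed

context fpp
begin

lemma AE_coordinate: "e \<in> edges \<Longrightarrow> AE s in F. Q s \<Longrightarrow> AE w in P. Q (w e)"
  by (rule AE_distrD[of "\<lambda>w. w e" P F Q]) (simp, simp only: distr_coordinate)

lemma AE_pos_weights: "AE w in P. pos_weights w"
  unfolding pos_weights_def
  by (subst AE_ball_countable[OF edges_countable]) (auto intro: AE_coordinate pos_F)

text \<open>As \<open>F\<close> is concentrated on positive values, \<open>exp (- k * s)\<close>
  tends to 0 almost everywhere, dominated by 1.\<close>

lemma laplace_small:
  assumes "q > 0"
  obtains l where "l > 0" "(\<integral>s. exp (- l * s) \<partial>F) \<le> q"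
proof -
  interpret F: prob_space F by (rule prob_F)
  have "(\<lambda>k. \<integral>s. exp (- real k * s) \<partial>F) \<longlonglongrightarrow> (\<integral>s. 0 \<partial>F)"
  proof (rule integral_dominated_convergence[where w = "\<lambda>_. 1"])
    show "AE s in F. (\<lambda>k. exp (- real k * s)) \<longlonglongrightarrow> 0"
      using pos_F
    proof eventually_elim
      case (elim s)
      then have "exp (- s) < 1" by simp
      then have "(\<lambda>k. exp (- s) ^ k) \<longlonglongrightarrow> 0" by (intro LIMSEQ_realpow_zero) auto
      then show ?case by (simp flip: exp_of_nat_mult)
    qed
    show "AE s in F. norm (exp (- real k * s)) \<le> 1" for k
      using pos_F by eventually_elim simp
  qed (auto simp: measurable_cong_sets[OF sets_F refl])
  then have "\<forall>\<^sub>F k in sequentially. (\<integral>s. exp (- real k * s) \<partial>F) < q"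
    using assms by (auto dest: order_tendstoD(2))
  then have "\<forall>\<^sub>F k in sequentially. (\<integral>s. exp (- real k * s) \<partial>F) < q \<and> 1 \<le> k"
    using eventually_ge_at_top[of 1] by eventually_elim simp
  then obtain k where "(\<integral>s. exp (- real k * s) \<partial>F) < q" "1 \<le> k"
    by (auto simp: eventually_sequentially)
  then show ?thesis by (intro that[of "real k"]) auto
qed

lemma expectation_exp_path_time:
  assumes l: "l > 0" and p: "p \<in> walks n x" "distinct p"
  shows "integrable P (\<lambda>w. exp (- l * path_time w p))"
    and "expectation (\<lambda>w. exp (- l * path_time w p)) = (\<integral>s. exp (- l * s) \<partial>F) ^ n"
proof -
  define E where "E = set (path_edges p)"
  have E: "E \<subseteq> edges" "finite E" "card E = n"
    using p by (auto simp: E_def walks_def distinct_card distinct_path_edges dest: path_edges_subset)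
  have eq: "exp (- l * path_time w p) = (\<Prod>e\<in>E. exp (- l * w e))" for w
    using p(2) E by (simp add: path_time_distinct E_def sum_distrib_left flip: exp_sum sum_negf)
  have meas: "(\<lambda>w. w e) \<in> P \<rightarrow>\<^sub>M F" if "e \<in> E" for e
    using that E by auto
  have indep: "indep_vars (\<lambda>_. borel) (\<lambda>e w. exp (- l * w e)) E"
    by (rule indep_vars_compose2[OF indep_vars_subset[OF indep_coordinates E(1)]])
       (simp add: measurable_cong_sets[OF sets_F refl])
  have int: "integrable P (\<lambda>w. exp (- l * w e))" if "e \<in> E" for e
  proof (rule integrable_const_bound[of _ 1])
    show "AE w in P. norm (exp (- l * w e)) \<le> 1"
      using AE_coordinate[OF subsetD[OF E(1) that] pos_F] by eventually_elim (use l in simp)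
    show "(\<lambda>w. exp (- l * w e)) \<in> borel_measurable P"
      using meas[OF that] by (simp add: measurable_cong_sets[OF refl sets_F])
  qed
  show "integrable P (\<lambda>w. exp (- l * path_time w p))"
    unfolding eq using E(2) indep int by (rule indep_vars_integrable)
  have "expectation (\<lambda>w. exp (- l * path_time w p)) = (\<Prod>e\<in>E. expectation (\<lambda>w. exp (- l * w e)))"
    unfolding eq using E(2) indep int by (rule indep_vars_lebesgue_integral)
  also have "\<dots> = (\<Prod>e\<in>E. \<integral>s. exp (- l * s) \<partial>F)"
  proof (rule prod.cong)
    fix e assume e: "e \<in> E"
    have "(\<integral>s. exp (- l * s) \<partial>F) = (\<integral>s. exp (- l * s) \<partial>distr P F (\<lambda>w. w e))"
      using e E by (subst distr_coordinate) auto
    also have "\<dots> = expectation (\<lambda>w. exp (- l * w e))"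
      using meas[OF e] by (intro integral_distr) (auto simp: measurable_cong_sets[OF sets_F refl])
    finally show "expectation (\<lambda>w. exp (- l * w e)) = (\<integral>s. exp (- l * s) \<partial>F)" by simp
  qed simp
  finally show "expectation (\<lambda>w. exp (- l * path_time w p)) = (\<integral>s. exp (- l * s) \<partial>F) ^ n"
    by (simp add: E(3))
qed

text \<open>A Chernoff bound, with \<open>l\<close> so large that the Laplace transform beats the
  number \<open>D ^ n\<close> of walks, followed by Borel-Cantelli.\<close>

lemma AE_linear_growth: "\<exists>c>0. \<forall>x. AE w in P. linear_growth w c x"
proof -
  define D where "D = real (2 * CARD('d))"
  have D: "D > 0" by (simp add: D_def)
  obtain l where l: "l > 0" "(\<integral>s. exp (- l * s) \<partial>F) \<le> 1 / (4 * D)"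
    using laplace_small[of "1 / (4 * D)"] D by auto
  \<comment> \<open>With this \<open>c\<close>, \<open>exp (- l * c * n)\<close> equals
    \<open>(1/2) ^ n\<close>: a single path is too fast with probability at most
    \<open>(2 / (4 * D)) ^ n\<close>, and some path with probability at most
    \<open>(1/2) ^ n\<close>.\<close>
  define c where "c = ln 2 / l"
  have c: "c > 0" using l by (simp add: c_def)
  have "AE w in P. linear_growth w c x" for x
  proof -
    define W where "W n = {p\<in>walks n x. distinct p}" for n
    have W: "finite (W n)" "real (card (W n)) \<le> D ^ n" for n
    proof -
      have "finite (walks n x)" "card (walks n x) \<le> (2 * CARD('d)) ^ n"
        using walks_finite_card by blast+
      moreover from this have "card (W n) \<le> card (walks n x)"
        unfolding W_def by (intro card_mono) auto
      ultimately have "card (W n) \<le> (2 * CARD('d)) ^ n" by linarith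
      then show "real (card (W n)) \<le> D ^ n" unfolding D_def
        by (metis of_nat_le_iff of_nat_power)
      show "finite (W n)" using \<open>finite (walks n x)\<close> by (simp add: W_def)
    qed
    have meas [measurable]: "(\<lambda>w. path_time w p) \<in> borel_measurable P" if "p \<in> W n" for p n
      using that by (intro path_time_measurable) (auto simp: W_def walks_def dest: path_edges_subset)
    define B where "B n = (\<Union>p\<in>W n. {w\<in>space P. path_time w p < c * real n})" for n
    have B_meas: "B n \<in> sets P" for n
      unfolding B_def using W(1) meas by (intro sets.finite_UN) auto
    have one: "prob {w\<in>space P. path_time w p < c * real n} \<le> (2 / (4 * D)) ^ n" if p: "p \<in> W n" for n p
    proof -
      have p': "p \<in> walks n x" "distinct p" using p by (auto simp: W_def)
      have "prob {w\<in>space P. path_time w p < c * real n} \<le>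
          prob {w\<in>space P. (1/2) ^ n \<le> exp (- l * path_time w p)}"
      proof (rule finite_measure_mono)
        show "{w\<in>space P. path_time w p < c * real n} \<subseteq> {w\<in>space P. (1/2) ^ n \<le> exp (- l * path_time w p)}"
        proof safe
          fix w assume "path_time w p < c * real n"
          then have "l * path_time w p < ln 2 * real n"
            using l by (simp add: c_def field_simps)
          then have "exp (real n * (- ln 2)) \<le> exp (- l * path_time w p)" by (simp add: mult.commute)
          then show "(1/2) ^ n \<le> exp (- l * path_time w p)"
            by (simp add: exp_of_nat_mult exp_minus power_one_over field_simps)
        qed
        show "{w\<in>space P. (1/2) ^ n \<le> exp (- l * path_time w p)} \<in> sets P"
          using meas[OF p] by measurable
      qed
      also have "\<dots> \<le> expectation (\<lambda>w. exp (- l * path_time w p)) / (1/2) ^ n"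
        using integral_Markov_inequality_measure[OF expectation_exp_path_time(1)[OF l(1) p'], of "{}" "(1/2) ^ n"]
        by simp
      also have "\<dots> \<le> (1 / (4 * D)) ^ n / (1/2) ^ n"
        unfolding expectation_exp_path_time(2)[OF l(1) p']
        using l(2) by (intro divide_right_mono power_mono) (auto intro!: Bochner_Integration.integral_nonneg)
      also have "\<dots> = (2 / (4 * D)) ^ n" by (simp flip: power_divide)
      finally show ?thesis .
    qed
    have B_le: "prob (B n) \<le> (1/2) ^ n" for n
    proof -
      have "prob (B n) \<le> (\<Sum>p\<in>W n. prob {w\<in>space P. path_time w p < c * real n})"
        unfolding B_def using W(1) meas by (intro finite_measure_subadditive_finite) auto
      also have "\<dots> \<le> (\<Sum>p\<in>W n. (2 / (4 * D)) ^ n)" by (rule sum_mono) (rule one)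
      also have "\<dots> = real (card (W n)) * (2 / (4 * D)) ^ n" by simp
      also have "\<dots> \<le> D ^ n * (2 / (4 * D)) ^ n"
        using W(2) D by (intro mult_right_mono) auto
      also have "\<dots> = (1/2) ^ n" using D by (simp flip: power_mult_distrib)
      finally show ?thesis .
    qed
    have "AE w in P. \<forall>\<^sub>F n in sequentially. w \<in> space P - B n"
    proof (rule borel_cantelli_AE1[OF B_meas])
      show "summable (\<lambda>n. prob (B n))"
        by (rule summable_comparison_test'[of "\<lambda>n. (1/2) ^ n" 0]) (use B_le in \<open>auto intro: summable_geometric\<close>)
    qed (simp add: emeasure_eq_measure)
    then show ?thesis
    proof eventually_elim
      case (elim w)
      then show ?case unfolding linear_growth_def
        by eventually_elim (auto simp: B_def W_def not_less)
    qed
  qed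
  with c show ?thesis by blast
qed

text \<open>Some edge \<open>e\<close> lies on \<open>p\<close> but not on \<open>q\<close>, so a
  tie prescribes \<open>w e\<close> as a function \<open>h\<close> of the other weights, which is
  independent of \<open>w e\<close>.\<close>

lemma AE_no_ties:
  assumes p: "path_from_to x y p" "distinct p" and q: "path_from_to x y q" "distinct q" and "p \<noteq> q"
  shows "AE w in P. path_time w p \<noteq> path_time w q"
proof -
  obtain e where e: "e \<in> set (path_edges p)" "e \<notin> set (path_edges q)"
    using simple_path_determined_by_edges[OF p(2) q(2)] assms by (auto simp: path_from_to_def)
  have edges: "set (path_edges p) \<subseteq> edges" "set (path_edges q) \<subseteq> edges"
    using p q by (auto dest: path_from_to_edges)
  define h where "h w = (\<Sum>e\<in>set (path_edges q). w e) - (\<Sum>e\<in>set (path_edges p) - {e}. w e)"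
    for w :: "(int ^ 'd) set \<Rightarrow> real"
  have split: "path_time w p = path_time w q \<longleftrightarrow> w e = h w" for w
    using sum.remove[OF _ e(1), of w] p q by (auto simp: path_time_distinct h_def)
  have coord: "(\<lambda>w. w e') \<in> borel_measurable (PiM J (\<lambda>_. F))" if "e' \<in> J" for e' J
    using measurable_component_singleton[OF that, of "\<lambda>_. F"]
    by (simp add: measurable_cong_sets[OF refl sets_F])
  have "indep_var borel (\<lambda>w. w e) borel h"
  proof (rule indep_var_local[of "{e}" "edges - {e}"])
    show "h \<in> borel_measurable (PiM (edges - {e}) (\<lambda>_. F))"
      unfolding h_def using e edges by (intro borel_measurable_diff borel_measurable_sum coord) auto
    show "h (restrict w (edges - {e})) = h w" for w
      unfolding h_def using e edges by (intro arg_cong2[of _ _ _ _ "(-)"] sum.cong) auto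
  qed (use e edges in \<open>auto intro: coord\<close>)
  moreover have "prob {w\<in>space P. w e = a} = 0" for a
    using prob_coordinates[of "{e}" "{a}"] e edges no_atoms[of a] by auto
  ultimately show ?thesis using AE_neq_if_indep[of "\<lambda>w. w e" h] by (simp add: split)
qed

lemma AE_regular:
  "\<exists>c>0. AE w in P. pos_weights w \<and> unique_geodesics w \<and> (\<forall>x. linear_growth w c x)"
proof -
  obtain c where c: "c > 0" "\<And>x. AE w in P. linear_growth w c x"
    using AE_linear_growth by auto
  have ties: "AE w in P. \<forall>x y p q. path_from_to x y p \<and> distinct p \<and> path_from_to x y q \<and> distinct q \<and> p \<noteq> q
      \<longrightarrow> path_time w p \<noteq> path_time w q"
    unfolding AE_all_countable by (auto intro: AE_no_ties simp: AE_impI)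
  have "AE w in P. \<forall>x. linear_growth w c x" using c(2) by (simp add: AE_all_countable)
  with ties AE_pos_weights have "AE w in P. pos_weights w \<and> unique_geodesics w \<and> (\<forall>x. linear_growth w c x)"
  proof eventually_elim
    case (elim w)
    have "\<exists>!p. is_geodesic w x y p" for x y
    proof (rule ex_ex1I)
      show "\<exists>p. is_geodesic w x y p"
        using geodesic_exists[OF pos_imp_nonneg_weights c(1)] elim by blast
      fix p q assume "is_geodesic w x y p" "is_geodesic w x y q"
      then show "p = q"
        using geodesic_distinct[of w x y] elim unfolding is_geodesic_def by metis
    qed
    with elim show ?case by (simp add: unique_geodesics_def)
  qed
  with c(1) show ?thesis by blast
qed

end

section \<open>Choosing good lines\<close>

definition int_box :: "nat \<Rightarrow> (int ^ 'd) set" where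
  "int_box r = {x. \<forall>i. \<bar>x $ i\<bar> \<le> int r}"

lemma int_box_finite_card:
  "finite (int_box r :: (int ^ 'd) set) \<and> card (int_box r :: (int ^ 'd) set) \<le> (2 * r + 1) ^ CARD('d)"
proof -
  define S where "S = PiE (UNIV :: 'd set) (\<lambda>_. {- int r..int r})"
  have S: "finite S" "card S = (2 * r + 1) ^ CARD('d)"
    unfolding S_def by (auto simp: finite_PiE card_PiE nat_add_distrib nat_mult_distrib)
  have sub: "vec_nth ` (int_box r :: (int ^ 'd) set) \<subseteq> S"
    by (auto simp: S_def int_box_def abs_le_iff minus_le_iff)
  have inj: "inj_on vec_nth (int_box r :: (int ^ 'd) set)" by (auto intro: inj_onI simp: vec_eq_iff)
  from finite_subset[OF sub S(1)] inj card_mono[OF S(1) sub] show ?thesis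
    by (simp add: S(2) card_image finite_image_iff)
qed

lemmas finite_int_box = conjunct1[OF int_box_finite_card]

context fpp
begin

section \<open>Union bounds over choices of separated lines\<close>

definition slab :: "'d \<Rightarrow> int \<Rightarrow> (int ^ 'd) set set" where
  "slab a h = {e\<in>edges. \<forall>y\<in>e. \<bar>y $ a - h\<bar> \<le> 1}"

lemma tau_edges_slab: "a \<noteq> b \<Longrightarrow> tau_edges (u + axis b k) b \<subseteq> slab a (u $ a)"
proof
  fix e assume "a \<noteq> b" "e \<in> tau_edges (u + axis b k) b"
  then show "e \<in> slab a (u $ a)"
    using tau_edges_near(2)[of e "u + axis b k" b _ a] tau_edges_subset[of "u + axis b k" b]
    by (auto simp: slab_def axis_def)
qed

lemma line_time_slab:
  assumes "a \<noteq> b" "u $ a = h"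
  shows "(\<lambda>w. line_time w m u b) \<in> borel_measurable (PiM (slab a h) (\<lambda>_. F))"
    and "line_time (restrict w (slab a h)) m u b = line_time w m u b"
  using assms tau_edges_slab[of a b u] unfolding line_time_def
  by (auto intro!: borel_measurable_sum tau_measurable simp: tau_local)

text \<open>The factor \<open>dimension\<close> is the union bound over the lines of one
  candidate.\<close>

definition bad_line_const :: real where
  "bad_line_const = real dimension * (3 + 19 * tau_const)"

lemma good_line_measurable [measurable]: "Measurable.pred P (\<lambda>w. good_line w m u b)"
proof -
  have "(\<lambda>w. line_time w m u b) \<in> borel_measurable P"
    unfolding line_time_def by (intro borel_measurable_sum tau_measurable[OF tau_edges_subset])
  then show ?thesis unfolding good_line_def by measurable
qed

text \<open>
  A line orthogonal to the coordinate \<open>a\<close> uses only edges within distance 1 of its hyperplane, so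
  families of lines lying in hyperplanes at distance 3 are independent.
\<close>

lemma all_bad_prob:
  fixes S :: "nat \<Rightarrow> ((int ^ 'd) \<times> 'd) set"
  assumes m: "m > 0" and K: "K > 0"
    and sep: "\<And>i k. i < k \<Longrightarrow> k < K \<Longrightarrow> 3 \<le> \<bar>h i - h k\<bar>"
    and S: "\<And>i. i < K \<Longrightarrow> finite (S i) \<and> card (S i) \<le> dimension"
    and lines: "\<And>i u b. i < K \<Longrightarrow> (u, b) \<in> S i \<Longrightarrow> b \<noteq> a \<and> u $ a = h i"
  shows "prob {w\<in>space P. \<forall>i<K. \<exists>(u, b)\<in>S i. \<not> good_line w m u b} \<le> (bad_line_const / sqrt (real m)) ^ K"
proof -
  \<comment> \<open>The indicator of failure of the \<open>i\<close>-th candidate, real-valued to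
    fit \<open>indep_local\<close>.\<close>
  define g :: "nat \<Rightarrow> ((int ^ 'd) set \<Rightarrow> real) \<Rightarrow> real"
    where "g i w = (if \<forall>(u, b)\<in>S i. good_line w m u b then 0 else 1)" for i w
  have indep: "indep_vars (\<lambda>_. borel) g {..<K}"
  proof (rule indep_local[where J = "\<lambda>i. slab a (h i)"])
    show "disjoint_family_on (\<lambda>i. slab a (h i)) {..<K}"
    proof (unfold disjoint_family_on_def, intro ballI impI)
      fix i k assume ik: "i \<in> {..<K}" "k \<in> {..<K}" "i \<noteq> k"
      then have "3 \<le> \<bar>h i - h k\<bar>"
        using sep[of i k] sep[of k i] by (cases i k rule: linorder_cases) (auto simp: abs_minus_commute)
      moreover have "\<exists>y. y \<in> e" if "e \<in> slab a (h i)" for e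
        using that by (auto simp: slab_def edges_def)
      moreover have "\<bar>h i - h k\<bar> \<le> 2" if "e \<in> slab a (h i)" "e \<in> slab a (h k)" "y \<in> e" for e y
      proof -
        have "\<bar>y $ a - h i\<bar> \<le> 1" "\<bar>y $ a - h k\<bar> \<le> 1" using that by (auto simp: slab_def)
        then show ?thesis by linarith
      qed
      ultimately show "slab a (h i) \<inter> slab a (h k) = {}" by fastforce
    qed
    show "g i \<in> borel_measurable (PiM (slab a (h i)) (\<lambda>_. F))" if "i \<in> {..<K}" for i
    proof -
      have [measurable]: "Measurable.pred (PiM (slab a (h i)) (\<lambda>_. F)) (\<lambda>w. good_line w m u b)"
        if "(u, b) \<in> S i" for u b
      proof -
        have "(\<lambda>w. line_time w m u b) \<in> borel_measurable (PiM (slab a (h i)) (\<lambda>_. F))"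
          using lines[of i u b] that \<open>i \<in> {..<K}\<close> by (intro line_time_slab(1)) auto
        then show ?thesis unfolding good_line_def by measurable
      qed
      have [measurable]: "Measurable.pred (PiM (slab a (h i)) (\<lambda>_. F)) (\<lambda>w. \<forall>p\<in>S i. good_line w m (fst p) (snd p))"
        using S[of i] \<open>i \<in> {..<K}\<close> by (intro pred_intros_finite(3)) auto
      have "(\<lambda>w. if \<forall>p\<in>S i. good_line w m (fst p) (snd p) then 0 else 1 :: real)
          \<in> borel_measurable (PiM (slab a (h i)) (\<lambda>_. F))"
        by measurable
      then show ?thesis by (simp add: g_def[abs_def] case_prod_beta)
    qed
    show "g i (restrict w (slab a (h i))) = g i w" if "i \<in> {..<K}" for i w
    proof -
      have "good_line (restrict w (slab a (h i))) m u b = good_line w m u b" if "(u, b) \<in> S i" for u b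
        using lines[of i u b] that \<open>i \<in> {..<K}\<close> line_time_slab(2)[of a b u "h i" w m]
        by (auto simp: good_line_def)
      then show ?thesis unfolding g_def by (intro if_cong ball_cong) auto
    qed
  qed (auto simp: slab_def)
  have "{w\<in>space P. \<forall>i<K. \<exists>(u, b)\<in>S i. \<not> good_line w m u b} = (\<Inter>i\<in>{..<K}. g i -` {1} \<inter> space P)"
    using K by (auto simp: g_def case_prod_beta split: if_splits)
  then have "prob {w\<in>space P. \<forall>i<K. \<exists>(u, b)\<in>S i. \<not> good_line w m u b} = (\<Prod>i<K. prob (g i -` {1} \<inter> space P))"
    using indep_varsD[OF indep, of "{..<K}" "\<lambda>_. {1}"] K by auto
  also have "\<dots> \<le> (\<Prod>i<K. bad_line_const / sqrt (real m))"
  proof (rule prod_mono, intro conjI)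
    fix i assume i: "i \<in> {..<K}"
    have "g i -` {1} \<inter> space P = (\<Union>p\<in>S i. {w\<in>space P. \<not> good_line w m (fst p) (snd p)})"
      by (force simp: g_def split: if_splits)
    then have "prob (g i -` {1} \<inter> space P) \<le> (\<Sum>p\<in>S i. prob {w\<in>space P. \<not> good_line w m (fst p) (snd p)})"
      using S[of i] i by (auto intro!: finite_measure_subadditive_finite)
    also have "\<dots> \<le> (\<Sum>p\<in>S i. (3 + 19 * tau_const) / sqrt (real m))"
      by (intro sum_mono bad_line_prob m)
    also have "\<dots> = real (card (S i)) * ((3 + 19 * tau_const) / sqrt (real m))" by simp
    also have "\<dots> \<le> real dimension * ((3 + 19 * tau_const) / sqrt (real m))"
    proof (rule mult_right_mono)
      have "0 \<le> A" using order.trans[OF measure_nonneg tail_F[of 1]] by simp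
      then show "0 \<le> (3 + 19 * tau_const) / sqrt (real m)" by (simp add: tau_const_def)
    qed (use S i in auto)
    finally show "prob (g i -` {1} \<inter> space P) \<le> bad_line_const / sqrt (real m)"
      by (simp add: bad_line_const_def)
  qed simp
  finally show ?thesis by simp
qed

text \<open>
  With this many choices, \<open>m\<^sup>-\<^sup>1\<^sup>/\<^sup>2\<close> to the power \<open>num_choices\<close> still beats the \<open>m\<^sup>2\<^sup>d\<close> pairs of
  endpoints by a factor \<open>m\<^sup>-\<^sup>2\<close>.
\<close>

definition num_choices :: nat where
  "num_choices = 4 * dimension + 4"

text \<open>A union bound over \<open>Z m\<close> followed by Borel-Cantelli. An element
  \<open>z\<close> describes a routing problem and \<open>S z i\<close> the lines of its
  \<open>i\<close>-th candidate solution; the candidates for one \<open>z\<close> lie in separated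
  hyperplanes and fail independently.\<close>

lemma AE_some_good:
  fixes S :: "'z \<Rightarrow> nat \<Rightarrow> ((int ^ 'd) \<times> 'd) set" and Q :: real
  assumes fin: "\<And>m. finite (Z m)" and card: "\<And>m. m > 0 \<Longrightarrow> real (card (Z m)) \<le> Q * real m ^ (2 * dimension)"
    and sep: "\<And>m z i k. z \<in> Z m \<Longrightarrow> i < k \<Longrightarrow> k < num_choices \<Longrightarrow> 3 \<le> \<bar>h z i - h z k\<bar>"
    and S: "\<And>m z i. z \<in> Z m \<Longrightarrow> i < num_choices \<Longrightarrow> finite (S z i) \<and> card (S z i) \<le> dimension"
    and lines: "\<And>m z i u b. z \<in> Z m \<Longrightarrow> i < num_choices \<Longrightarrow> (u, b) \<in> S z i \<Longrightarrow> b \<noteq> a z \<and> u $ a z = h z i"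
  shows "AE w in P. \<forall>\<^sub>F m in sequentially. \<forall>z\<in>Z m. \<exists>i<num_choices. \<forall>(u, b)\<in>S z i. good_line w m u b"
proof -
  define E where "E m z = {w\<in>space P. \<forall>i<num_choices. \<exists>(u, b)\<in>S z i. \<not> good_line w m u b}" for m z
  define B where "B m = (\<Union>z\<in>Z m. E m z)" for m
  have E_meas: "E m z \<in> sets P" if "z \<in> Z m" for m z
  proof -
    have "Measurable.pred P (\<lambda>w. \<forall>i\<in>{..<num_choices}. \<exists>p\<in>S z i. \<not> good_line w m (fst p) (snd p))"
      using S[OF that] by (intro pred_intros_finite(3,4)) auto
    then show ?thesis by (simp add: E_def case_prod_beta pred_def Ball_def)
  qed
  then have B_meas: "B m \<in> sets P" for m unfolding B_def using fin by (intro sets.finite_UN) auto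
  have bound: "prob (B m) \<le> Q * bad_line_const ^ num_choices / real m ^ 2" if m: "m > 0" for m
  proof -
    have "prob (B m) \<le> (\<Sum>z\<in>Z m. prob (E m z))"
      unfolding B_def using fin E_meas by (intro finite_measure_subadditive_finite) auto
    also have "\<dots> \<le> (\<Sum>z\<in>Z m. (bad_line_const / sqrt (real m)) ^ num_choices)"
    proof (rule sum_mono)
      fix z assume "z \<in> Z m"
      then show "prob (E m z) \<le> (bad_line_const / sqrt (real m)) ^ num_choices"
        unfolding E_def using m sep S lines
        by (intro all_bad_prob[where h = "h z" and a = "a z"]) (auto simp: num_choices_def)
    qed
    also have "\<dots> = real (card (Z m)) * (bad_line_const / sqrt (real m)) ^ num_choices" by simp
    \<comment> \<open>That \<open>num_choices\<close> is even gives the sign of the power here and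
      removes the square root below.\<close>
    also have "\<dots> \<le> (Q * real m ^ (2 * dimension)) * (bad_line_const / sqrt (real m)) ^ num_choices"
      using card[OF m] by (intro mult_right_mono zero_le_even_power) (auto simp: num_choices_def)
    also have "sqrt (real m) ^ num_choices = real m ^ (2 * dimension) * real m ^ 2"
    proof -
      have "num_choices = 2 * (2 * dimension + 2)" by (simp add: num_choices_def)
      then have "sqrt (real m) ^ num_choices = (sqrt (real m) ^ 2) ^ (2 * dimension + 2)"
        by (simp only: power_mult)
      then show ?thesis by (simp add: power_add power2_eq_square)
    qed
    then have "(Q * real m ^ (2 * dimension)) * (bad_line_const / sqrt (real m)) ^ num_choices =
        Q * bad_line_const ^ num_choices / real m ^ 2"
      using m by (simp add: power_divide)
    finally show ?thesis .
  qed
  have "AE w in P. \<forall>\<^sub>F m in sequentially. w \<in> space P - B m"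
  proof (rule borel_cantelli_AE1[OF B_meas])
    have "summable (\<lambda>m. Q * bad_line_const ^ num_choices * inverse (real m ^ 2))"
      by (intro summable_mult inverse_power_summable) simp
    then show "summable (\<lambda>m. prob (B m))"
      by (rule summable_comparison_test'[where N = 1]) (use bound in \<open>auto simp: divide_inverse\<close>)
  qed (simp add: emeasure_eq_measure)
  then show ?thesis
  proof eventually_elim
    case (elim w)
    then show ?case by eventually_elim (fastforce simp: B_def E_def)
  qed
qed

text \<open>The sites \<open>v\<close> are arbitrary so that they may be picked on a path that
  depends on the weights. The union bound survives this because the offsets from \<open>v 0\<close>
  range over a box independent of \<open>m\<close>.\<close>

definition near_choice :: "((int ^ 'd) set \<Rightarrow> real) \<Rightarrow> nat \<Rightarrow> nat \<Rightarrow> bool" where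
  "near_choice w R m \<longleftrightarrow> (\<forall>v a b. a \<noteq> b \<longrightarrow> v 0 \<in> int_box (R * m) \<longrightarrow>
     (\<forall>i<num_choices. v i - v 0 \<in> int_box (3 * num_choices)) \<longrightarrow>
     (\<forall>i k. i < k \<longrightarrow> k < num_choices \<longrightarrow> 3 \<le> \<bar>v i $ a - v k $ a\<bar>) \<longrightarrow>
     (\<exists>i<num_choices. good_line w m (v i) b))"

lemma int_box_card_linear:
  assumes "m > 0" "R > 0"
  shows "real (card (int_box (R * m) :: (int ^ 'd) set)) \<le> real (3 * R) ^ dimension * real m ^ dimension"
proof -
  have "card (int_box (R * m) :: (int ^ 'd) set) \<le> (2 * (R * m) + 1) ^ dimension"
    using int_box_finite_card by (metis dimension)
  also have "\<dots> \<le> (3 * R * m) ^ dimension"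
    using assms by (intro power_mono) (auto simp: Suc_leI)
  finally show ?thesis by (metis of_nat_le_iff of_nat_mult of_nat_power power_mult_distrib)
qed

lemma AE_near_choice:
  assumes R: "R > 0"
  shows "AE w in P. \<forall>\<^sub>F m in sequentially. near_choice w R m"
proof -
  let ?K = num_choices
  define Off where "Off = {os. set os \<subseteq> (int_box (3 * ?K) :: (int ^ 'd) set) \<and> length os = ?K}"
  have Off: "finite Off" unfolding Off_def by (intro finite_lists_length_eq finite_int_box)
  define Z0 where "Z0 m = (int_box (R * m) :: (int ^ 'd) set) \<times> Off \<times> (UNIV :: 'd set) \<times> (UNIV :: 'd set)" for m
  define Z where "Z m = {(x, os, a, b) \<in> Z0 m. a \<noteq> b \<and>
    (\<forall>i k. i < k \<longrightarrow> k < ?K \<longrightarrow> 3 \<le> \<bar>os ! i $ a - os ! k $ a\<bar>)}" for m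
  define h where "h = (\<lambda>(x :: int ^ 'd, os :: (int ^ 'd) list, a :: 'd, b :: 'd) i. (x + os ! i) $ a :: int)"
  define S where "S = (\<lambda>(x :: int ^ 'd, os :: (int ^ 'd) list, a :: 'd, b :: 'd) i. {(x + os ! i, b)})"
  define Q where "Q = real (3 * R) ^ dimension * real (card Off * dimension * dimension)"
  have Z0: "finite (Z0 m)" for m 
    unfolding Z0_def by (intro finite_cartesian_product finite_int_box Off) auto
  have sub: "Z m \<subseteq> Z0 m" for m by (auto simp: Z_def)
  have AE: "AE w in P. \<forall>\<^sub>F m in sequentially. \<forall>z\<in>Z m. \<exists>i<?K. \<forall>(u, b)\<in>S z i. good_line w m u b"
  proof (rule AE_some_good[where h = h and a = "\<lambda>(x :: int ^ 'd, os :: (int ^ 'd) list, a :: 'd, b :: 'd). a" and Q = Q])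
    show "finite (Z m)" for m by (rule finite_subset[OF sub Z0])
    show "real (card (Z m)) \<le> Q * real m ^ (2 * dimension)" if m: "m > 0" for m
    proof -
      have "card (Z m) \<le> card (int_box (R * m) :: (int ^ 'd) set) * (card Off * dimension * dimension)"
        using card_mono[OF Z0 sub, of m] by (simp add: Z0_def card_cartesian_product mult.assoc dimension)
      then have "real (card (Z m)) \<le> real (card (int_box (R * m) :: (int ^ 'd) set)) * real (card Off * dimension * dimension)"
        by (metis of_nat_le_iff of_nat_mult)
      also have "\<dots> \<le> (real (3 * R) ^ dimension * real m ^ dimension) * real (card Off * dimension * dimension)"
        by (intro mult_right_mono int_box_card_linear m R) simp
      also have "\<dots> = Q * real m ^ dimension" by (simp add: Q_def)
      also have "\<dots> \<le> Q * real m ^ (2 * dimension)"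
        using m by (intro mult_left_mono power_increasing) (auto simp: Q_def)
      finally show ?thesis .
    qed
  qed (use dim dimension in \<open>auto simp: Z_def h_def S_def\<close>)
  then show ?thesis
  proof eventually_elim
    case (elim w)
    then show ?case
    proof eventually_elim
      case (elim m)
      show ?case unfolding near_choice_def
      proof (intro allI impI)
        fix v :: "nat \<Rightarrow> int ^ 'd" and a b :: 'd
        assume v: "a \<noteq> b" "v 0 \<in> int_box (R * m)" "\<forall>i<?K. v i - v 0 \<in> int_box (3 * ?K)"
          "\<forall>i k. i < k \<longrightarrow> k < ?K \<longrightarrow> 3 \<le> \<bar>v i $ a - v k $ a\<bar>"
        define os where "os = map (\<lambda>i. v i - v 0) [0..<?K]"
        have nth: "os ! i = v i - v 0" if "i < ?K" for i using that by (simp add: os_def)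
        have sep: "3 \<le> \<bar>os ! i $ a - os ! k $ a\<bar>" if "i < k" "k < ?K" for i k
          using v(4) that nth[of i] nth[of k] by simp
        have "os \<in> Off" using v(3) by (auto simp: Off_def os_def)
        then have "(v 0, os, a, b) \<in> Z m" using v sep by (simp add: Z_def Z0_def)
        with elim obtain i where i: "i < ?K" "\<forall>(u, b)\<in>S (v 0, os, a, b) i. good_line w m u b" by blast
        then have "good_line w m (v i) b" by (simp add: S_def nth)
        with i(1) show "\<exists>i<?K. good_line w m (v i) b" by blast
      qed
    qed
  qed
qed

section \<open>Staircase paths inside a hyperplane\<close>

definition coord_index :: "'d \<Rightarrow> nat" where
  "coord_index = (SOME f. bij_betw f UNIV {0..<dimension})"

lemma bij_coord_index: "bij_betw coord_index UNIV {0..<dimension}"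
proof -
  have "\<exists>f. bij_betw f (UNIV :: 'd set) {0..<dimension}"
    using ex_bij_betw_finite_nat[of "UNIV :: 'd set"] by (simp add: dimension)
  then show ?thesis unfolding coord_index_def by (rule someI_ex)
qed

text \<open>The corners of the path that adjusts the coordinates one after the other.\<close>

definition stair :: "int ^ 'd \<Rightarrow> int ^ 'd \<Rightarrow> nat \<Rightarrow> int ^ 'd" where
  "stair x y n = (\<chi> c. if coord_index c < n then y $ c else x $ c)"

definition good_stair :: "((int ^ 'd) set \<Rightarrow> real) \<Rightarrow> nat \<Rightarrow> 'd \<Rightarrow> int ^ 'd \<Rightarrow> int ^ 'd \<Rightarrow> bool" where
  "good_stair w m a x y \<longleftrightarrow> (\<forall>b. b \<noteq> a \<longrightarrow> good_line w m (stair x y (coord_index b)) b)"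

text \<open>
  The stair stays in the hyperplane where the coordinate \<open>a\<close> is that of its endpoints, which is what
  makes its translates along \<open>a\<close> independent.
\<close>

definition stair_choice :: "((int ^ 'd) set \<Rightarrow> real) \<Rightarrow> nat \<Rightarrow> nat \<Rightarrow> bool" where
  "stair_choice w R m \<longleftrightarrow> (\<forall>x\<in>int_box (R * m). \<forall>y\<in>int_box (R * m). \<forall>a. x $ a = y $ a \<longrightarrow>
     (\<exists>i<num_choices. good_stair w m a (x + axis a (3 * int i)) (y + axis a (3 * int i))))"

text \<open>Both endpoints are free, which produces the exponent \<open>2 * dimension\<close> in
  \<open>AE_some_good\<close>. The candidates are the translates of one stair along \<open>a\<close>
  by multiples of 3.\<close>

lemma AE_stair_choice:
  assumes R: "R > 0"
  shows "AE w in P. \<forall>\<^sub>F m in sequentially. stair_choice w R m"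
proof -
  let ?K = num_choices
  define Z0 where "Z0 m = (int_box (R * m) :: (int ^ 'd) set) \<times> (int_box (R * m) :: (int ^ 'd) set) \<times> (UNIV :: 'd set)" for m
  define Z where "Z m = {(x, y, a) \<in> Z0 m. x $ a = y $ a}" for m
  define h where "h = (\<lambda>(x :: int ^ 'd, y :: int ^ 'd, a :: 'd) i. x $ a + 3 * int i :: int)"
  define S where "S = (\<lambda>(x, y, a) i.
    (\<lambda>b. (stair (x + axis a (3 * int i)) (y + axis a (3 * int i)) (coord_index b), b)) ` {b. b \<noteq> a})"
  define Q where "Q = real (3 * R) ^ dimension * real (3 * R) ^ dimension * real dimension"
  have Z0: "finite (Z0 m)" for m 
    unfolding Z0_def by (intro finite_cartesian_product finite_int_box) auto
  have sub: "Z m \<subseteq> Z0 m" for m by (auto simp: Z_def)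
  have AE: "AE w in P. \<forall>\<^sub>F m in sequentially. \<forall>z\<in>Z m. \<exists>i<?K. \<forall>(u, b)\<in>S z i. good_line w m u b"
  proof (rule AE_some_good[where h = h and a = "\<lambda>(x :: int ^ 'd, y :: int ^ 'd, a :: 'd). a" and Q = Q])
    show "finite (Z m)" for m by (rule finite_subset[OF sub Z0])
    show "real (card (Z m)) \<le> Q * real m ^ (2 * dimension)" if m: "m > 0" for m
    proof -
      have "card (Z m) \<le> card (int_box (R * m) :: (int ^ 'd) set) * card (int_box (R * m) :: (int ^ 'd) set) * dimension"
        using card_mono[OF Z0 sub, of m] by (simp add: Z0_def card_cartesian_product mult.assoc dimension)
      then have "real (card (Z m)) \<le> real (card (int_box (R * m) :: (int ^ 'd) set)) *
          real (card (int_box (R * m) :: (int ^ 'd) set)) * real dimension"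
        by (metis of_nat_le_iff of_nat_mult)
      also have "\<dots> \<le> (real (3 * R) ^ dimension * real m ^ dimension) *
          (real (3 * R) ^ dimension * real m ^ dimension) * real dimension"
        by (intro mult_right_mono mult_mono int_box_card_linear m R) auto
      also have "\<dots> = Q * real m ^ (2 * dimension)" by (simp add: Q_def mult_2 power_add)
      finally show ?thesis .
    qed
    show "finite (S z i) \<and> card (S z i) \<le> dimension" for z i
      by (cases z) (auto simp: S_def dimension[symmetric] intro!: order.trans[OF card_image_le] card_mono)
    show "b \<noteq> (case z of (x, y, a) \<Rightarrow> a) \<and> u $ (case z of (x, y, a) \<Rightarrow> a) = h z i"
      if "z \<in> Z m" "(u, b) \<in> S z i" for z i m u b
      using that by (cases z) (auto simp: S_def h_def stair_def Z_def)
  qed (auto simp: Z_def h_def)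
  then show ?thesis
  proof eventually_elim
    case (elim w)
    then show ?case
    proof eventually_elim
      case (elim m)
      show ?case unfolding stair_choice_def
      proof (intro ballI allI impI)
        fix x y :: "int ^ 'd" and a :: 'd
        assume xy: "x \<in> int_box (R * m)" "y \<in> int_box (R * m)" "x $ a = y $ a"
        then have "(x, y, a) \<in> Z m" by (simp add: Z_def Z0_def)
        with elim obtain i where "i < ?K" "\<forall>(u, b)\<in>S (x, y, a) i. good_line w m u b" by blast
        then show "\<exists>i<?K. good_stair w m a (x + axis a (3 * int i)) (y + axis a (3 * int i))"
          by (intro exI[of _ i]) (auto simp: S_def good_stair_def)
      qed
    qed
  qed
qed

lemma passage_time_line:
  assumes w: "nonneg_weights w"
  shows "passage_time w (u + axis b p) (u + axis b (p + int n)) \<le>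
    (\<Sum>k\<in>{p..<p + int n}. tau w (u + axis b k) b)"
proof (induction n)
  case (Suc n)
  have ax: "u + axis b (p + int n) + axis b 1 = u + axis b (p + int (Suc n))"
    by (auto simp: vec_eq_iff axis_def)
  have "passage_time w (u + axis b p) (u + axis b (p + int (Suc n))) \<le>
      passage_time w (u + axis b p) (u + axis b (p + int n)) +
      passage_time w (u + axis b (p + int n)) (u + axis b (p + int (Suc n)))"
    by (rule passage_time_triangle[OF w])
  also have "\<dots> \<le> (\<Sum>k\<in>{p..<p + int n}. tau w (u + axis b k) b) + tau w (u + axis b (p + int n)) b"
    using Suc passage_time_le_tau[OF w, of "u + axis b (p + int n)" b] by (simp only: ax add_mono)
  also have "\<dots> = (\<Sum>k\<in>insert (p + int n) {p..<p + int n}. tau w (u + axis b k) b)"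
    by (subst sum.insert) auto
  also have "insert (p + int n) {p..<p + int n} = {p..<p + int (Suc n)}" by auto
  finally show ?case .
qed (simp add: passage_time_refl[OF w])

lemma good_line_passage_time:
  assumes w: "nonneg_weights w" and good: "good_line w m u b"
    and pq: "\<bar>p\<bar> \<le> 8 * int m" "\<bar>q\<bar> \<le> 8 * int m"
  shows "passage_time w (u + axis b p) (u + axis b q) \<le> line_const * real m"
  using pq
proof (induction p q rule: linorder_wlog)
  case (le p q)
  have "line_time w m u b = (\<Sum>k\<in>{- 8 * int m..<8 * int m}. tau w (u + axis b k) b)"
    unfolding line_time_def
    by (rule sum.reindex_bij_witness[of _ "\<lambda>k. nat (k + 8 * int m)" "\<lambda>k. int k - 8 * int m"]) auto
  moreover have "(\<Sum>k\<in>{p..<q}. tau w (u + axis b k) b) \<le> (\<Sum>k\<in>{- 8 * int m..<8 * int m}. tau w (u + axis b k) b)"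
    using le by (intro sum_mono2 tau_nonneg[OF w]) auto
  moreover have "passage_time w (u + axis b p) (u + axis b q) \<le> (\<Sum>k\<in>{p..<q}. tau w (u + axis b k) b)"
    using passage_time_line[OF w, of u b p "nat (q - p)"] le by simp
  ultimately show ?case using good by (simp add: good_line_def)
next
  case (sym p q)
  then show ?case by (subst passage_time_sym) simp
qed

lemma line_const_nonneg: "0 \<le> line_const"
proof -
  have "0 \<le> A" using order.trans[OF measure_nonneg tail_F[of 1]] by simp
  moreover have "0 \<le> zeta32" using sum_powr_le_zeta32[of 0] by simp
  ultimately show ?thesis by (simp add: line_const_def tau_const_def)
qed

text \<open>Each coordinate costs at most one good line; the step in coordinate \<open>a\<close> is
  trivial because the endpoints agree there.\<close>

lemma good_stair_passage_time:
  assumes w: "nonneg_weights w" and good: "good_stair w m a x y" and a: "x $ a = y $ a"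
    and near: "\<And>b. \<bar>y $ b - x $ b\<bar> \<le> 8 * int m"
  shows "passage_time w x y \<le> real dimension * (line_const * real m)"
proof -
  have step: "passage_time w (stair x y n) (stair x y (Suc n)) \<le> line_const * real m" if n: "n < dimension" for n
  proof -
    obtain b where b: "coord_index b = n"
      using bij_coord_index n unfolding bij_betw_def by (metis atLeastLessThan_iff imageE le0)
    have inj: "coord_index c = coord_index b \<longleftrightarrow> c = b" for c
      using bij_coord_index by (auto simp: bij_betw_def inj_def)
    have st: "stair x y (Suc n) = stair x y n + axis b (y $ b - x $ b)"
      unfolding vec_eq_iff
    proof
      fix c
      show "stair x y (Suc n) $ c = (stair x y n + axis b (y $ b - x $ b)) $ c"
        by (cases "c = b") (use b inj[of c] in \<open>auto simp: stair_def axis_def less_Suc_eq\<close>)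
    qed
    show ?thesis
    proof (cases "b = a")
      case True
      then have "stair x y (Suc n) = stair x y n" using st a by (simp add: vec_eq_iff axis_def)
      then show ?thesis using line_const_nonneg by (simp add: passage_time_refl[OF w])
    next
      case False
      then have "good_line w m (stair x y n) b" using good b by (auto simp: good_stair_def)
      from good_line_passage_time[OF w this, of 0 "y $ b - x $ b"] near[of b]
      show ?thesis by (simp add: st axis_def zero_vec_def[symmetric])
    qed
  qed
  have "passage_time w x (stair x y n) \<le> real n * (line_const * real m)" if "n \<le> dimension" for n
    using that
  proof (induction n)
    case 0
    have "stair x y 0 = x" by (simp add: stair_def)
    then show ?case by (simp add: passage_time_refl[OF w])
  next
    case (Suc n)
    then show ?case
      using passage_time_triangle[OF w, of x "stair x y (Suc n)" "stair x y n"] step[of n]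
      by (simp add: algebra_simps)
  qed
  moreover have "stair x y dimension = y"
    using bij_coord_index by (auto simp: stair_def vec_eq_iff bij_betw_def)
  ultimately show ?thesis using order_refl[of dimension] by metis
qed

end

section \<open>The Busemann function along the axis\<close>

text \<open>Equivalently, the lower limit of \<open>s n / n\<close> is less than \<open>- c\<close>.
  The margin \<open>1 / Suc q\<close> runs over a countable set, which gives measurability, and
  absorbs bounded perturbations, which gives shift invariance.\<close>

definition neg_drift :: "(nat \<Rightarrow> real) \<Rightarrow> real \<Rightarrow> bool" where
  "neg_drift s c \<longleftrightarrow> (\<exists>q::nat. \<forall>m. \<exists>n\<ge>m. s n \<le> - (c + 1 / real (Suc q)) * real n)"

lemma neg_drift_shift: "neg_drift (\<lambda>n. s (Suc n) - x) c \<longleftrightarrow> neg_drift s c"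
proof
  assume "neg_drift (\<lambda>n. s (Suc n) - x) c"
  then obtain q :: nat where q: "\<And>m. \<exists>n\<ge>m. s (Suc n) - x \<le> - (c + 1 / real (Suc q)) * real n"
    by (auto simp: neg_drift_def)
  \<comment> \<open>Half of the margin is kept; the other half pays for \<open>x\<close> and for the
    shifted index.\<close>
  define d where "d = 1 / real (Suc (2 * q + 1))"
  have d: "d > 0" "1 / real (Suc q) = 2 * d" by (auto simp: d_def field_simps)
  show "neg_drift s c" unfolding neg_drift_def
  proof (rule exI[of _ "2 * q + 1"], rule allI)
    fix m
    obtain n where n: "n \<ge> max m (nat \<lceil>(x + c + d) / d\<rceil>)"
      "s (Suc n) - x \<le> - (c + 1 / real (Suc q)) * real n"
      using q by blast
    then have "(x + c + d) / d \<le> real n" by linarith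
    then have "x + c + d \<le> d * real n" using d by (simp add: field_simps)
    then have "s (Suc n) \<le> - (c + d) * real (Suc n)"
      using n(2) unfolding d(2) by (simp add: algebra_simps)
    then show "\<exists>n\<ge>m. s n \<le> - (c + 1 / real (Suc (2 * q + 1))) * real n"
      using n(1) unfolding d_def[symmetric] by (intro exI[of _ "Suc n"]) auto
  qed
next
  assume "neg_drift s c"
  then obtain q :: nat where q: "\<And>m. \<exists>n\<ge>m. s n \<le> - (c + 1 / real (Suc q)) * real n"
    by (auto simp: neg_drift_def)
  define d where "d = 1 / real (Suc (2 * q + 1))"
  have d: "d > 0" "1 / real (Suc q) = 2 * d" by (auto simp: d_def field_simps)
  show "neg_drift (\<lambda>n. s (Suc n) - x) c" unfolding neg_drift_def
  proof (rule exI[of _ "2 * q + 1"], rule allI)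
    fix m
    obtain n' where n': "n' \<ge> max (Suc m) (nat \<lceil>(- x - c - d) / d\<rceil>)"
      "s n' \<le> - (c + 1 / real (Suc q)) * real n'"
      using q by blast
    then obtain n where n: "n' = Suc n" by (cases n') auto
    have "(- x - c - d) / d \<le> real (Suc n)" using n'(1) n by linarith
    then have "- x - c - d \<le> d * real (Suc n)" using d by (simp add: field_simps)
    then have "s (Suc n) - x \<le> - (c + d) * real n"
      using n'(2) unfolding d(2) n by (simp add: algebra_simps)
    then show "\<exists>n\<ge>m. s (Suc n) - x \<le> - (c + 1 / real (Suc (2 * q + 1))) * real n"
      using n'(1) n unfolding d_def[symmetric] by (intro exI[of _ n]) auto
  qed
qed

text \<open>Increments eventually below \<open>L / 2 < 0\<close> would drive the sequence to minus
  infinity.\<close>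

lemma increment_limit_nonneg:
  fixes a :: "nat \<Rightarrow> real"
  assumes lim: "(\<lambda>n. a (Suc n) - a n) \<longlonglongrightarrow> L" and a: "\<And>n. 0 \<le> a n"
  shows "0 \<le> L"
proof (rule ccontr)
  assume "\<not> 0 \<le> L"
  then have L: "L < L / 2" "L / 2 < 0" by auto
  obtain N where N: "\<And>n. n \<ge> N \<Longrightarrow> a (Suc n) - a n < L / 2"
    using order_tendstoD(2)[OF lim L(1)] by (auto simp: eventually_sequentially)
  have bound: "a (N + k) \<le> a N + real k * (L / 2)" for k
  proof (induction k)
    case (Suc k)
    then show ?case using N[of "N + k"] by (simp add: field_simps)
  qed simp
  define l where "l = - (L / 2)"
  have l: "l > 0" using L by (simp add: l_def)
  obtain k :: nat where "a N / l < real k" using reals_Archimedean2 by blast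
  then have "a N < real k * l" using l by (simp add: pos_divide_less_eq)
  then have "a N + real k * (L / 2) < 0" by (simp add: l_def)
  then show False using bound[of k] a[of "N + k"] by linarith
qed

context fpp
begin

text \<open>The sign is chosen so that passage times in \<open>shift w\<close> are those in
  \<open>w\<close> between points moved one step backwards along the axis; Busemann increments at
  \<open>k\<close> then become those at \<open>k + 1\<close>.\<close>

definition shift :: "((int ^ 'd) set \<Rightarrow> real) \<Rightarrow> (int ^ 'd) set \<Rightarrow> real" where
  "shift w = (\<lambda>e\<in>edges. w ((\<lambda>v. v + axis j (-1)) ` e))"

lemma shift_preserves: "shift \<in> P \<rightarrow>\<^sub>M P" "distr P P shift = P"
proof -
  define f :: "(int ^ 'd) set \<Rightarrow> (int ^ 'd) set" where "f = image (\<lambda>v. v + axis j (-1))"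
  have f: "f \<in> edges \<rightarrow> edges"
  proof
    fix e :: "(int ^ 'd) set"
    assume "e \<in> edges"
    then obtain x y where "e = {x, y}" "adjacent x y" by (auto simp: edges_def)
    then show "f e \<in> edges" by (simp add: f_def edge_iff)
  qed
  have "inj (\<lambda>v. v + axis j (-1) :: int ^ 'd)" by (auto intro: injI)
  then have inj: "inj_on f edges" 
    unfolding f_def by (intro inj_onI) (simp only: inj_image_eq_iff)
  have shift: "shift = (\<lambda>w. \<lambda>e\<in>edges. w (f e))" by (auto simp: shift_def f_def)
  show "shift \<in> P \<rightarrow>\<^sub>M P"
    unfolding shift using f by (intro measurable_restrict measurable_component_singleton) auto
  show "distr P P shift = P"
    unfolding shift using distr_PiM_reindex[of edges "\<lambda>_. F" f edges] prob_F inj f by simp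
qed

lemma passage_time_shift:
  "passage_time (shift w) x y = passage_time w (x + axis j (-1)) (y + axis j (-1))"
  unfolding shift_def by (rule passage_time_translate)

lemma passage_time_shift_axis:
  "passage_time (shift w) (axis j p) (axis j q) = passage_time w (axis j (p - 1)) (axis j (q - 1))"
proof -
  have "axis j p + axis j (-1) = axis j (p - 1)" for p :: int by (auto simp: axis_def vec_eq_iff)
  then show ?thesis by (simp add: passage_time_shift)
qed

lemma AE_shift: "AE w in P. Q w \<Longrightarrow> AE w in P. Q (shift w)"
  by (rule AE_distrD[OF shift_preserves(1)]) (simp only: shift_preserves(2))

lemma integral_shift:
  assumes "g \<in> borel_measurable P"
  shows "(\<integral>w. g (shift w) \<partial>P) = (\<integral>w. g w \<partial>P :: real)"
  using integral_distr[OF shift_preserves(1) assms] by (simp only: shift_preserves(2))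

section \<open>Measurability and integrability of passage times\<close>

lemma passage_time_measurable [measurable]: "(\<lambda>w. passage_time w x y) \<in> borel_measurable P"
  unfolding passage_time_def
  by (intro borel_measurable_cINF_real path_time_measurable) (auto dest: path_from_to_edges)

lemma AE_nonneg_weights: "AE w in P. nonneg_weights w"
  using AE_pos_weights by eventually_elim (rule pos_imp_nonneg_weights)

text \<open>A single edge weight need not be integrable under these tails; the minimum
  \<open>tau\<close> over three paths is.\<close>

lemma integrable_step: "integrable P (\<lambda>w. passage_time w (axis j (p - 1)) (axis j p))"
proof (rule Bochner_Integration.integrable_bound)
  show "integrable P (\<lambda>w. tau w (axis j (p - 1)) j)"
  proof (rule integrable_if_tail)
    show "random_variable borel (\<lambda>w. tau w (axis j (p - 1)) j)"
      by (rule tau_measurable[OF tau_edges_subset])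
    show "AE w in P. 0 \<le> tau w (axis j (p - 1)) j"
      using AE_nonneg_weights by eventually_elim (rule tau_nonneg)
  qed (rule tau_tail)
  have ax: "axis j (p - 1) + axis j 1 = axis j p" by (auto simp: axis_def vec_eq_iff)
  show "AE w in P. norm (passage_time w (axis j (p - 1)) (axis j p)) \<le> norm (tau w (axis j (p - 1)) j)"
    using AE_nonneg_weights
  proof eventually_elim
    case (elim w)
    then show ?case
      using passage_time_le_tau[OF elim, of "axis j (p - 1)" j] passage_time_nonneg[OF elim]
      by (simp add: ax)
  qed
qed measurable

lemma integrable_passage_time_axis: "integrable P (\<lambda>w. passage_time w (axis j p) (axis j (p + int n)))"
proof (induction n)
  case 0
  have "AE w in P. passage_time w (axis j p) (axis j (p + int 0)) = 0"
    using AE_nonneg_weights by eventually_elim (simp add: passage_time_refl)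
  then have "integrable P (\<lambda>w. passage_time w (axis j p) (axis j (p + int 0))) \<longleftrightarrow> integrable P (\<lambda>_. 0 :: real)"
    by (intro integrable_cong_AE) auto
  then show ?case by simp
next
  case (Suc n)
  show ?case
  proof (rule Bochner_Integration.integrable_bound)
    show "integrable P (\<lambda>w. passage_time w (axis j p) (axis j (p + int n)) +
        passage_time w (axis j (p + int (Suc n) - 1)) (axis j (p + int (Suc n))))"
      using Suc integrable_step by (rule Bochner_Integration.integrable_add)
    show "AE w in P. norm (passage_time w (axis j p) (axis j (p + int (Suc n)))) \<le>
      norm (passage_time w (axis j p) (axis j (p + int n)) +
        passage_time w (axis j (p + int (Suc n) - 1)) (axis j (p + int (Suc n))))"
      using AE_nonneg_weights
    proof eventually_elim
      case (elim w)
      then show ?case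
        using passage_time_triangle[OF elim, of "axis j p" "axis j (p + int (Suc n))" "axis j (p + int n)"]
          passage_time_nonneg[OF elim] by simp
    qed
  qed measurable
qed

section \<open>Busemann increments and their stationarity\<close>

definition busemann_approx :: "nat \<Rightarrow> nat \<Rightarrow> ((int ^ 'd) set \<Rightarrow> real) \<Rightarrow> real" where
  "busemann_approx k n w =
     passage_time w (axis j (- int (Suc k))) (axis j (int n)) - passage_time w (axis j (- int k)) (axis j (int n))"

definition busemann_step :: "nat \<Rightarrow> ((int ^ 'd) set \<Rightarrow> real) \<Rightarrow> real" where
  "busemann_step k w = lim (\<lambda>n. busemann_approx k n w)"

lemma busemann_approx_shift: "busemann_approx k (Suc n) (shift w) = busemann_approx (Suc k) n w"
proof -
  have "- int (Suc k) - 1 = - int (Suc (Suc k))" "- int k - 1 = - int (Suc k)" "int (Suc n) - 1 = int n"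
    by auto
  then show ?thesis by (simp only: busemann_approx_def passage_time_shift_axis)
qed

lemma busemann_limit_shift:
  "(\<lambda>n. busemann_approx k n (shift w)) \<longlonglongrightarrow> L \<longleftrightarrow> (\<lambda>n. busemann_approx (Suc k) n w) \<longlonglongrightarrow> L"
  by (subst filterlim_sequentially_Suc[symmetric]) (simp only: busemann_approx_shift)

text \<open>Both sequences have the same limits, so \<open>lim\<close> agrees for every
  configuration. Invariance of the drift event thus holds pointwise, not merely almost
  surely.\<close>

lemma busemann_step_shift: "busemann_step k (shift w) = busemann_step (Suc k) w"
  unfolding busemann_step_def lim_def by (simp only: busemann_limit_shift)

lemma busemann_step_funpow: "busemann_step k ((shift ^^ n) w) = busemann_step (k + n) w"
proof (induction n arbitrary: w)
  case (Suc n)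
  show ?case by (simp only: funpow_Suc_right comp_def Suc busemann_step_shift) simp
qed simp

lemma busemann_step_measurable [measurable]: "busemann_step k \<in> borel_measurable P"
  unfolding busemann_step_def busemann_approx_def by measurable

context
  assumes conv: "AE w in P. convergent (\<lambda>n. busemann_approx 0 n w)"
begin

lemma AE_convergent: "AE w in P. convergent (\<lambda>n. busemann_approx k n w)"
proof (induction k)
  case (Suc k)
  then show ?case using AE_shift[OF Suc] by (simp add: convergent_def busemann_limit_shift)
qed (rule conv)

lemma AE_busemann_sum:
  "AE w in P. \<forall>k. (\<lambda>n. passage_time w (axis j (- int k)) (axis j (int n)) - passage_time w (axis j 0) (axis j (int n)))
     \<longlonglongrightarrow> (\<Sum>i<k. busemann_step i w)"
proof -
  have "AE w in P. \<forall>k. convergent (\<lambda>n. busemann_approx k n w)"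
    using AE_convergent by (simp add: AE_all_countable)
  then show ?thesis
  proof eventually_elim
    case (elim w)
    have "(\<lambda>n. \<Sum>i<k. busemann_approx i n w) \<longlonglongrightarrow> (\<Sum>i<k. busemann_step i w)" for k
      using elim by (intro tendsto_sum) (auto simp: busemann_step_def convergent_LIMSEQ_iff)
    moreover have "(\<Sum>i<k. busemann_approx i n w) =
        passage_time w (axis j (- int k)) (axis j (int n)) - passage_time w (axis j 0) (axis j (int n))" for k n
      by (induction k) (auto simp: busemann_approx_def)
    ultimately show ?case by simp
  qed
qed

text \<open>The bound does not depend on \<open>n\<close>, so it serves as dominating function in
  the limit.\<close>

lemma AE_busemann_approx_bound:
  "AE w in P. norm (busemann_approx 0 n w) \<le> passage_time w (axis j (- 1)) (axis j 0)"
  using AE_nonneg_weights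
proof eventually_elim
  case (elim w)
  show ?case
    using passage_time_triangle[OF elim, of "axis j (-1)" "axis j (int n)" "axis j 0"]
      passage_time_triangle[OF elim, of "axis j 0" "axis j (int n)" "axis j (-1)"]
      passage_time_sym[of w "axis j 0" "axis j (-1)"]
    by (simp add: busemann_approx_def abs_le_iff)
qed

lemma integrable_busemann_step: "integrable P (busemann_step 0)"
proof (rule Bochner_Integration.integrable_bound)
  show "integrable P (\<lambda>w. passage_time w (axis j (-1)) (axis j 0))"
    using integrable_step[of 0] by simp
  have "AE w in P. \<forall>n. norm (busemann_approx 0 n w) \<le> passage_time w (axis j (- 1)) (axis j 0)"
    using AE_busemann_approx_bound by (simp add: AE_all_countable)
  then show "AE w in P. norm (busemann_step 0 w) \<le> norm (passage_time w (axis j (-1)) (axis j 0))"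
    using conv
  proof eventually_elim
    case (elim w)
    have "(\<lambda>n. norm (busemann_approx 0 n w)) \<longlonglongrightarrow> norm (busemann_step 0 w)"
      using elim by (intro tendsto_norm) (auto simp: busemann_step_def convergent_LIMSEQ_iff)
    then have "norm (busemann_step 0 w) \<le> passage_time w (axis j (- 1)) (axis j 0)"
      by (rule LIMSEQ_le_const2) (use elim in auto)
    then show ?case by simp
  qed
qed measurable

lemma integral_busemann_step_nonneg:
  assumes U [measurable]: "U \<in> sets P" and inv: "\<And>w. w \<in> space P \<Longrightarrow> shift w \<in> U \<longleftrightarrow> w \<in> U"
  shows "0 \<le> (\<integral>w. indicator U w * busemann_step 0 w \<partial>P)"
proof (rule increment_limit_nonneg)
  define a where "a n = (\<integral>w. indicator U w * passage_time w (axis j 0) (axis j (int n)) \<partial>P)" for n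
  have int: "integrable P (\<lambda>w. indicator U w * passage_time w (axis j p) (axis j (p + int n)))" for p n
    using integrable_real_mult_indicator[OF U integrable_passage_time_axis] by (simp add: mult.commute)
  \<comment> \<open>By invariance of \<open>U\<close>, the shift turns \<open>a (Suc n)\<close> into
    the integral over \<open>U\<close> of the time from \<open>-1\<close> to
    \<open>n\<close>.\<close>
  have incr: "(\<integral>w. indicator U w * busemann_approx 0 n w \<partial>P) = a (Suc n) - a n" for n
  proof -
    have "a (Suc n) = (\<integral>w. indicator U (shift w) *
        passage_time (shift w) (axis j 0) (axis j (int (Suc n))) \<partial>P)"
      unfolding a_def by (rule integral_shift[symmetric]) measurable
    also have "\<dots> = (\<integral>w. indicator U w * passage_time w (axis j (-1)) (axis j (int n)) \<partial>P)"
      by (intro Bochner_Integration.integral_cong)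
         (auto simp: inv passage_time_shift_axis indicator_def)
    also have "\<dots> - a n = (\<integral>w. indicator U w * busemann_approx 0 n w \<partial>P)"
      unfolding a_def busemann_approx_def
      using int[of "-1" "Suc n"] int[of 0 n]
      by (subst Bochner_Integration.integral_diff[symmetric]) (auto simp: algebra_simps)
    finally show ?thesis by simp
  qed
  show "(\<lambda>n. a (Suc n) - a n) \<longlonglongrightarrow> (\<integral>w. indicator U w * busemann_step 0 w \<partial>P)"
    unfolding incr[symmetric]
  proof (rule integral_dominated_convergence)
    show "integrable P (\<lambda>w. passage_time w (axis j (-1)) (axis j 0))"
      using integrable_step[of 0] by simp
    show "AE w in P. (\<lambda>n. indicator U w * busemann_approx 0 n w) \<longlonglongrightarrow> indicator U w * busemann_step 0 w"
      using conv by eventually_elim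
        (auto intro!: tendsto_mult_left simp: busemann_step_def convergent_LIMSEQ_iff)
    show "AE w in P. norm (indicator U w * busemann_approx 0 n w) \<le> passage_time w (axis j (- 1)) (axis j 0)" for n
      using AE_busemann_approx_bound[of n]
      by eventually_elim (auto simp: indicator_def intro: order.trans[OF abs_ge_zero])
    show "(\<lambda>w. indicator U w * busemann_approx 0 n w) \<in> borel_measurable P" for n
      unfolding busemann_approx_def by measurable
  qed measurable
  show "0 \<le> a n" for n
    unfolding a_def using AE_nonneg_weights
    by (intro integral_nonneg_AE) (auto elim!: eventually_mono simp: passage_time_nonneg)
qed

lemma AE_no_neg_drift:
  assumes c: "c > 0"
  shows "AE w in P. \<not> neg_drift (\<lambda>n. \<Sum>i<n. busemann_step i w) c"
proof -
  define U where "U = {w\<in>space P. neg_drift (\<lambda>n. \<Sum>i<n. busemann_step i w) c}"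
  have U [measurable]: "U \<in> sets P" unfolding U_def neg_drift_def by measurable
  have shift_space: "shift w \<in> space P" if "w \<in> space P" for w
    using measurable_space[OF shift_preserves(1) that] .
  have inv: "shift w \<in> U \<longleftrightarrow> w \<in> U" if w: "w \<in> space P" for w
  proof -
    have "(\<Sum>i<n. busemann_step i (shift w)) = (\<Sum>i<Suc n. busemann_step i w) - busemann_step 0 w" for n
      by (subst sum.lessThan_Suc_shift) (simp add: busemann_step_shift)
    then show ?thesis
      using w shift_space[OF w] neg_drift_shift[of "\<lambda>n. \<Sum>i<n. busemann_step i w"]
      by (simp only: U_def mem_Collect_eq simp_thms)
  qed
  \<comment> \<open>The factor \<open>indicator U\<close> makes the event of the maximal theorem
    equal to \<open>U\<close>: outside \<open>U\<close> the whole orbit stays outside and every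
    running maximum is 0.\<close>
  define g where "g w = indicator U w * (- busemann_step 0 w - c)" for w
  have "integrable P (\<lambda>w. - busemann_step 0 w - c)" using integrable_busemann_step by simp
  from integrable_real_mult_indicator[OF U this] have g_int: "integrable P g"
    by (simp add: g_def[abs_def] mult.commute)
  have orbit: "(shift ^^ n) w \<in> U" "(shift ^^ n) w \<in> space P" if "w \<in> U" for w n
    using that inv shift_space by (induction n) (auto simp: U_def)
  have zero: "running_max shift g n w = 0" if "w \<in> space P" "w \<notin> U" for w n
    using that
  proof (induction n arbitrary: w)
    case (Suc n)
    then show ?case using shift_space inv by (simp add: g_def)
  qed simp
  have pos: "\<exists>n. 0 < running_max shift g n w" if w: "w \<in> U" for w
  proof -
    obtain q :: nat where "\<And>m. \<exists>n\<ge>m. (\<Sum>i<n. busemann_step i w) \<le> - (c + 1 / real (Suc q)) * real n"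
      using w by (auto simp: U_def neg_drift_def)
    then obtain n where n: "n \<ge> 1" "(\<Sum>i<n. busemann_step i w) \<le> - (c + 1 / real (Suc q)) * real n"
      by blast
    have "(\<Sum>k<n. g ((shift ^^ k) w)) = (\<Sum>k<n. - busemann_step k w - c)"
      using orbit[OF w] by (simp add: g_def busemann_step_funpow)
    also have "\<dots> = - (\<Sum>k<n. busemann_step k w) - c * real n"
      by (simp add: sum_subtractf sum_negf)
    also have "\<dots> \<ge> 1 / real (Suc q) * real n" using n(2) by (simp add: algebra_simps)
    finally have "0 < (\<Sum>k<n. g ((shift ^^ k) w))"
      using n(1) by (smt (verit) divide_pos_pos mult_pos_pos of_nat_0_less_iff zero_less_Suc less_le_trans zero_less_one)
    then show ?thesis using orbit_sum_le_running_max[of g shift w n] by (intro exI[of _ n]) linarith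
  qed
  have "0 \<le> (\<integral>w. indicator U w * g w \<partial>P)"
  proof (rule maximal_ergodic[OF shift_preserves g_int _ U])
    show "AE w in P. indicator U w = (1::real) \<longleftrightarrow> (\<exists>n. 0 < running_max shift g n w)"
    proof (rule AE_I2)
      fix w assume w: "w \<in> space P"
      show "indicator U w = (1::real) \<longleftrightarrow> (\<exists>n. 0 < running_max shift g n w)"
        using pos[of w] zero[OF w] by (cases "w \<in> U") auto
    qed
  qed
  also have "\<dots> = (\<integral>w. - (indicator U w * busemann_step 0 w) - c * indicator U w \<partial>P)"
    by (intro Bochner_Integration.integral_cong) (auto simp: g_def indicator_def)
  also have "\<dots> = - (\<integral>w. indicator U w * busemann_step 0 w \<partial>P) - c * prob U"
  proof -
    have "integrable P (\<lambda>w. indicator U w * busemann_step 0 w)"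
      using integrable_real_mult_indicator[OF U integrable_busemann_step] by (simp add: mult.commute)
    moreover have "integrable P (indicator U :: _ \<Rightarrow> real)"
      using U by (simp add: emeasure_eq_measure)
    ultimately show ?thesis using sets.sets_into_space[OF U]
      by (subst Bochner_Integration.integral_diff) (auto simp: Int_absorb2)
  qed
  finally have "c * prob U \<le> 0" using integral_busemann_step_nonneg[OF U inv] by simp
  then have "prob U = 0" using c measure_nonneg[of P U] by (auto simp: mult_le_0_iff)
  then have "AE w in P. w \<notin> U" using U by (intro AE_not_in) (simp add: null_sets_def emeasure_eq_measure)
  then show ?thesis using AE_space by eventually_elim (simp add: U_def)
qed

end

end

section \<open>Routing from a limit geodesic to the axis\<close>

lemma inj_leaves_int_box:
  fixes \<gamma> :: "nat \<Rightarrow> int ^ 'd"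
  assumes "inj \<gamma>"
  shows "\<exists>i\<ge>n. \<gamma> i \<notin> int_box r"
proof (rule ccontr)
  assume "\<not> ?thesis"
  then have "\<gamma> ` {n..} \<subseteq> int_box r" by auto
  then have "finite (\<gamma> ` {n..})" using finite_int_box by (rule finite_subset)
  moreover have "inj_on \<gamma> {n..}" using assms by (rule inj_on_subset) simp
  ultimately have "finite {n..}" by (simp add: finite_image_iff)
  with infinite_Ici[of n] show False by contradiction
qed

text \<open>Let \<open>\<rho>\<close> be the norm of a vertex whose direction is within
  \<open>1 / q\<close> of the backward one, and \<open>m\<close> the ceiling of
  \<open>\<rho> / q\<close>. The vertex is within \<open>m\<close> of the axis point
  \<open>- \<rho>\<close>, and \<open>\<rho>\<close> differs from \<open>q * m\<close> by at most
  \<open>q\<close>, hence by at most \<open>m\<close>.\<close>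

lemma direction_visits:
  fixes \<gamma> :: "nat \<Rightarrow> int ^ 'd"
  assumes inj: "inj \<gamma>" and z: "z \<in> asymptotic_directions \<gamma>" and near: "norm (z + axis j 1) < 1 / real q"
    and q: "q > 0"
  shows "\<exists>i m. M \<le> m \<and> (\<forall>b. \<bar>\<gamma> i $ b + axis j (int (q * m)) $ b\<bar> \<le> 2 * int m)"
proof -
  obtain r where r: "strict_mono r" "(\<lambda>i. sgn (real_vec (\<gamma> (r i)))) \<longlonglongrightarrow> z"
    using z by (auto simp: asymptotic_directions_def)
  have lim: "(\<lambda>i. norm (sgn (real_vec (\<gamma> (r i))) + axis j 1)) \<longlonglongrightarrow> norm (z + axis j 1)"
    using r(2) by (intro tendsto_intros)
  obtain i0 where i0: "\<And>i. i \<ge> i0 \<Longrightarrow> norm (sgn (real_vec (\<gamma> (r i))) + axis j 1) < 1 / real q"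
    using order_tendstoD(2)[OF lim near] by (auto simp: eventually_sequentially)
  have "inj (\<gamma> \<circ> r)" by (rule inj_compose[OF inj strict_mono_imp_inj_on[OF r(1)]])
  \<comment> \<open>Outside this box \<open>\<rho> / q\<close> exceeds \<open>M + q\<close>, which
    yields both \<open>M \<le> m\<close> and \<open>q \<le> m\<close>.\<close>
  then obtain i where i: "i \<ge> i0" "(\<gamma> \<circ> r) i \<notin> int_box (q * (M + q))"
    using inj_leaves_int_box by blast
  define x where "x = \<gamma> (r i)"
  define \<rho> where "\<rho> = norm (real_vec x)"
  obtain b0 where "int (q * (M + q)) < \<bar>x $ b0\<bar>" using i(2) by (auto simp: int_box_def x_def not_le)
  then have "real (q * (M + q)) < \<bar>real_of_int (x $ b0)\<bar>" by linarith
  also have "\<dots> \<le> \<rho>" using component_le_norm_cart[of "real_vec x" b0] by (simp add: \<rho>_def real_vec_def)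
  finally have \<rho>_big: "real q * real (M + q) < \<rho>" by simp
  then have \<rho>: "\<rho> > 0" by (smt (verit) mult_nonneg_nonneg of_nat_0_le_iff)
  define m where "m = nat \<lceil>\<rho> / real q\<rceil>"
  have m: "\<rho> / real q \<le> real m" "real m < \<rho> / real q + 1"
    using \<rho> q unfolding m_def by (auto simp: of_nat_nat) linarith+
  then have m': "\<rho> \<le> real q * real m" "real q * real m < \<rho> + real q"
    using q by (auto simp: field_simps)
  have "real (M + q) < \<rho> / real q" using \<rho>_big q by (simp add: field_simps)
  with m(1) have "real (M + q) < real m" by linarith
  then have M: "M \<le> m" "q \<le> m" by auto
  have comp: "\<bar>real_of_int (x $ b) + \<rho> * (axis j 1 :: real ^ 'd) $ b\<bar> \<le> real m" for b
  proof -
    have "real_vec x + \<rho> *\<^sub>R axis j 1 = \<rho> *\<^sub>R (sgn (real_vec x) + axis j 1)"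
      using \<rho> by (simp add: sgn_div_norm \<rho>_def scaleR_right_distrib)
    then have "norm (real_vec x + \<rho> *\<^sub>R axis j 1) = \<rho> * norm (sgn (real_vec x) + axis j 1)"
      using \<rho> by simp
    also have "\<dots> \<le> \<rho> * (1 / real q)"
      using i0[OF i(1)] \<rho> by (intro mult_left_mono) (auto simp: x_def)
    also have "\<dots> \<le> real m" using m by simp
    finally show ?thesis
      using component_le_norm_cart[of "real_vec x + \<rho> *\<^sub>R axis j 1" b] by (simp add: real_vec_def)
  qed
  have "\<bar>x $ b + axis j (int (q * m)) $ b\<bar> \<le> 2 * int m" for b
  proof (cases "b = j")
    case True
    then have "\<bar>real_of_int (x $ b) + \<rho>\<bar> \<le> real m" using comp[of b] by (simp add: axis_def)
    then have "\<bar>real_of_int (x $ b) + real q * real m\<bar> \<le> 2 * real m" using m' M by linarith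
    then have "\<bar>real_of_int (x $ b + int (q * m))\<bar> \<le> real_of_int (2 * int m)" by simp
    then show ?thesis using True unfolding axis_def by (simp only: of_int_abs[symmetric] of_int_le_iff) simp
  next
    case False
    then have "\<bar>real_of_int (x $ b)\<bar> \<le> real m" using comp[of b] by (simp add: axis_def)
    then have "\<bar>x $ b\<bar> \<le> int m" by linarith
    then show ?thesis using False by (simp add: axis_def)
  qed
  with M(1) show ?thesis unfolding x_def by blast
qed

text \<open>Consider the first time at which some coordinate \<open>c\<close> has moved by
  \<open>3 * K\<close>. Until then this coordinate changes by at most 1 per step, so it takes all
  intermediate values, in particular the multiples of 3, while the path stays near
  \<open>\<gamma> i\<close>. The vertices found are separated candidates on the path itself.\<close>

lemma path_crosses_hyperplanes:
  fixes \<gamma> :: "nat \<Rightarrow> int ^ 'd"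
  assumes path: "infinite_path \<gamma>" and inj: "inj \<gamma>"
  obtains c s l where "\<bar>s :: int\<bar> = 1" "\<And>k. k < K \<Longrightarrow> \<gamma> (l k) $ c = \<gamma> i $ c + s * (3 * int k)"
    "\<And>k. k < K \<Longrightarrow> \<gamma> (l k) - \<gamma> i \<in> int_box (3 * K)" "l 0 = i"
proof -
  define d where "d n b = \<gamma> (i + n) $ b - \<gamma> i $ b" for n b
  define leaves where "leaves n \<longleftrightarrow> (\<exists>b. 3 * int K \<le> \<bar>d n b\<bar>)" for n
  have "\<exists>n. leaves n"
  proof -
    define \<eta> where "\<eta> n = \<gamma> (i + n) - \<gamma> i" for n
    have "inj \<eta>" 
    proof (rule injI)
      fix a b assume "\<eta> a = \<eta> b"
      then have "i + a = i + b" by (intro injD[OF inj]) (simp add: \<eta>_def)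
      then show "a = b" by simp
    qed
    then obtain n where "\<eta> n \<notin> int_box (3 * K)" using inj_leaves_int_box by blast
    then obtain b where "3 * int K < \<bar>d n b\<bar>" by (auto simp: int_box_def \<eta>_def d_def not_le)
    then show ?thesis unfolding leaves_def by (intro exI[of _ n] exI[of _ b]) simp
  qed
  then obtain L where L: "leaves L" "\<And>n. n < L \<Longrightarrow> \<not> leaves n"
    using exists_least_iff[of leaves] by blast
  obtain c where c: "3 * int K \<le> \<bar>d L c\<bar>" using L(1) by (auto simp: leaves_def)
  define s where "s = (if d L c \<ge> 0 then 1 else - 1 :: int)"
  have s: "\<bar>s\<bar> = 1" "s * s = 1" by (auto simp: s_def)
  have sd: "s * d L c = \<bar>d L c\<bar>" by (auto simp: s_def)
  have step: "\<bar>s * d (Suc n) c - s * d n c\<bar> \<le> 1" for n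
  proof -
    have "adjacent (\<gamma> (i + n)) (\<gamma> (Suc (i + n)))" using path by (simp add: infinite_path_def)
    from adjacent_component[OF this, of c] show ?thesis
      by (auto simp: d_def s_def)
  qed
  have "\<exists>n. (n < L \<or> n = 0) \<and> s * d n c = 3 * int k" if k: "k < K" for k
  proof -
    have "\<exists>n. 0 \<le> n \<and> n \<le> L \<and> s * d n c = 3 * int k"
      by (rule nat_intermed_int_val) (use step c k sd in \<open>auto simp: d_def\<close>)
    then obtain n where n: "n \<le> L" "s * d n c = 3 * int k" by auto
    then have "n \<noteq> L" using c k sd by auto
    with n show ?thesis by (intro exI[of _ n]) simp
  qed
  then obtain n where n: "\<And>k. k < K \<Longrightarrow> (n k < L \<or> n k = 0) \<and> s * d (n k) c = 3 * int k" by metis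
  \<comment> \<open>\<open>n 0\<close> may be a later return to the starting hyperplane;
    \<open>l 0\<close> is set to \<open>i\<close> because \<open>near_choice\<close> measures
    offsets from the first site.\<close>
  define l where "l k = (if k = 0 then i else i + n k)" for k
  show ?thesis
  proof (rule that[OF s(1)])
    fix k assume k: "k < K"
    have "d (n k) c = s * (3 * int k)" using n[OF k] s(2) by (metis mult.assoc mult_1)
    then show "\<gamma> (l k) $ c = \<gamma> i $ c + s * (3 * int k)" by (auto simp: l_def d_def)
    have "\<bar>d (n k) b\<bar> \<le> 3 * int K" for b
      using n[OF k] L(2)[of "n k"] by (cases "n k = 0") (auto simp: leaves_def d_def not_le intro: less_imp_le)
    then show "\<gamma> (l k) - \<gamma> i \<in> int_box (3 * K)" by (auto simp: int_box_def l_def d_def)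
  qed (simp add: l_def)
qed

context fpp
begin

text \<open>The route has four pieces: from \<open>v\<close> on the path along direction
  \<open>j\<close> to a point \<open>v'\<close> with a good line in direction \<open>a0\<close>;
  along that line to \<open>p\<close>; along a good stair to \<open>p'\<close>; and along the
  \<open>a0\<close>-line of \<open>u k3\<close> to the axis. The stair is only good after a
  translation along \<open>a0\<close>, so both of its ends must be reachable by good
  \<open>a0\<close>-lines. The costs are \<open>1 + 1 + dimension + 1\<close> times
  \<open>line_const * m\<close>.\<close>

lemma route_to_axis:
  assumes w: "nonneg_weights w" and near: "near_choice w (q + 4) m" and stair: "stair_choice w (q + 4) m"
    and path: "infinite_path \<gamma>" and inj: "inj \<gamma>" and m: "3 * num_choices \<le> m"
    and x: "\<And>b. \<bar>\<gamma> i $ b + axis j (int (q * m)) $ b\<bar> \<le> 2 * int m"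
  obtains l k where "k < num_choices"
    "passage_time w (\<gamma> l) (axis j (- int (q * m + 3 * k))) \<le> (real dimension + 3) * (line_const * real m)"
    "\<gamma> l $ j \<le> 3 * int m - int (q * m)"
proof -
  let ?K = num_choices
  have ax0: "axis b 0 = (0 :: int ^ 'd)" for b by simp
  define a0 where "a0 = side j"
  have a0: "a0 \<noteq> j" unfolding a0_def by (rule side_neq)
  have Km: "3 * int ?K \<le> int m" using m by linarith
  define C where "C = line_const * real m"
  have C: "C \<ge> 0" using line_const_nonneg by (simp add: C_def)
  have box: "y \<in> int_box ((q + 4) * m)" if "\<And>b. \<bar>y $ b + axis j (int (q * m)) $ b\<bar> \<le> 4 * int m" for y :: "int ^ 'd"
  proof -
    have "\<bar>y $ b\<bar> \<le> int ((q + 4) * m)" for b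
    proof -
      have "int ((q + 4) * m) = int (q * m) + 4 * int m" by (simp add: algebra_simps)
      moreover have "axis j (int (q * m)) $ b = 0 \<or> axis j (int (q * m)) $ b = int (q * m)"
        by (simp add: axis_def)
      moreover have "0 \<le> int (q * m)" by (rule of_nat_0_le_iff)
      ultimately show ?thesis using that[of b] by linarith
    qed
    then show ?thesis by (simp add: int_box_def)
  qed
  obtain c s l where cs: "\<bar>s\<bar> = 1" "\<And>k. k < ?K \<Longrightarrow> \<gamma> (l k) $ c = \<gamma> i $ c + s * (3 * int k)"
    "\<And>k. k < ?K \<Longrightarrow> \<gamma> (l k) - \<gamma> i \<in> int_box (3 * ?K)" "l 0 = i"
    by (rule path_crosses_hyperplanes[OF path inj, of ?K i]) blast
  \<comment> \<open>If the crossed hyperplanes are orthogonal to \<open>j\<close>, a good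
    \<open>a0\<close>-line is available at once and \<open>v' = v\<close>. Otherwise a good
    \<open>j\<close>-line comes first, whose points provide separated \<open>a0\<close>-lines to
    choose from.\<close>
  define d1 where "d1 = (if c = j then a0 else j)"
  have "c \<noteq> d1" using a0 by (auto simp: d1_def)
  moreover have "\<gamma> (l 0) \<in> int_box ((q + 4) * m)"
    unfolding cs(4) by (rule box, rule order.trans[OF x]) simp
  moreover have "3 \<le> \<bar>\<gamma> (l k) $ c - \<gamma> (l k') $ c\<bar>" if "k < k'" "k' < ?K" for k k'
    using cs(1) cs(2)[of k] cs(2)[of k'] that by (auto simp: abs_if split: if_splits)
  ultimately obtain k1 where k1: "k1 < ?K" "good_line w m (\<gamma> (l k1)) d1"
    using near[unfolded near_choice_def, rule_format, of c d1 "\<lambda>k. \<gamma> (l k)"] cs(3,4) by auto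
  define v where "v = \<gamma> (l k1)"
  have v: "\<bar>v $ b + axis j (int (q * m)) $ b\<bar> \<le> 3 * int m" for b
    using x[of b] cs(3)[OF k1(1)] Km by (auto simp: int_box_def v_def dest!: spec[of _ b])
  obtain k2 where k2: "k2 < ?K" "passage_time w v (v + axis j (3 * int k2)) \<le> C"
    "good_line w m (v + axis j (3 * int k2)) a0"
  proof (cases "c = j")
    case True
    then have "good_line w m v a0" using k1 by (simp add: d1_def v_def)
    then show ?thesis using C
      by (intro that[of 0]) (simp_all add: passage_time_refl[OF w] num_choices_def ax0)
  next
    case False
    have v0: "v + axis j (3 * int 0) = v" by (simp add: axis_def vec_eq_iff)
    have "\<exists>k<?K. good_line w m (v + axis j (3 * int k)) a0"
    proof (rule near[unfolded near_choice_def, rule_format, of j a0 "\<lambda>k. v + axis j (3 * int k)"])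
      show "v + axis j (3 * int 0) \<in> int_box ((q + 4) * m)"
        unfolding v0 by (rule box, rule order.trans[OF v]) simp
    qed (use a0 in \<open>auto simp: int_box_def axis_def\<close>)
    then obtain k where k: "k < ?K" "good_line w m (v + axis j (3 * int k)) a0" by blast
    have "good_line w m v j" using k1 False by (simp add: d1_def v_def)
    from good_line_passage_time[OF w this, of 0 "3 * int k"] k Km
    have "passage_time w v (v + axis j (3 * int k)) \<le> C"
      by (simp add: C_def ax0)
    with k show ?thesis by (intro that)
  qed
  define v' where "v' = v + axis j (3 * int k2)"
  have v': "\<bar>v' $ b + axis j (int (q * m)) $ b\<bar> \<le> 4 * int m" for b
    using v[of b] k2(1) Km by (auto simp: v'_def axis_def)
  define u where "u k = (axis j (- int (q * m + 3 * k)) :: int ^ 'd)" for k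
  have "\<exists>k<?K. good_line w m (u k) a0"
  proof (rule near[unfolded near_choice_def, rule_format, of j a0 u])
    show "u 0 \<in> int_box ((q + 4) * m)" by (rule box) (auto simp: u_def axis_def)
  qed (use a0 in \<open>auto simp: int_box_def axis_def u_def\<close>)
  then obtain k3 where k3: "k3 < ?K" "good_line w m (u k3) a0" by blast
  \<comment> \<open>The axis point is moved along its \<open>a0\<close>-line into the hyperplane of
    \<open>v'\<close>, as a stair needs ends with equal coordinate \<open>a0\<close>.\<close>
  define y where "y = u k3 + axis a0 (v' $ a0)"
  have y: "\<bar>y $ b + axis j (int (q * m)) $ b\<bar> \<le> 4 * int m" for b
    using v'[of a0] a0 k3(1) Km by (auto simp: y_def u_def axis_def)
  have ya: "v' $ a0 = y $ a0" using a0 by (simp add: y_def u_def axis_def)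
  obtain k4 where k4: "k4 < ?K"
    "good_stair w m a0 (v' + axis a0 (3 * int k4)) (y + axis a0 (3 * int k4))"
    using stair[unfolded stair_choice_def] box[OF v'] box[OF y] ya by blast
  define p where "p = v' + axis a0 (3 * int k4)"
  define p' where "p' = y + axis a0 (3 * int k4)"
  have "passage_time w p p' \<le> real dimension * C"
    unfolding C_def
  proof (rule good_stair_passage_time[OF w])
    show "good_stair w m a0 p p'" using k4 by (simp add: p_def p'_def)
    show "p $ a0 = p' $ a0" using ya by (simp add: p_def p'_def)
    show "\<bar>p' $ b - p $ b\<bar> \<le> 8 * int m" for b
      using v'[of b] y[of b] by (simp add: p_def p'_def)
  qed
  moreover have "passage_time w v' p \<le> C"
  proof -
    have "good_line w m v' a0" using k2(3) by (simp add: v'_def)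
    then show ?thesis
      using good_line_passage_time[OF w, of m v' a0 0 "3 * int k4"] k4(1) Km by (simp add: C_def p_def ax0)
  qed
  moreover have "passage_time w p' (u k3) \<le> C"
  proof -
    have "u k3 + axis a0 (v' $ a0 + 3 * int k4) = p'"
      by (simp add: p'_def y_def axis_def vec_eq_iff)
    moreover have "\<bar>v' $ a0 + 3 * int k4\<bar> \<le> 8 * int m"
      using v'[of a0] a0 k4(1) Km by (auto simp: axis_def)
    ultimately show ?thesis
      using good_line_passage_time[OF w k3(2), of "v' $ a0 + 3 * int k4" 0] by (simp add: C_def ax0)
  qed
  moreover have "passage_time w v v' \<le> C" using k2(2) by (simp add: v'_def)
  ultimately have "passage_time w v (u k3) \<le> (real dimension + 3) * C"
    using passage_time_triangle[OF w, of v "u k3" v'] passage_time_triangle[OF w, of v' "u k3" p]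
      passage_time_triangle[OF w, of p "u k3" p'] by (simp add: algebra_simps)
  moreover have "v $ j \<le> 3 * int m - int (q * m)" using v[of j] by (simp add: axis_def)
  ultimately show ?thesis using k3(1) that[of k3 "l k1"] by (simp add: v_def u_def C_def)
qed

text \<open>The deterministic core: a direction in the cone would force
  \<open>s n \<le> - (c / 2) * n\<close> for infinitely many \<open>n\<close>, contradicting the
  excluded drift at rate \<open>c / 4\<close>.\<close>

lemma directions_avoid_backward_cone:
  assumes pos: "pos_weights w" and uniq: "unique_geodesics w"
    and c: "c > 0" and growth: "linear_growth w c x0" and q: "q > 0"
    and q_large: "1 \<le> c * real q / 2 - 7 / 2 * c - (real dimension + 3) * line_const"
    and near: "\<forall>\<^sub>F m in sequentially. near_choice w (q + 4) m"
    and stair: "\<forall>\<^sub>F m in sequentially. stair_choice w (q + 4) m"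
    and bus: "\<And>k. (\<lambda>n. passage_time w (axis j (- int k)) (axis j (int n)) -
      passage_time w (axis j 0) (axis j (int n))) \<longlonglongrightarrow> s k"
    and drift: "\<not> neg_drift s (c / 4)"
    and lim: "is_limit_geodesic w j x0 \<gamma>"
  shows "asymptotic_directions \<gamma> \<inter> {z \<in> sphere 0 1. norm (z + axis j 1) < 1 / real q} = {}"
proof (rule ccontr)
  assume "\<not> ?thesis"
  then obtain z where z: "z \<in> asymptotic_directions \<gamma>" "norm (z + axis j 1) < 1 / real q" by blast
  have w: "nonneg_weights w" using pos by (rule pos_imp_nonneg_weights)
  have inj: "inj \<gamma>" by (rule limit_geodesic_inj[OF pos uniq lim])
  have path: "infinite_path \<gamma>" using lim by (simp add: is_limit_geodesic_def)
  obtain r where r: "\<And>y. r \<le> l1_norm (x0 - y) \<Longrightarrow> c * real_of_int (l1_norm (x0 - y)) \<le> passage_time w x0 y"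
    using passage_time_lower_bound[OF w c growth] by blast
  obtain m0 where m0: "\<And>m. m \<ge> m0 \<Longrightarrow> near_choice w (q + 4) m \<and> stair_choice w (q + 4) m"
    using eventually_conj[OF near stair] by (auto simp: eventually_sequentially)
  define B where "B = c * real_of_int \<bar>x0 $ j\<bar> + passage_time w x0 (axis j 0)"
  \<comment> \<open>This makes the margin in \<open>neg_drift\<close> at most \<open>c / 4\<close>,
    so that a drift of rate \<open>c / 2\<close> suffices.\<close>
  define k0 where "k0 = nat \<lceil>4 / c\<rceil>"
  have k0: "1 / real (Suc k0) \<le> c / 4"
  proof -
    have "4 / c \<le> real (Suc k0)" unfolding k0_def using c by linarith
    then show ?thesis using c by (simp add: field_simps)
  qed
  have q3: "q > 3"
  proof -
    have "0 \<le> (real dimension + 3) * line_const" using line_const_nonneg by simp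
    then have "0 < c * (real q / 2 - 7 / 2)" using q_large by (simp add: algebra_simps)
    then show ?thesis using c by (simp add: zero_less_mult_iff)
  qed
  have "neg_drift s (c / 4)" unfolding neg_drift_def
  proof (rule exI[of _ k0], rule allI)
    fix M
    \<comment> \<open>The entries serve, in turn, to make \<open>n\<close> large, to have good
      choices of lines, to keep offsets below \<open>m\<close>, to absorb the fixed cost
      \<open>B\<close>, and to bring \<open>v\<close> into the range of the linear lower
      bound.\<close>
    define N where "N = Max {M, m0, 3 * num_choices, nat \<lceil>B\<rceil>, nat (r + \<bar>x0 $ j\<bar>)}"
    obtain i m where m: "N \<le> m" and x: "\<And>b. \<bar>\<gamma> i $ b + axis j (int (q * m)) $ b\<bar> \<le> 2 * int m"
      using direction_visits[OF inj z q, of N] by blast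
    have mN: "M \<le> m" "m0 \<le> m" "3 * num_choices \<le> m" "nat \<lceil>B\<rceil> \<le> m" "nat (r + \<bar>x0 $ j\<bar>) \<le> m"
      using m unfolding N_def by simp_all
    obtain l k where lk: "k < num_choices"
      "passage_time w (\<gamma> l) (axis j (- int (q * m + 3 * k))) \<le> (real dimension + 3) * (line_const * real m)"
      "\<gamma> l $ j \<le> 3 * int m - int (q * m)"
      using route_to_axis[OF w _ _ path inj mN(3) x] m0[OF mN(2)] by blast
    define n where "n = q * m + 3 * k"
    define v where "v = \<gamma> l"
    have far: "(int q - 3) * int m - \<bar>x0 $ j\<bar> \<le> l1_norm (x0 - v)"
      using component_le_l1_norm[of "x0 - v" j] lk(3) by (simp add: v_def algebra_simps)
    have "int m \<le> (int q - 3) * int m" 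
      using q3 mult_right_mono[of 1 "int q - 3" "int m"] by simp
    then have "r \<le> l1_norm (x0 - v)" using far mN(5) by linarith
    then have "c * real_of_int (l1_norm (x0 - v)) \<le> passage_time w x0 v" by (rule r)
    moreover have "c * real_of_int ((int q - 3) * int m - \<bar>x0 $ j\<bar>) \<le> c * real_of_int (l1_norm (x0 - v))"
      using far c by (intro mult_left_mono) (auto simp only: of_int_le_iff)
    ultimately have lower: "c * ((real q - 3) * real m) - c * real_of_int \<bar>x0 $ j\<bar> \<le> passage_time w x0 v"
      by (simp add: algebra_simps)
    \<comment> \<open>Towards a far axis point the time from \<open>x0\<close> splits exactly at
      \<open>v\<close>, while the time from \<open>- n\<close> is at most that through
      \<open>v\<close>. The last summand replaces the reference point \<open>x0\<close> by the
      origin.\<close>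
    have "s n \<le> passage_time w (axis j (- int n)) v - passage_time w x0 v + passage_time w x0 (axis j 0)"
    proof (rule LIMSEQ_le_const2[OF bus])
      have "\<forall>\<^sub>F N in sequentially. passage_time w (axis j (- int n)) (axis j (int N)) -
          passage_time w (axis j 0) (axis j (int N)) \<le>
          passage_time w (axis j (- int n)) v - passage_time w x0 v + passage_time w x0 (axis j 0)"
        using limit_geodesic_additive[OF pos uniq lim, of l]
      proof eventually_elim
        case (elim N)
        then show ?case
          using passage_time_triangle[OF w, of "axis j (- int n)" "axis j (int N)" v]
            passage_time_triangle[OF w, of x0 "axis j (int N)" "axis j 0"]
          by (simp add: v_def)
      qed
      then show "\<exists>N. \<forall>n'\<ge>N. passage_time w (axis j (- int n)) (axis j (int n')) -
          passage_time w (axis j 0) (axis j (int n')) \<le>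
          passage_time w (axis j (- int n)) v - passage_time w x0 v + passage_time w x0 (axis j 0)"
        by (simp add: eventually_sequentially)
    qed
    then have "s n \<le> (real dimension + 3) * (line_const * real m) - c * ((real q - 3) * real m) + B"
      using lk(2) lower passage_time_sym[of w "axis j (- int n)" v] by (simp add: n_def v_def B_def)
    \<comment> \<open>Between \<open>c * (q - 3)\<close> and \<open>c / 2 * (q + 1)\<close> there is
      a gap of \<open>c * q / 2 - 7 / 2 * c\<close>; by \<open>q_large\<close> it covers the cost of
      the route and leaves at least \<open>m\<close>, which covers \<open>B\<close>.\<close>
    also have "\<dots> \<le> - (c / 2) * ((real q + 1) * real m)"
    proof -
      have "B \<le> real m" using mN(4) by linarith
      also have "\<dots> \<le> (c * real q / 2 - 7 / 2 * c - (real dimension + 3) * line_const) * real m"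
        using mult_right_mono[OF q_large, of "real m"] by simp
      finally show ?thesis by (simp add: algebra_simps)
    qed
    also have "\<dots> \<le> - (c / 2) * real n"
    proof -
      have "real n \<le> (real q + 1) * real m"
        using lk(1) mN(3) by (simp add: n_def algebra_simps)
      then show ?thesis using c by simp
    qed
    also have "\<dots> \<le> - (c / 4 + 1 / real (Suc k0)) * real n"
      using k0 by (intro mult_right_mono) auto
    finally have "s n \<le> - (c / 4 + 1 / real (Suc k0)) * real n" .
    moreover have "M \<le> n" using mN(1) q by (simp add: n_def) (metis le_trans mult_le_mono1 nat_mult_1 Suc_leI One_nat_def trans_le_add1)
    ultimately show "\<exists>n\<ge>M. s n \<le> - (c / 4 + 1 / real (Suc k0)) * real n" by blast
  qed
  with drift show False by simp
qed

end

section \<open>Geodesics avoid the backward direction\<close>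

text \<open>Elements of the product space are \<open>undefined\<close> outside \<open>edges\<close>;
  this and the next two lemmas allow the given weights to be replaced by their restriction.\<close>

lemma is_geodesic_restrict: "is_geodesic (restrict w edges) = is_geodesic w"
proof (intro ext)
  fix x y p
  have "passage_time (restrict w edges) x y = passage_time w x y"
    by (rule passage_time_cong) simp
  moreover have "path_time (restrict w edges) p = path_time w p" if "path_from_to x y p"
    using that by (intro path_time_cong) auto
  ultimately show "is_geodesic (restrict w edges) x y p = is_geodesic w x y p"
    by (auto simp: is_geodesic_def)
qed

lemma is_limit_geodesic_restrict: "is_limit_geodesic (restrict w edges) = is_limit_geodesic w"
  unfolding is_limit_geodesic_def[abs_def] geodesic_def[abs_def] is_geodesic_restrict ..

lemma limit_geodesic_restrict: "limit_geodesic (restrict w edges) = limit_geodesic w"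
  unfolding limit_geodesic_def[abs_def] is_limit_geodesic_restrict ..

text \<open>\<open>measure F {s<..} ^ (2 * d)\<close> is the probability that the minimum of
  \<open>2 * d\<close> copies exceeds \<open>s\<close>, at most \<open>E / s ^ d\<close> by Markov's
  inequality. The root of order \<open>2 * d\<close> gives the exponent 1/2 in every
  dimension.\<close>

lemma tail_from_min_moment:
  fixes F :: "real measure"
  assumes F: "prob_space F" "sets F = sets borel" "AE s in F. 0 \<le> s" and d: "d > 0"
    and moment: "integrable (PiM {1..2 * d} (\<lambda>_. F)) (\<lambda>s. (Min (s ` {1..2 * d})) ^ d)"
  obtains A where "\<And>s. s > 0 \<Longrightarrow> measure F {s<..} \<le> A * s powr (-1/2)"
proof -
  let ?I = "{1..2 * d}"
  let ?Q = "PiM ?I (\<lambda>_. F)"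
  interpret F: prob_space F by fact
  interpret product_sigma_finite "\<lambda>_ :: nat. F" ..
  interpret Q: prob_space ?Q by (rule prob_space_PiM) (rule F(1))
  define E where "E = (\<integral>s. (Min (s ` ?I)) ^ d \<partial>?Q)"
  have I: "finite ?I" "?I \<noteq> {}" using d by auto
  have AE_comp: "AE w in ?Q. \<forall>i\<in>?I. 0 \<le> w i"
    unfolding AE_ball_countable[OF countable_finite[OF I(1)]]
    using F by (auto intro: AE_PiM_component)
  have nonneg: "AE w in ?Q. 0 \<le> (Min (w ` ?I)) ^ d"
    using AE_comp
  proof eventually_elim
    case (elim w)
    then have "0 \<le> Min (w ` ?I)" using I by (subst Min_ge_iff) auto
    then show ?case by simp
  qed
  have E: "E \<ge> 0" unfolding E_def by (rule integral_nonneg_AE[OF nonneg])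
  have "measure F {s<..} \<le> (1 + E) * s powr (-1/2)" if s: "s > 0" for s
  proof -
    have box: "PiE ?I (\<lambda>_. {s<..}) \<in> sets ?Q"
      using I F by (intro sets_PiM_I_finite) auto
    have "measure F {s<..} ^ (2 * d) = measure ?Q (PiE ?I (\<lambda>_. {s<..}))"
    proof -
      have "emeasure ?Q (PiE ?I (\<lambda>_. {s<..})) = (\<Prod>i\<in>?I. emeasure F {s<..})"
        using I F by (intro emeasure_PiM) auto
      then have "emeasure ?Q (PiE ?I (\<lambda>_. {s<..})) = ennreal (measure F {s<..} ^ (2 * d))"
        by (simp add: F.emeasure_eq_measure ennreal_power)
      then show ?thesis by (intro measure_eq_emeasure_eq_ennreal[symmetric]) simp_all
    qed
    also have "\<dots> \<le> measure ?Q {w\<in>space ?Q. s ^ d \<le> (Min (w ` ?I)) ^ d}"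
    proof (rule Q.finite_measure_mono)
      show "PiE ?I (\<lambda>_. {s<..}) \<subseteq> {w\<in>space ?Q. s ^ d \<le> (Min (w ` ?I)) ^ d}"
      proof
        fix w assume w: "w \<in> PiE ?I (\<lambda>_. {s<..})"
        then have "s \<le> Min (w ` ?I)" using I by (subst Min_ge_iff) (auto dest!: PiE_mem intro: less_imp_le)
        moreover have "w \<in> space ?Q" using box w sets.sets_into_space by blast
        ultimately show "w \<in> {w\<in>space ?Q. s ^ d \<le> (Min (w ` ?I)) ^ d}"
          using s by (simp add: power_mono)
      qed
      show "{w\<in>space ?Q. s ^ d \<le> (Min (w ` ?I)) ^ d} \<in> sets ?Q"
        using borel_measurable_integrable[OF moment] by measurable
    qed
    also have "\<dots> \<le> E / s ^ d"
      unfolding E_def using s by (intro integral_Markov_inequality_measure[OF moment, of "{}"] nonneg) auto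
    also have "\<dots> \<le> ((1 + E) * s powr (-1/2)) ^ (2 * d)"
    proof -
      have "(s powr (-1/2)) ^ (2 * d) = s powr (- real d)" using s d by (simp add: powr_power)
      also have "\<dots> = 1 / s ^ d" using s by (simp add: powr_minus powr_realpow divide_inverse)
      finally have "(s powr (-1/2)) ^ (2 * d) = 1 / s ^ d" .
      \<comment> \<open>\<open>1 + E\<close> replaces the root of order \<open>2 * d\<close> of
        \<open>E\<close> in the constant.\<close>
      moreover have "E \<le> (1 + E) ^ (2 * d)"
        using E d self_le_power[of "1 + E" "2 * d"] by simp
      ultimately show ?thesis using s by (simp only: power_mult_distrib) (simp add: divide_right_mono)
    qed
    finally show ?thesis
      using E d by (subst (asm) power_mono_iff) auto
  qed
  then show ?thesis by (rule that)
qed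

text \<open>The Cauchy criterion makes the event measurable, which allows its almost-sure validity
  to be carried from the original space to \<open>P\<close>.\<close>

lemma (in fpp) convergent_measurable:
  "{w\<in>space P. convergent (\<lambda>n. busemann_approx k n w)} \<in> sets P"
  unfolding Cauchy_convergent_iff[symmetric] Cauchy_iff2 busemann_approx_def by measurable

theorem theorem6p2:
  fixes M :: "'a measure"
    and F :: "real measure"
    and t :: "(int ^ 'd) set \<Rightarrow> 'a \<Rightarrow> real"
    and j :: "'d::finite"
  assumes dim: "CARD('d) \<ge> 2"
    and prob: "prob_space M"
    and indep: "prob_space.indep_vars M (\<lambda>_. borel) t edges"
    and distr: "\<And>e. e \<in> edges \<Longrightarrow> distr M borel (t e) = F"
    and nonneg: "\<And>e. e \<in> edges \<Longrightarrow> AE \<omega> in M. 0 \<le> t e \<omega>"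
    and moment: "integrable (PiM {1..2 * CARD('d)} (\<lambda>_. F))
      (\<lambda>s. (Min (s ` {1..2 * CARD('d)})) ^ CARD('d))"
    and continuous: "\<And>a. measure F {a} = 0"
    and LimG: "AE \<omega> in M.
      (\<forall>x. \<exists>\<gamma>. is_limit_geodesic (\<lambda>e. t e \<omega>) j x \<gamma>) \<and>
      (\<forall>x y. coalesce (limit_geodesic (\<lambda>e. t e \<omega>) j x) (limit_geodesic (\<lambda>e. t e \<omega>) j y))"
  shows "\<exists>\<delta>>0. \<forall>x. AE \<omega> in M.
    asymptotic_directions (limit_geodesic (\<lambda>e. t e \<omega>) j x) \<inter>
      {z \<in> sphere 0 1. norm (z + axis j 1) < \<delta>} = {}"
proof -
  interpret M: prob_space M by (rule prob)
  define e0 where "e0 = {0 + axis j 1, 0 :: int ^ 'd}"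
  have e0: "e0 \<in> edges" unfolding e0_def edge_iff by (rule adjacent_axis) simp
  have t [measurable]: "t e \<in> borel_measurable M" if "e \<in> edges" for e
    using indep that by (auto simp: M.indep_vars_def)
  have sets_F: "sets F = sets borel" using distr[OF e0] by auto
  have prob_F: "prob_space F" using M.prob_space_distr[OF t[OF e0]] distr[OF e0] by simp
  interpret F: prob_space F by (rule prob_F)
  have "AE s in distr M borel (t e0). 0 \<le> s"
    using nonneg[OF e0] t[OF e0] by (subst AE_distr_iff) auto
  then have nonneg_F: "AE s in F. 0 \<le> s" unfolding distr[OF e0] .
  have "AE s in F. s \<notin> {0}"
    using continuous[of 0] sets_F by (intro AE_not_in) (simp add: null_sets_def F.emeasure_eq_measure)
  with nonneg_F have pos_F: "AE s in F. 0 < s" by eventually_elim simp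
  obtain A where A: "\<And>s. s > 0 \<Longrightarrow> measure F {s<..} \<le> A * s powr (-1/2)"
    using tail_from_min_moment[OF prob_F sets_F nonneg_F zero_less_card_finite moment] by blast
  interpret fpp F A j "CARD('d)"
    by unfold_locales (use sets_F prob_F pos_F continuous A dim in auto)
  \<comment> \<open>The weights as a random element of the product space; by independence its law is
    \<open>P\<close>.\<close>
  define \<Phi> where "\<Phi> \<omega> = (\<lambda>e\<in>edges. t e \<omega>)" for \<omega>
  have \<Phi>_borel: "distr M (PiM edges (\<lambda>_. borel)) \<Phi> = P"
  proof -
    have "distr M (PiM edges (\<lambda>_. borel)) \<Phi> = PiM edges (\<lambda>e. distr M borel (t e))"
      using M.indep_vars_iff_distr_eq_PiM'[OF edges_nonempty, where M' = "\<lambda>_. borel" and X = t] indep t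
      unfolding \<Phi>_def by auto
    also have "\<dots> = P" by (rule PiM_cong) (simp_all add: distr)
    finally show ?thesis .
  qed
  have sets_P: "sets P = sets (PiM edges (\<lambda>_. borel))"
    by (rule sets_PiM_cong) (simp_all add: sets_F)
  have \<Phi>: "\<Phi> \<in> M \<rightarrow>\<^sub>M P"
    unfolding \<Phi>_def measurable_cong_sets[OF refl sets_P] by (intro measurable_restrict t)
  have \<Phi>_distr: "distr M P \<Phi> = P"
    using distr_cong[OF refl sets_P, of M \<Phi> \<Phi>] \<Phi>_borel by simp
  have AE_\<Phi>: "AE \<omega> in M. Q (\<Phi> \<omega>)" if "AE w in P. Q w" for Q
    using that by (intro AE_distrD[OF \<Phi>]) (simp only: \<Phi>_distr)
  have LimG': "AE \<omega> in M. (\<forall>x. is_limit_geodesic (\<Phi> \<omega>) j x (limit_geodesic (\<Phi> \<omega>) j x)) \<and>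
      (\<forall>x y. coalesce (limit_geodesic (\<Phi> \<omega>) j x) (limit_geodesic (\<Phi> \<omega>) j y))"
    if reg: "AE w in P. pos_weights w \<and> unique_geodesics w"
    using LimG AE_\<Phi>[OF reg]
  proof eventually_elim
    case (elim \<omega>)
    then show ?case
      using limit_geodesic_unique[of "\<Phi> \<omega>" j]
      unfolding \<Phi>_def is_limit_geodesic_restrict limit_geodesic_restrict by metis
  qed
  obtain c where c: "c > 0"
    and reg: "AE w in P. pos_weights w \<and> unique_geodesics w \<and> (\<forall>x. linear_growth w c x)"
    using AE_regular by blast
  have reg': "AE w in P. pos_weights w \<and> unique_geodesics w" using reg by eventually_elim simp
  have "AE \<omega> in M. convergent (\<lambda>n. busemann_approx 0 n (\<Phi> \<omega>))"
    using LimG'[OF reg'] AE_\<Phi>[OF reg']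
  proof eventually_elim
    case (elim \<omega>)
    then show ?case unfolding busemann_approx_def by (intro busemann_limit_exists) auto
  qed
  \<comment> \<open>Of the limit hypothesis only this measurable consequence is transferred to
    \<open>P\<close>; the limits and their coalescence are used on the original space again at the
    end.\<close>
  then have conv: "AE w in P. convergent (\<lambda>n. busemann_approx 0 n w)"
    using AE_distr_iff[OF \<Phi> convergent_measurable[of 0]] unfolding \<Phi>_distr by blast
  define L where "L = (real (CARD('d)) + 3) * line_const"
  \<comment> \<open>The least integer satisfying \<open>q_large\<close>. It depends only on
    \<open>c\<close>, the dimension and \<open>line_const\<close>, so the same \<open>1 / q\<close>
    serves for all \<open>x\<close>.\<close>
  define q where "q = nat \<lceil>2 * (1 + 7 / 2 * c + L) / c\<rceil>"
  have "0 \<le> L" using line_const_nonneg by (simp add: L_def)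
  then have q_pos: "0 < 2 * (1 + 7 / 2 * c + L) / c" using c by (intro divide_pos_pos) auto
  have q_ge: "2 * (1 + 7 / 2 * c + L) / c \<le> real q" unfolding q_def by linarith
  then have q: "q > 0" using q_pos by linarith
  have q_large: "1 \<le> c * real q / 2 - 7 / 2 * c - (real (CARD('d)) + 3) * line_const"
    using q_ge c unfolding L_def[symmetric] by (simp add: field_simps)
  have R: "q + 4 > 0" by simp
  have drift: "AE w in P. \<not> neg_drift (\<lambda>n. \<Sum>i<n. busemann_step i w) (c / 4)"
    by (rule AE_no_neg_drift[OF conv]) (use c in simp)
  have all: "AE w in P. (\<forall>x. linear_growth w c x) \<and> pos_weights w \<and> unique_geodesics w \<and>
      (\<forall>\<^sub>F m in sequentially. near_choice w (q + 4) m) \<and>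
      (\<forall>\<^sub>F m in sequentially. stair_choice w (q + 4) m) \<and>
      (\<forall>k. (\<lambda>n. passage_time w (axis j (- int k)) (axis j (int n)) -
        passage_time w (axis j 0) (axis j (int n))) \<longlonglongrightarrow> (\<Sum>i<k. busemann_step i w)) \<and>
      \<not> neg_drift (\<lambda>n. \<Sum>i<n. busemann_step i w) (c / 4)"
    using reg AE_near_choice[OF R] AE_stair_choice[OF R] AE_busemann_sum[OF conv] drift
    by eventually_elim blast
  have "AE \<omega> in M. asymptotic_directions (limit_geodesic (\<lambda>e. t e \<omega>) j x) \<inter>
      {z \<in> sphere 0 1. norm (z + axis j 1) < 1 / real q} = {}" for x
    using AE_\<Phi>[OF all] LimG'[OF reg']
  proof eventually_elim
    case (elim \<omega>)
    have "limit_geodesic (\<lambda>e. t e \<omega>) = limit_geodesic (\<Phi> \<omega>)"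
      unfolding \<Phi>_def by (rule limit_geodesic_restrict[symmetric])
    then show ?case
      using elim directions_avoid_backward_cone[OF _ _ c _ q q_large, of "\<Phi> \<omega>" x
        "\<lambda>k. \<Sum>i<k. busemann_step i (\<Phi> \<omega>)" "limit_geodesic (\<Phi> \<omega>) j x"] by auto
  qed
  then show ?thesis using q by (intro exI[of _ "1 / real q"]) auto
qed

end
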